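(* Let $G$ be a compact (Hausdorff) group, let $\Omega$ be an additively written $\mathbb Z$-torsion-free procyclic group with a fixed topological generator $\omega$, and let $d:G\to\Omega$ be a surjective continuous homomorphism. Let $\mathfrak E$ be an unramified $G$-spectrum, i.e. $\mathfrak E\le\mathrm{Sp}(G)^{\mathrm{ur}}$, and let $(C,v)$ be an unramified Fesenko--Neukirch datum on $\mathfrak E$. For each $H\in\mathfrak E^\flat_{\mathrm b}$ let $\pi_H\in C(H)$ be a prime element with respect to $v$. Then for each $(H,U)\in\mathfrak E_{\mathrm b}$ the assignment $$\Upsilon_{(H,U)}:\pi_{\mathfrak K}(H,U)=H/U\to C(H)/\mathrm{ind}^C_{H,U}C(U),\qquad \varphi_{H|U}^k\mapsto\pi_H^k\bmod\mathrm{ind}^C_{H,U}C(U)\quad(k\in\mathbb Z)$$ is a (well-defined) homomorphism of abelian groups which is independent of the choice of the prime element, and the family $\Upsilon=\{\Upsilon_{(H,U)}\mid(H,U)\in\mathfrak E_{\mathrm b}\}$ defines an isomorphism $\Upsilon:\pi_{\mathfrak K}\to\widehat{\mathrm H}^0_{\mathfrak E}(C)$ in $\mathsf{Fct}(\mathfrak E,\mathsf{Ab})$.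
   Context: ${}^gH=gHg^{-1}$, $H^g=g^{-1}Hg$. RIC-functors. A RIC-domain $\mathfrak D$ consists of a non-empty set $\mathfrak D_{\mathrm b}$ with a left action $(g,x)\mapsto{}^gx$ of a group $G$ and, for each $x\in\mathfrak D_{\mathrm b}$, subsets $\mathfrak D_{\mathrm r}(x),\mathfrak D_{\mathrm i}(x)\subseteq\mathfrak D_{\mathrm b}$ such that for $\star\in\{\mathrm r,\mathrm i\}$: $x\in\mathfrak D_\star(x)$; $y\in\mathfrak D_\star(x)$ implies $\mathfrak D_\star(y)\subseteq\mathfrak D_\star(x)$; ${}^g\mathfrak D_\star(x)=\mathfrak D_\star({}^gx)$. A RIC-functor $\Phi:\mathfrak D\to\mathcal C$ consists of objects $\Phi(x)$ and morphisms $\mathrm{res}_{y,x}:\Phi(x)\to\Phi(y)$ ($y\in\mathfrak D_{\mathrm r}(x)$), $\mathrm{ind}_{x,y}:\Phi(y)\to\Phi(x)$ ($y\in\mathfrak D_{\mathrm i}(x)$), $\mathrm{con}_{g,x}:\Phi(x)\to\Phi({}^gx)$ such that $\mathrm{res}_{x,x}=\mathrm{ind}_{x,x}=\mathrm{con}_{1,x}=\mathrm{id}$; $\mathrm{res}_{z,y}\mathrm{res}_{y,x}=\mathrm{res}_{z,x}$, $\mathrm{ind}_{x,y}\mathrm{ind}_{y,z}=\mathrm{ind}_{x,z}$, $\mathrm{con}_{g',{}^gx}\mathrm{con}_{g,x}=\mathrm{con}_{g'g,x}$; $\mathrm{con}_{g,y}\mathrm{res}_{y,x}=\mathrm{res}_{{}^gy,{}^gx}\mathrm{con}_{g,x}$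 and $\mathrm{con}_{g,x}\mathrm{ind}_{x,y}=\mathrm{ind}_{{}^gx,{}^gy}\mathrm{con}_{g,y}$. Morphisms are families $(\varphi_x)$ commuting with res, ind, con; the category is $\mathsf{Fct}(\mathfrak D,\mathcal C)$. Subgroup systems and Mackey functors. A $G$-subgroup system is a RIC-domain $\mathfrak S$ where $\mathfrak S_{\mathrm b}$ is a set of subgroups of $G$ with the conjugation action and $I\le H$ for $I\in\mathfrak S_\star(H)$; $\mathfrak S'\le\mathfrak S$ means $\mathfrak S'_{\mathrm b}\subseteq\mathfrak S_{\mathrm b}$, $\mathfrak S'_\star(H)\subseteq\mathfrak S_\star(H)$. It is a $G$-Mackey system if for $I\in\mathfrak S_{\mathrm r}(H)$, $J\in\mathfrak S_{\mathrm i}(H)$ the set $I\backslash H/J$ is finite, $I\cap J\in\mathfrak S_{\mathrm r}(J)$ and $I\cap J\in\mathfrak S_{\mathrm i}(I)$. A Mackey functor $C:\mathfrak M\to\mathsf{Ab}$ on a Mackey system is a RIC-functor with $\mathrm{con}_{h,H}=\mathrm{id}$ for $h\in H$ and $\mathrm{res}_{I,H}\mathrm{ind}_{H,J}=\sum_{h}\mathrm{ind}_{I,I\cap{}^hJ}\,\mathrm{con}_{h,I^h\cap J}\,\mathrm{res}_{I^h\cap J,J}$ ($h$ over representatives of $I\backslash H/J$). Groups $C(H)$ are written multiplicatively. Ramification. For closed subgroups $K\le H$ of $G$: $I_H=H\cap\ker d$, $f_{H|K}=[d(H):d(K)]$, $f_H=f_{G|H}$, $e_{H|K}=[I_H:I_K]$.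 $H$ is inertially finite if it is closed and $f_H<\infty$. For such $H$, $d(H)=f_H\Omega$ and $d_H=\frac1{f_H}d|_H:H\to\Omega$ is surjective with kernel $I_H$. For $U$ a closed normal subgroup of $H$ with $I_H\le U$, the Frobenius element $\varphi_{H|U}\in H/U$ is the image of any $h\in H$ with $d_H(h)=\omega$; if $U$ is open, it generates the finite cyclic group $H/U$. A $G$-subgroup system is inertially finite if all its members are inertially finite closed subgroups and $[H:I]<\infty$ for $I\in\mathfrak S_{\mathrm r}(H)$. Spectra. A two-dimensional $G$-subgroup system is a RIC-domain $\mathfrak E$ with $\mathfrak E_{\mathrm b}$ a set of pairs $(H,U)$ ($H$ closed subgroup of $G$, $U$ closed normal subgroup of $H$) with componentwise conjugation and $I\le H$, $V\le U$ for $(I,V)\in\mathfrak E_\star(H,U)$. $\mathfrak E^\flat_{\mathrm b}$ is the set of first components of $\mathfrak E_{\mathrm b}$, $\mathrm{Ext}(\mathfrak E,H)=\{U:(H,U)\in\mathfrak E_{\mathrm b}\}$, $\mathfrak E^\flat_\star(H)$ the set of first components of $\bigcup_U\mathfrak E_\star(H,U)$. $\mathfrak E$ is a $G$-spectrum if $\mathfrak E^\flat$ is a $G$-subgroup system, $(I,V)\in\mathfrak E_{\mathrm r}(H,U)$ implies $V=U$, and $[H:I]<\infty$ for $I\in\mathfrak E^\flat_{\mathrm r}(H)$. $\mathfrak E\le\mathrm{Sp}(G)^{\mathrm{ur}}$ means: for all $(H,U)\in\mathfrak E_{\mathrm b}$, $H$ is inertially finite and $U$ is an open normal subgroup of $H$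 with $I_H\le U$. A Mackey cover of $\mathfrak E$ is a $G$-Mackey system $\mathfrak M$ with $\mathfrak E^\flat\le\mathfrak M$, $\mathrm{Ext}(\mathfrak E,H)\subseteq\mathfrak M_{\mathrm i}(H)$, and $V\in\mathfrak M_{\mathrm i}(U)$ whenever $(I,V)\in\mathfrak E_{\mathrm i}(H,U)$. Valuations. For an inertially finite $\mathfrak M$ let $\boldsymbol\Omega_d\in\mathsf{Fct}(\mathfrak M,\mathsf{Ab})$ be: $\boldsymbol\Omega_d(H)=\Omega$, con $=\mathrm{id}$, $\mathrm{res}_{K,H}$ = multiplication by $e_{H|K}$, $\mathrm{ind}_{H,K}$ = multiplication by $f_{H|K}$. $\mathrm{Val}_d^{\Omega,\omega}(C)$ is the set of morphisms $v:C\to\boldsymbol\Omega_d$ with $\omega\in\mathrm{im}(v_H)$ for all $H\in\mathfrak M_{\mathrm b}$. A prime element of $C(H)$ is $\pi\in C(H)$ with $v_H(\pi)=\omega$. Unramified Fesenko--Neukirch datum on $\mathfrak E$: a pair $(C,v)$ with $C:\mathfrak M\to\mathsf{Ab}$ a Mackey functor on an inertially finite Mackey cover $\mathfrak M$ of $\mathfrak E$ and $v\in\mathrm{Val}_d^{\Omega,\omega}(C)$ such that for each $(H,U)\in\mathfrak E_{\mathrm b}$: (a) $\mathrm{im}(v_H)/[H:U]\,\mathrm{im}(v_U)$ has order $[H:U]$ and is generated by the image of $\omega$; (b) $\mathrm{ind}^C_{H,U}:\ker(v_U)\to\ker(v_H)$ is surjective; (c) $|C(H)/\mathrm{ind}^C_{H,U}C(U)|\le[H:U]$.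 Functors. $\pi_{\mathfrak K}\in\mathsf{Fct}(\mathfrak E,\mathsf{Ab})$: $\pi_{\mathfrak K}(H,U)=(H/U)^{\mathrm{ab}}=H/U$, con induced by conjugation, ind induced by inclusion, $\mathrm{res}_{(I,U),(H,U)}$ the group-theoretic transfer $H/U\to I/U$. $\widehat{\mathrm H}^0_{\mathfrak E}(C)\in\mathsf{Fct}(\mathfrak E,\mathsf{Ab})$: $(H,U)\mapsto C(H)/\mathrm{ind}^C_{H,U}C(U)$ with structure maps induced by those of $C$ on first components (well defined). *)

theory Defs
  imports "HOL-Analysis.Analysis" "HOL-Algebra.Algebra"
begin

section \<open>Groups and topological groups\<close>

text \<open>
  All groups are carrier-based. The subgroup \<open>H\<close> of \<open>G\<close>, regarded as a group, is
  \<open>G\<lparr>carrier := H\<rparr>\<close>, and \<open>H/U\<close> is \<open>(G\<lparr>carrier := H\<rparr>) Mod U\<close>, whose elements are the cosets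
  \<open>U #> h\<close> with \<open>h \<in> H\<close>. Abelian groups are written multiplicatively throughout; in particular
  for the additively written group \<open>\<Omega>\<close> of the mathematical text, \<open>n x\<close> becomes \<open>x [^] n\<close>.
\<close>

abbreviation quot_group :: "'g monoid \<Rightarrow> 'g set \<Rightarrow> 'g set \<Rightarrow> 'g set monoid" where
  "quot_group G H U \<equiv> (G\<lparr>carrier := H\<rparr>) Mod U"

definition finite_index :: "'g monoid \<Rightarrow> 'g set \<Rightarrow> 'g set \<Rightarrow> bool" where
  "finite_index G H K \<longleftrightarrow> finite (rcosets\<^bsub>G\<lparr>carrier := H\<rparr>\<^esub> K)"

text \<open>The index \<open>[H : K]\<close>; it is \<open>0\<close> if the index is infinite.\<close>

definition sub_index :: "'g monoid \<Rightarrow> 'g set \<Rightarrow> 'g set \<Rightarrow> nat" where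
  "sub_index G H K = card (rcosets\<^bsub>G\<lparr>carrier := H\<rparr>\<^esub> K)"

definition conj_set :: "'g monoid \<Rightarrow> 'g \<Rightarrow> 'g set \<Rightarrow> 'g set" where
  "conj_set G g H = g <#\<^bsub>G\<^esub> H #>\<^bsub>G\<^esub> (inv\<^bsub>G\<^esub> g)"

definition conj_pair :: "'g monoid \<Rightarrow> 'g \<Rightarrow> 'g set \<times> 'g set \<Rightarrow> 'g set \<times> 'g set" where
  "conj_pair G g = (\<lambda>(H, U). (conj_set G g H, conj_set G g U))"

text \<open>The double coset \<open>I h J\<close>, and the sets of representatives for \<open>I \ H / J\<close>.\<close>

definition dcoset :: "'g monoid \<Rightarrow> 'g set \<Rightarrow> 'g \<Rightarrow> 'g set \<Rightarrow> 'g set" where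
  "dcoset G I h J = (I #>\<^bsub>G\<^esub> h) <#>\<^bsub>G\<^esub> J"

definition dcoset_reps :: "'g monoid \<Rightarrow> 'g set \<Rightarrow> 'g set \<Rightarrow> 'g set \<Rightarrow> 'g set \<Rightarrow> bool" where
  "dcoset_reps G I H J R \<longleftrightarrow>
     R \<subseteq> H \<and> bij_betw (\<lambda>h. dcoset G I h J) R ((\<lambda>h. dcoset G I h J) ` H)"

text \<open>
  The transfer \<open>A \<rightarrow> B\<close> for an abelian subgroup \<open>B\<close> of finite index in \<open>A\<close>: for a left transversal
  \<open>T\<close> write \<open>a t = t\<^sub>a b\<^sub>t\<close> with \<open>t\<^sub>a \<in> T\<close> and \<open>b\<^sub>t \<in> B\<close>; then \<open>a\<close> is sent to the
  product of the \<open>b\<^sub>t\<close>. It does not depend on the choice of \<open>T\<close>.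
\<close>

definition left_transversal :: "'a monoid \<Rightarrow> 'a set \<Rightarrow> 'a set \<Rightarrow> bool" where
  "left_transversal A B T \<longleftrightarrow>
     T \<subseteq> carrier A \<and> (\<forall>a\<in>carrier A. \<exists>!t. t \<in> T \<and> a \<in> t <#\<^bsub>A\<^esub> B)"

definition transfer_map :: "'a monoid \<Rightarrow> 'a set \<Rightarrow> 'a \<Rightarrow> 'a" where
  "transfer_map A B a =
     (let T = (SOME T. left_transversal A B T);
          rep = (\<lambda>x. THE t. t \<in> T \<and> x \<in> t <#\<^bsub>A\<^esub> B)
      in finprod (A\<lparr>carrier := B\<rparr>)
           (\<lambda>t. inv\<^bsub>A\<^esub> (rep (a \<otimes>\<^bsub>A\<^esub> t)) \<otimes>\<^bsub>A\<^esub> (a \<otimes>\<^bsub>A\<^esub> t)) T)"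

text \<open>
  If \<open>f : A \<rightarrow> B\<close> maps \<open>N\<close> into \<open>N'\<close>, then \<open>quot_map B N' f\<close> is the induced map
  \<open>A/N \<rightarrow> B/N'\<close>: on the coset \<open>x = N a\<close> it has the value \<open>N' f(x) = N' f(a)\<close>.
\<close>

definition quot_map :: "'b monoid \<Rightarrow> 'b set \<Rightarrow> ('a \<Rightarrow> 'b) \<Rightarrow> 'a set \<Rightarrow> 'b set" where
  "quot_map B N' f x = N' <#>\<^bsub>B\<^esub> (f ` x)"

definition topological_grp :: "'g monoid \<Rightarrow> 'g topology \<Rightarrow> bool" where
  "topological_grp G T \<longleftrightarrow>
     group G \<and> topspace T = carrier G \<and>
     continuous_map (prod_topology T T) T (\<lambda>(x, y). x \<otimes>\<^bsub>G\<^esub> y) \<and>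
     continuous_map T T (\<lambda>x. inv\<^bsub>G\<^esub> x)"

definition compact_grp :: "'g monoid \<Rightarrow> 'g topology \<Rightarrow> bool" where
  "compact_grp G T \<longleftrightarrow> topological_grp G T \<and> compact_space T \<and> Hausdorff_space T"

definition profinite_grp :: "'g monoid \<Rightarrow> 'g topology \<Rightarrow> bool" where
  "profinite_grp G T \<longleftrightarrow> compact_grp G T \<and> (\<forall>S. connectedin T S \<longrightarrow> (\<exists>a. S \<subseteq> {a}))"

definition top_generator :: "'g monoid \<Rightarrow> 'g topology \<Rightarrow> 'g \<Rightarrow> bool" where
  "top_generator G T x \<longleftrightarrow> x \<in> carrier G \<and> T closure_of (generate G {x}) = carrier G"

text \<open>A torsion-free procyclic group with a distinguished topological generator.\<close>

definition torsion_free_procyclic :: "'w monoid \<Rightarrow> 'w topology \<Rightarrow> 'w \<Rightarrow> bool" where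
  "torsion_free_procyclic \<Omega> T\<Omega> \<omega> \<longleftrightarrow>
     comm_group \<Omega> \<and> profinite_grp \<Omega> T\<Omega> \<and> top_generator \<Omega> T\<Omega> \<omega> \<and>
     (\<forall>x\<in>carrier \<Omega>. \<forall>n::nat. n > 0 \<longrightarrow> x [^]\<^bsub>\<Omega>\<^esub> n = \<one>\<^bsub>\<Omega>\<^esub> \<longrightarrow> x = \<one>\<^bsub>\<Omega>\<^esub>)"

definition closed_subgroup :: "'g monoid \<Rightarrow> 'g topology \<Rightarrow> 'g set \<Rightarrow> bool" where
  "closed_subgroup G T H \<longleftrightarrow> subgroup H G \<and> closedin T H"


section \<open>RIC-domains and RIC-functors to abelian groups\<close>

text \<open>
  The left action of \<open>G\<close> is a separate parameter \<open>act\<close>, since the systems below carry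
  conjugation actions. Only the values of \<open>res_dom\<close> and \<open>ind_dom\<close> at points of \<open>pts\<close> are relevant.
\<close>

record 'x ric_domain =
  pts :: "'x set"
  res_dom :: "'x \<Rightarrow> 'x set"
  ind_dom :: "'x \<Rightarrow> 'x set"

definition is_ric_domain :: "'g monoid \<Rightarrow> ('g \<Rightarrow> 'x \<Rightarrow> 'x) \<Rightarrow> 'x ric_domain \<Rightarrow> bool" where
  "is_ric_domain G act D \<longleftrightarrow>
     pts D \<noteq> {} \<and>
     group_action G (pts D) (\<lambda>g. restrict (act g) (pts D)) \<and>
     (\<forall>S \<in> {res_dom D, ind_dom D}. \<forall>x\<in>pts D.
        S x \<subseteq> pts D \<and> x \<in> S x \<and> (\<forall>y\<in>S x. S y \<subseteq> S x) \<and>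
        (\<forall>g\<in>carrier G. act g ` S x = S (act g x)))"

text \<open>\<open>res_map y x\<close>, \<open>ind_map x y\<close> and \<open>con_map g x\<close> have their indices in the order of
  \<open>res\<^bsub>y,x\<^esub> : \<Phi>(x) \<rightarrow> \<Phi>(y)\<close>, \<open>ind\<^bsub>x,y\<^esub> : \<Phi>(y) \<rightarrow> \<Phi>(x)\<close> and
  \<open>con\<^bsub>g,x\<^esub> : \<Phi>(x) \<rightarrow> \<Phi>(act g x)\<close>.\<close>

record ('g, 'x, 'c) ric_functor =
  obj_grp :: "'x \<Rightarrow> 'c monoid"
  res_map :: "'x \<Rightarrow> 'x \<Rightarrow> 'c \<Rightarrow> 'c"
  ind_map :: "'x \<Rightarrow> 'x \<Rightarrow> 'c \<Rightarrow> 'c"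
  con_map :: "'g \<Rightarrow> 'x \<Rightarrow> 'c \<Rightarrow> 'c"

text \<open>The objects of \<open>Fct(D, Ab)\<close>.\<close>

definition is_ric_functor ::
  "'g monoid \<Rightarrow> ('g \<Rightarrow> 'x \<Rightarrow> 'x) \<Rightarrow> 'x ric_domain \<Rightarrow> ('g, 'x, 'c) ric_functor \<Rightarrow> bool" where
  "is_ric_functor G act D \<Phi> \<longleftrightarrow>
     (\<forall>x\<in>pts D. comm_group (obj_grp \<Phi> x)) \<and>
     (\<forall>x\<in>pts D. \<forall>y\<in>res_dom D x. res_map \<Phi> y x \<in> hom (obj_grp \<Phi> x) (obj_grp \<Phi> y)) \<and>
     (\<forall>x\<in>pts D. \<forall>y\<in>ind_dom D x. ind_map \<Phi> x y \<in> hom (obj_grp \<Phi> y) (obj_grp \<Phi> x)) \<and>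
     (\<forall>x\<in>pts D. \<forall>g\<in>carrier G. con_map \<Phi> g x \<in> hom (obj_grp \<Phi> x) (obj_grp \<Phi> (act g x))) \<and>
     (\<forall>x\<in>pts D. \<forall>a\<in>carrier (obj_grp \<Phi> x).
        res_map \<Phi> x x a = a \<and> ind_map \<Phi> x x a = a \<and> con_map \<Phi> \<one>\<^bsub>G\<^esub> x a = a) \<and>
     (\<forall>x\<in>pts D. \<forall>y\<in>res_dom D x. \<forall>z\<in>res_dom D y. \<forall>a\<in>carrier (obj_grp \<Phi> x).
        res_map \<Phi> z y (res_map \<Phi> y x a) = res_map \<Phi> z x a) \<and>
     (\<forall>x\<in>pts D. \<forall>y\<in>ind_dom D x. \<forall>z\<in>ind_dom D y. \<forall>a\<in>carrier (obj_grp \<Phi> z).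
        ind_map \<Phi> x y (ind_map \<Phi> y z a) = ind_map \<Phi> x z a) \<and>
     (\<forall>x\<in>pts D. \<forall>g\<in>carrier G. \<forall>g'\<in>carrier G. \<forall>a\<in>carrier (obj_grp \<Phi> x).
        con_map \<Phi> g' (act g x) (con_map \<Phi> g x a) = con_map \<Phi> (g' \<otimes>\<^bsub>G\<^esub> g) x a) \<and>
     (\<forall>x\<in>pts D. \<forall>y\<in>res_dom D x. \<forall>g\<in>carrier G. \<forall>a\<in>carrier (obj_grp \<Phi> x).
        con_map \<Phi> g y (res_map \<Phi> y x a) = res_map \<Phi> (act g y) (act g x) (con_map \<Phi> g x a)) \<and>
     (\<forall>x\<in>pts D. \<forall>y\<in>ind_dom D x. \<forall>g\<in>carrier G. \<forall>a\<in>carrier (obj_grp \<Phi> y).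
        con_map \<Phi> g x (ind_map \<Phi> x y a) = ind_map \<Phi> (act g x) (act g y) (con_map \<Phi> g y a))"

text \<open>The morphisms and isomorphisms of \<open>Fct(D, Ab)\<close>.\<close>

definition ric_morphism ::
  "'g monoid \<Rightarrow> ('g \<Rightarrow> 'x \<Rightarrow> 'x) \<Rightarrow> 'x ric_domain \<Rightarrow> ('g, 'x, 'c) ric_functor \<Rightarrow>
   ('g, 'x, 'e) ric_functor \<Rightarrow> ('x \<Rightarrow> 'c \<Rightarrow> 'e) \<Rightarrow> bool" where
  "ric_morphism G act D \<Phi> \<Psi> \<phi> \<longleftrightarrow>
     is_ric_functor G act D \<Phi> \<and> is_ric_functor G act D \<Psi> \<and>
     (\<forall>x\<in>pts D. \<phi> x \<in> hom (obj_grp \<Phi> x) (obj_grp \<Psi> x)) \<and>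
     (\<forall>x\<in>pts D. \<forall>y\<in>res_dom D x. \<forall>a\<in>carrier (obj_grp \<Phi> x).
        \<phi> y (res_map \<Phi> y x a) = res_map \<Psi> y x (\<phi> x a)) \<and>
     (\<forall>x\<in>pts D. \<forall>y\<in>ind_dom D x. \<forall>a\<in>carrier (obj_grp \<Phi> y).
        \<phi> x (ind_map \<Phi> x y a) = ind_map \<Psi> x y (\<phi> y a)) \<and>
     (\<forall>x\<in>pts D. \<forall>g\<in>carrier G. \<forall>a\<in>carrier (obj_grp \<Phi> x).
        \<phi> (act g x) (con_map \<Phi> g x a) = con_map \<Psi> g x (\<phi> x a))"

definition ric_isomorphism ::
  "'g monoid \<Rightarrow> ('g \<Rightarrow> 'x \<Rightarrow> 'x) \<Rightarrow> 'x ric_domain \<Rightarrow> ('g, 'x, 'c) ric_functor \<Rightarrow>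
   ('g, 'x, 'e) ric_functor \<Rightarrow> ('x \<Rightarrow> 'c \<Rightarrow> 'e) \<Rightarrow> bool" where
  "ric_isomorphism G act D \<Phi> \<Psi> \<phi> \<longleftrightarrow>
     ric_morphism G act D \<Phi> \<Psi> \<phi> \<and>
     (\<exists>\<psi>. ric_morphism G act D \<Psi> \<Phi> \<psi> \<and>
        (\<forall>x\<in>pts D. (\<forall>a\<in>carrier (obj_grp \<Phi> x). \<psi> x (\<phi> x a) = a) \<and>
                    (\<forall>b\<in>carrier (obj_grp \<Psi> x). \<phi> x (\<psi> x b) = b)))"


section \<open>Subgroup systems and Mackey functors\<close>

definition subgroup_system :: "'g monoid \<Rightarrow> 'g set ric_domain \<Rightarrow> bool" where
  "subgroup_system G S \<longleftrightarrow>
     is_ric_domain G (conj_set G) S \<and>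
     (\<forall>H\<in>pts S. subgroup H G \<and> (\<forall>I \<in> res_dom S H \<union> ind_dom S H. I \<subseteq> H))"

definition subsystem :: "'g set ric_domain \<Rightarrow> 'g set ric_domain \<Rightarrow> bool" where
  "subsystem S' S \<longleftrightarrow>
     pts S' \<subseteq> pts S \<and> (\<forall>H\<in>pts S'. res_dom S' H \<subseteq> res_dom S H \<and> ind_dom S' H \<subseteq> ind_dom S H)"

definition mackey_system :: "'g monoid \<Rightarrow> 'g set ric_domain \<Rightarrow> bool" where
  "mackey_system G M \<longleftrightarrow>
     subgroup_system G M \<and>
     (\<forall>H\<in>pts M. \<forall>I\<in>res_dom M H. \<forall>J\<in>ind_dom M H.
        finite ((\<lambda>h. dcoset G I h J) ` H) \<and> I \<inter> J \<in> res_dom M J \<and> I \<inter> J \<in> ind_dom M I)"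

definition mackey_functor ::
  "'g monoid \<Rightarrow> 'g set ric_domain \<Rightarrow> ('g, 'g set, 'c) ric_functor \<Rightarrow> bool" where
  "mackey_functor G M C \<longleftrightarrow>
     is_ric_functor G (conj_set G) M C \<and>
     (\<forall>H\<in>pts M. \<forall>h\<in>H. \<forall>a\<in>carrier (obj_grp C H). con_map C h H a = a) \<and>
     (\<forall>H\<in>pts M. \<forall>I\<in>res_dom M H. \<forall>J\<in>ind_dom M H. \<forall>R. dcoset_reps G I H J R \<longrightarrow>
        (\<forall>a\<in>carrier (obj_grp C J).
           res_map C I H (ind_map C H J a) =
           finprod (obj_grp C I)
             (\<lambda>h. let K = conj_set G (inv\<^bsub>G\<^esub> h) I \<inter> J
                  in ind_map C I (I \<inter> conj_set G h J) (con_map C h K (res_map C K J a))) R))"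


section \<open>Ramification\<close>

definition inertia :: "'g monoid \<Rightarrow> 'w monoid \<Rightarrow> ('g \<Rightarrow> 'w) \<Rightarrow> 'g set \<Rightarrow> 'g set" where
  "inertia G \<Omega> d H = H \<inter> kernel G \<Omega> d"

text \<open>\<open>ram_f \<Omega> d H K\<close> is \<open>f\<^bsub>H|K\<^esub>\<close>, \<open>ram_e G \<Omega> d H K\<close> is \<open>e\<^bsub>H|K\<^esub>\<close> and
  \<open>abs_f G \<Omega> d H\<close> is \<open>f\<^sub>H = f\<^bsub>G|H\<^esub>\<close>.\<close>

definition ram_f :: "'w monoid \<Rightarrow> ('g \<Rightarrow> 'w) \<Rightarrow> 'g set \<Rightarrow> 'g set \<Rightarrow> nat" where
  "ram_f \<Omega> d H K = sub_index \<Omega> (d ` H) (d ` K)"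

definition ram_e :: "'g monoid \<Rightarrow> 'w monoid \<Rightarrow> ('g \<Rightarrow> 'w) \<Rightarrow> 'g set \<Rightarrow> 'g set \<Rightarrow> nat" where
  "ram_e G \<Omega> d H K = sub_index G (inertia G \<Omega> d H) (inertia G \<Omega> d K)"

definition abs_f :: "'g monoid \<Rightarrow> 'w monoid \<Rightarrow> ('g \<Rightarrow> 'w) \<Rightarrow> 'g set \<Rightarrow> nat" where
  "abs_f G \<Omega> d H = ram_f \<Omega> d (carrier G) H"

definition inertially_finite ::
  "'g monoid \<Rightarrow> 'g topology \<Rightarrow> 'w monoid \<Rightarrow> ('g \<Rightarrow> 'w) \<Rightarrow> 'g set \<Rightarrow> bool" where
  "inertially_finite G T \<Omega> d H \<longleftrightarrow>
     closed_subgroup G T H \<and> finite_index \<Omega> (d ` carrier G) (d ` H)"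

text \<open>\<open>d\<^sub>H(h) = (1/f\<^sub>H) d(h)\<close>: division by \<open>f\<^sub>H\<close> is unique as \<open>\<Omega>\<close> is torsion-free, and
  possible as \<open>d(H) = f\<^sub>H \<Omega>\<close>.\<close>

definition d_norm :: "'g monoid \<Rightarrow> 'w monoid \<Rightarrow> ('g \<Rightarrow> 'w) \<Rightarrow> 'g set \<Rightarrow> 'g \<Rightarrow> 'w" where
  "d_norm G \<Omega> d H h = (THE w. w \<in> carrier \<Omega> \<and> w [^]\<^bsub>\<Omega>\<^esub> abs_f G \<Omega> d H = d h)"

definition frobenius ::
  "'g monoid \<Rightarrow> 'w monoid \<Rightarrow> 'w \<Rightarrow> ('g \<Rightarrow> 'w) \<Rightarrow> 'g set \<Rightarrow> 'g set \<Rightarrow> 'g set" where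
  "frobenius G \<Omega> \<omega> d H U = (THE x. \<exists>h\<in>H. d_norm G \<Omega> d H h = \<omega> \<and> x = U #>\<^bsub>G\<^esub> h)"

definition inertially_finite_system ::
  "'g monoid \<Rightarrow> 'g topology \<Rightarrow> 'w monoid \<Rightarrow> ('g \<Rightarrow> 'w) \<Rightarrow> 'g set ric_domain \<Rightarrow> bool" where
  "inertially_finite_system G T \<Omega> d S \<longleftrightarrow>
     subgroup_system G S \<and>
     (\<forall>H\<in>pts S. inertially_finite G T \<Omega> d H \<and> (\<forall>I\<in>res_dom S H. finite_index G H I))"


section \<open>Spectra\<close>

definition two_dim_system ::
  "'g monoid \<Rightarrow> 'g topology \<Rightarrow> ('g set \<times> 'g set) ric_domain \<Rightarrow> bool" where
  "two_dim_system G T E \<longleftrightarrow>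
     is_ric_domain G (conj_pair G) E \<and>
     (\<forall>(H, U)\<in>pts E.
        closed_subgroup G T H \<and> closed_subgroup G T U \<and> U \<lhd> G\<lparr>carrier := H\<rparr> \<and>
        (\<forall>(I, V) \<in> res_dom E (H, U) \<union> ind_dom E (H, U). I \<subseteq> H \<and> V \<subseteq> U))"

definition Ext :: "('g set \<times> 'g set) ric_domain \<Rightarrow> 'g set \<Rightarrow> 'g set set" where
  "Ext E H = {U. (H, U) \<in> pts E}"

definition flat :: "('g set \<times> 'g set) ric_domain \<Rightarrow> 'g set ric_domain" where
  "flat E = \<lparr>pts = fst ` pts E,
             res_dom = (\<lambda>H. fst ` (\<Union>U\<in>Ext E H. res_dom E (H, U))),
             ind_dom = (\<lambda>H. fst ` (\<Union>U\<in>Ext E H. ind_dom E (H, U)))\<rparr>"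

definition spectrum ::
  "'g monoid \<Rightarrow> 'g topology \<Rightarrow> ('g set \<times> 'g set) ric_domain \<Rightarrow> bool" where
  "spectrum G T E \<longleftrightarrow>
     two_dim_system G T E \<and> subgroup_system G (flat E) \<and>
     (\<forall>(H, U)\<in>pts E. \<forall>(I, V)\<in>res_dom E (H, U). V = U) \<and>
     (\<forall>H\<in>pts (flat E). \<forall>I\<in>res_dom (flat E) H. finite_index G H I)"

definition unramified_spectrum ::
  "'g monoid \<Rightarrow> 'g topology \<Rightarrow> 'w monoid \<Rightarrow> ('g \<Rightarrow> 'w) \<Rightarrow>
   ('g set \<times> 'g set) ric_domain \<Rightarrow> bool" where
  "unramified_spectrum G T \<Omega> d E \<longleftrightarrow>
     spectrum G T E \<and>
     (\<forall>(H, U)\<in>pts E.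
        inertially_finite G T \<Omega> d H \<and> openin (subtopology T H) U \<and>
        U \<lhd> G\<lparr>carrier := H\<rparr> \<and> inertia G \<Omega> d H \<subseteq> U)"

definition mackey_cover ::
  "'g monoid \<Rightarrow> ('g set \<times> 'g set) ric_domain \<Rightarrow> 'g set ric_domain \<Rightarrow> bool" where
  "mackey_cover G E M \<longleftrightarrow>
     mackey_system G M \<and> subsystem (flat E) M \<and>
     (\<forall>H\<in>pts (flat E). Ext E H \<subseteq> ind_dom M H) \<and>
     (\<forall>(H, U)\<in>pts E. \<forall>(I, V)\<in>ind_dom E (H, U). V \<in> ind_dom M U)"


section \<open>Valuations and Fesenko--Neukirch data\<close>

definition omega_functor ::
  "'g monoid \<Rightarrow> 'w monoid \<Rightarrow> ('g \<Rightarrow> 'w) \<Rightarrow> ('g, 'g set, 'w) ric_functor" where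
  "omega_functor G \<Omega> d =
     \<lparr>obj_grp = (\<lambda>H. \<Omega>),
      res_map = (\<lambda>K H x. x [^]\<^bsub>\<Omega>\<^esub> ram_e G \<Omega> d H K),
      ind_map = (\<lambda>H K x. x [^]\<^bsub>\<Omega>\<^esub> ram_f \<Omega> d H K),
      con_map = (\<lambda>g H x. x)\<rparr>"

definition valuation ::
  "'g monoid \<Rightarrow> 'w monoid \<Rightarrow> 'w \<Rightarrow> ('g \<Rightarrow> 'w) \<Rightarrow> 'g set ric_domain \<Rightarrow>
   ('g, 'g set, 'c) ric_functor \<Rightarrow> ('g set \<Rightarrow> 'c \<Rightarrow> 'w) \<Rightarrow> bool" where
  "valuation G \<Omega> \<omega> d M C v \<longleftrightarrow>
     ric_morphism G (conj_set G) M C (omega_functor G \<Omega> d) v \<and>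
     (\<forall>H\<in>pts M. \<omega> \<in> v H ` carrier (obj_grp C H))"

definition prime_element ::
  "'w \<Rightarrow> ('g, 'g set, 'c) ric_functor \<Rightarrow> ('g set \<Rightarrow> 'c \<Rightarrow> 'w) \<Rightarrow> 'g set \<Rightarrow> 'c \<Rightarrow> bool" where
  "prime_element \<omega> C v H p \<longleftrightarrow> p \<in> carrier (obj_grp C H) \<and> v H p = \<omega>"

text \<open>The norm subgroup \<open>ind\<^bsub>H,U\<^esub> C(U)\<close> of \<open>C(H)\<close>.\<close>

definition norm_group :: "('g, 'g set, 'c) ric_functor \<Rightarrow> 'g set \<Rightarrow> 'g set \<Rightarrow> 'c set" where
  "norm_group C H U = ind_map C H U ` carrier (obj_grp C U)"

definition unramified_FN_datum ::
  "'g monoid \<Rightarrow> 'g topology \<Rightarrow> 'w monoid \<Rightarrow> 'w \<Rightarrow> ('g \<Rightarrow> 'w) \<Rightarrow>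
   ('g set \<times> 'g set) ric_domain \<Rightarrow> 'g set ric_domain \<Rightarrow>
   ('g, 'g set, 'c) ric_functor \<Rightarrow> ('g set \<Rightarrow> 'c \<Rightarrow> 'w) \<Rightarrow> bool" where
  "unramified_FN_datum G T \<Omega> \<omega> d E M C v \<longleftrightarrow>
     mackey_cover G E M \<and> inertially_finite_system G T \<Omega> d M \<and>
     mackey_functor G M C \<and> valuation G \<Omega> \<omega> d M C v \<and>
     (\<forall>(H, U)\<in>pts E.
        (let n = sub_index G H U;
             N = (\<lambda>x. x [^]\<^bsub>\<Omega>\<^esub> n) ` v U ` carrier (obj_grp C U);
             Q = quot_group \<Omega> (v H ` carrier (obj_grp C H)) N
         in order Q = n \<and> generate Q {N #>\<^bsub>\<Omega>\<^esub> \<omega>} = carrier Q) \<and>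
        ind_map C H U ` kernel (obj_grp C U) \<Omega> (v U) = kernel (obj_grp C H) \<Omega> (v H) \<and>
        finite (carrier (obj_grp C H Mod norm_group C H U)) \<and>
        order (obj_grp C H Mod norm_group C H U) \<le> sub_index G H U)"


section \<open>The two functors and the reciprocity morphism\<close>

text \<open>
  The functor \<open>(H, U) \<mapsto> H/U\<close> on an unramified spectrum, where \<open>H/U\<close> is cyclic and hence equal
  to its abelianization. Induction \<open>I/V \<rightarrow> H/U\<close> is \<open>V x \<mapsto> U V x = U x\<close>; restriction
  \<open>H/U \<rightarrow> I/U\<close> is the transfer.
\<close>

definition pi_functor :: "'g monoid \<Rightarrow> ('g, 'g set \<times> 'g set, 'g set) ric_functor" where
  "pi_functor G =
     \<lparr>obj_grp = (\<lambda>(H, U). quot_group G H U),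
      res_map = (\<lambda>(I, V) (H, U). transfer_map (quot_group G H U) (carrier (quot_group G I V))),
      ind_map = (\<lambda>(H, U) (I, V). quot_map G U (\<lambda>x. x)),
      con_map = (\<lambda>g (H, U). conj_set G g)\<rparr>"

definition H0_functor ::
  "'g monoid \<Rightarrow> ('g, 'g set, 'c) ric_functor \<Rightarrow> ('g, 'g set \<times> 'g set, 'c set) ric_functor" where
  "H0_functor G C =
     \<lparr>obj_grp = (\<lambda>(H, U). obj_grp C H Mod norm_group C H U),
      res_map = (\<lambda>(I, V) (H, U). quot_map (obj_grp C I) (norm_group C I V) (res_map C I H)),
      ind_map = (\<lambda>(H, U) (I, V). quot_map (obj_grp C H) (norm_group C H U) (ind_map C H I)),
      con_map = (\<lambda>g (H, U). quot_map (obj_grp C (conj_set G g H))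
                 (norm_group C (conj_set G g H) (conj_set G g U)) (con_map C g H))\<rparr>"

text \<open>The assignment \<open>\<phi>\<^bsub>H|U\<^esub>\<^sup>k \<mapsto> p\<^sup>k mod ind\<^bsub>H,U\<^esub> C(U)\<close> for a prime element \<open>p\<close> of \<open>C(H)\<close>.
  That it is well defined is part of the theorem.\<close>

definition upsilon ::
  "'g monoid \<Rightarrow> 'w monoid \<Rightarrow> 'w \<Rightarrow> ('g \<Rightarrow> 'w) \<Rightarrow> ('g, 'g set, 'c) ric_functor \<Rightarrow> 'c \<Rightarrow>
   'g set \<Rightarrow> 'g set \<Rightarrow> 'g set \<Rightarrow> 'c set" where
  "upsilon G \<Omega> \<omega> d C p H U x =
     (THE Y. \<exists>k::int. x = frobenius G \<Omega> \<omega> d H U [^]\<^bsub>quot_group G H U\<^esub> k \<and>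
                      Y = norm_group C H U #>\<^bsub>obj_grp C H\<^esub> (p [^]\<^bsub>obj_grp C H\<^esub> k))"

end

theory Submission
  imports Defs
begin

text \<open>
  Since \<open>\<Omega>\<close> is torsion-free and topologically generated by \<open>\<omega>\<close>, its subgroups of finite index \<open>n\<close>
  are exactly \<open>n\<Omega>\<close>, so for \<open>I\<^sub>H \<subseteq> U\<close> the degree map identifies \<open>H/U\<close> with the cyclic group
  \<open>f\<^sub>H\<Omega>/f\<^sub>U\<Omega>\<close> of order \<open>n = [H:U]\<close> generated by Frobenius. On the other side, elements of \<open>C(H)\<close>
  whose valuations differ by a multiple of \<open>n\<omega>\<close> agree modulo norms: the \<open>n\<close>-th power of a prime
  element is the norm of a prime element of \<open>C(U)\<close> up to \<open>ker v\<^sub>H\<close>, and \<open>ker v\<^sub>H\<close> consists of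
  norms. This gives well-definedness and independence of the prime element; condition (a) gives
  injectivity and condition (c) surjectivity. Naturality holds because the structure maps of both
  functors have the same effect on degrees and on valuations, the transfer between cyclic groups
  being the power map by the index. The functor laws for \<open>\<pi>\<close> are not checked separately: they are
  transported from \<open>H\<^sup>0\<close> along the bijections \<open>\<Upsilon>\<close>.
\<close>

section \<open>Indices, quotients and the transfer\<close>

text \<open>Integer exponents drive every argument. A class in \<open>H/U\<close> has a
  representative of degree \<open>k f_H \<omega>\<close>, the power \<open>\<pi>_H^k\<close> has
  valuation \<open>k \<omega>\<close>, and \<open>k\<close> matters only modulo
  \<open>[H:U]\<close>. In these terms conjugation and restriction keep \<open>k\<close>, while
  induction from \<open>I\<close> to \<open>H\<close> multiplies it by \<open>f_{H|I}\<close>. Two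
  obstacles shape the work. A degree need not be an integer multiple of \<open>\<omega>\<close>, so
  representatives have to be corrected by elements of \<open>U\<close>; this rests on compactness of
  \<Omega> and density of the multiples of \<open>\<omega>\<close>. And the chosen prime elements
  are not compatible with the structure maps of \<open>C\<close>, so nothing may depend on which
  element of a given valuation is used. Finiteness of \<open>[H:U]\<close> comes from
  \<open>f_U = f_H [H:U]\<close> and \<open>f_U > 0\<close>, since \<open>U\<close> is a point of
  the inertially finite Mackey system. The Mackey formula enters once, to show that restriction
  carries norms to norms.\<close>

lemma sub_index_mult:
  fixes G :: "'a monoid" (structure)
  assumes "group G" "subgroup A G" "subgroup B G" "subgroup K G" and BA: "B \<subseteq> A" and KB: "K \<subseteq> B"
  shows "sub_index G A K = sub_index G A B * sub_index G B K"
proof -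
  interpret group G by fact
  have rc: "rcosets\<^bsub>G\<lparr>carrier := Q\<rparr>\<^esub> Y = (\<lambda>x. Y #> x) ` Q" for Q Y
    by (auto simp: RCOSETS_def)
  interpret A: subgroup A G by fact
  interpret B: subgroup B G by fact
  interpret K: subgroup K G by fact
  \<comment> \<open>A representative of each coset of \<open>B\<close> in \<open>A\<close>. Every
    coset of \<open>K\<close> in \<open>A\<close> is then \<open>K b s(Q)\<close> for exactly one
    pair of cosets \<open>Q\<close> and \<open>K b\<close>. A bijection also settles infinite
    indices, where both sides take the default value \<open>0\<close>.\<close>
  define s where "s Q = (SOME a. a \<in> A \<and> Q = B #> a)" for Q
  have s: "s Q \<in> A \<and> Q = B #> s Q" if "Q \<in> (\<lambda>x. B #> x) ` A" for Q
    unfolding s_def by (rule someI_ex) (use that in blast)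
  have "bij_betw (\<lambda>(Q, Y). Y #> s Q) (((\<lambda>x. B #> x) ` A) \<times> ((\<lambda>x. K #> x) ` B)) ((\<lambda>x. K #> x) ` A)"
    unfolding bij_betw_def
  proof
    show "inj_on (\<lambda>(Q, Y). Y #> s Q) (((\<lambda>x. B #> x) ` A) \<times> ((\<lambda>x. K #> x) ` B))"
    proof (rule inj_onI, clarify)
      fix a b a' b' assume *: "a \<in> A" "b \<in> B" "a' \<in> A" "b' \<in> B"
        and eq: "K #> b #> s (B #> a) = K #> b' #> s (B #> a')"
      define t t' where "t = s (B #> a)" and "t' = s (B #> a')"
      have t: "t \<in> A" "B #> a = B #> t" "t' \<in> A" "B #> a' = B #> t'"
        using s[of "B #> a"] s[of "B #> a'"] * by (auto simp: t_def t'_def)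
      have car: "t \<in> carrier G" "t' \<in> carrier G" "b \<in> carrier G" "b' \<in> carrier G"
        using t * A.mem_carrier B.mem_carrier by auto
      have "b \<otimes> t \<in> K #> b #> t" using rcos_self[OF car(3) K.subgroup_axioms]
        by (auto simp: r_coset_def[of _ _ t])
      then have "b \<otimes> t \<in> K #> b' #> t'" using eq t_def t'_def by simp
      then obtain k where k: "k \<in> K" "b \<otimes> t = k \<otimes> b' \<otimes> t'" by (auto simp: r_coset_def)
      then have "k \<otimes> b' \<in> B" using * KB by auto
      then have "b \<otimes> t \<in> B #> t'" using k by (auto simp: r_coset_def)
      then have "B #> t' = B #> (b \<otimes> t)" using car(2) B.subgroup_axioms by (rule repr_independence)
      moreover have "b \<otimes> t \<in> B #> t" using * by (auto simp: r_coset_def)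
      then have "B #> t = B #> (b \<otimes> t)" using car(1) B.subgroup_axioms by (rule repr_independence)
      ultimately have "B #> t = B #> t'" by simp
      then have tt: "B #> a = B #> a'" using t by simp
      then have "t = t'" by (simp add: t_def t'_def)
      then have "K #> b #> t #> inv t = K #> b' #> t #> inv t" using eq t_def t'_def by simp
      then have "K #> b = K #> b'" using car by (simp add: coset_mult_assoc r_coset_subset_G m_assoc K.subset)
      then show "B #> a = B #> a' \<and> K #> b = K #> b'" using tt by simp
    qed
  next
    show "(\<lambda>(Q, Y). Y #> s Q) ` (((\<lambda>x. B #> x) ` A) \<times> ((\<lambda>x. K #> x) ` B)) = (\<lambda>x. K #> x) ` A"
    proof (intro equalityI subsetI)
      fix Z assume "Z \<in> (\<lambda>(Q, Y). Y #> s Q) ` (((\<lambda>x. B #> x) ` A) \<times> ((\<lambda>x. K #> x) ` B))"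
      then obtain a b where ab: "a \<in> A" "b \<in> B" "Z = K #> b #> s (B #> a)" by auto
      moreover have "s (B #> a) \<in> A" using s ab by auto
      ultimately have "Z = K #> (b \<otimes> s (B #> a))" "b \<otimes> s (B #> a) \<in> A"
        using BA by (auto simp: coset_mult_assoc K.subset)
      then show "Z \<in> (\<lambda>x. K #> x) ` A" by auto
    next
      fix Z assume "Z \<in> (\<lambda>x. K #> x) ` A"
      then obtain a where a: "a \<in> A" "Z = K #> a" by auto
      have sa: "s (B #> a) \<in> A" "B #> a = B #> s (B #> a)" using s[of "B #> a"] a by auto
      have "a \<in> B #> a" using a rcos_self[OF _ B.subgroup_axioms] by auto
      then obtain b where b: "b \<in> B" "a = b \<otimes> s (B #> a)"
        using sa by (auto simp: r_coset_def)
      then have "Z = K #> b #> s (B #> a)" using a sa by (simp add: coset_mult_assoc K.subset)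
      then have "Z = (\<lambda>(Q, Y). Y #> s Q) (B #> a, K #> b)" by simp
      moreover have "(B #> a, K #> b) \<in> ((\<lambda>x. B #> x) ` A) \<times> ((\<lambda>x. K #> x) ` B)"
        using a b by blast
      ultimately show "Z \<in> (\<lambda>(Q, Y). Y #> s Q) ` (((\<lambda>x. B #> x) ` A) \<times> ((\<lambda>x. K #> x) ` B))"
        by (rule image_eqI)
    qed
  qed
  from bij_betw_same_card[OF this] show ?thesis
    by (simp add: sub_index_def rc card_cartesian_product)
qed

text \<open>Links the setwise \<open>quot_map\<close> to representatives: in \<open>f (n a)\<close>
  the factor \<open>f n\<close> lies in \<open>N'\<close> and is absorbed. The maps of
  \<open>H0_functor\<close> and the induction of \<open>pi_functor\<close> are evaluated through
  it.\<close>

lemma quot_map_rcos: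
  assumes "group A" "group B" "subgroup N A" "subgroup N' B" "f \<in> hom A B" "f ` N \<subseteq> N'"
    "a \<in> carrier A"
  shows "quot_map B N' f (N #>\<^bsub>A\<^esub> a) = N' #>\<^bsub>B\<^esub> f a"
proof -
  interpret A: group A by fact
  interpret B: group B by fact
  interpret N: subgroup N A by fact
  interpret N': subgroup N' B by fact
  have fa: "f a \<in> carrier B" using assms(5,7) by (auto simp: hom_def)
  have "n' \<otimes>\<^bsub>B\<^esub> f (n \<otimes>\<^bsub>A\<^esub> a) = (n' \<otimes>\<^bsub>B\<^esub> f n) \<otimes>\<^bsub>B\<^esub> f a \<and> n' \<otimes>\<^bsub>B\<^esub> f n \<in> N'"
    if "n \<in> N" "n' \<in> N'" for n n'
  proof -
    have "f n \<in> N'" using that assms(6) by auto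
    moreover have "f (n \<otimes>\<^bsub>A\<^esub> a) = f n \<otimes>\<^bsub>B\<^esub> f a"
      using assms(5,7) that by (auto simp: hom_def)
    ultimately show ?thesis using that fa by (simp add: B.m_assoc)
  qed
  then have "quot_map B N' f (N #>\<^bsub>A\<^esub> a) \<subseteq> N' #>\<^bsub>B\<^esub> f a"
    unfolding quot_map_def set_mult_def r_coset_def by auto
  moreover have "N' #>\<^bsub>B\<^esub> f a \<subseteq> quot_map B N' f (N #>\<^bsub>A\<^esub> a)"
  proof -
    have "a \<in> N #>\<^bsub>A\<^esub> a" using assms(7) A.rcos_self N.subgroup_axioms by blast
    then show ?thesis unfolding quot_map_def set_mult_def r_coset_def[of B] by blast
  qed
  ultimately show ?thesis by blast
qed

section \<open>Products in subgroups and the transfer of abelian groups\<close>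

lemma (in comm_group) subgroup_imp_comm_group:
  assumes "subgroup B G"
  shows "comm_group (G\<lparr>carrier := B\<rparr>)"
proof -
  interpret B: subgroup B G by fact
  show ?thesis
    by (rule group.group_comm_groupI[OF subgroup_imp_group[OF assms]]) (simp add: m_comm)
qed

text \<open>The transfer is a product formed in \<open>B\<close> as a group of its own. Moving it to
  the ambient group allows multiplication with the representatives, which lie outside
  \<open>B\<close> in general. On an infinite index set both products default to the common
  unit.\<close>

lemma (in comm_group) finprod_subgroup:
  assumes "subgroup B G" "f \<in> S \<rightarrow> B"
  shows "finprod (G\<lparr>carrier := B\<rparr>) f S = finprod G f S"
proof -
  interpret B: subgroup B G by fact
  interpret GB: comm_group "G\<lparr>carrier := B\<rparr>"
    using subgroup_imp_comm_group[OF assms(1)] .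
  show ?thesis using assms(2)
  proof (induction S rule: infinite_finite_induct)
    case (insert x F)
    then have "f \<in> F \<rightarrow> B" "f x \<in> B" by auto
    moreover from this have "f \<in> F \<rightarrow> carrier G" "f x \<in> carrier G" using B.subset by auto
    ultimately show ?case using insert by (simp add: GB.finprod_insert finprod_insert)
  qed (simp_all add: GB.finprod_infinite GB.finprod_empty)
qed

lemma (in comm_group) finprod_mem_subgroup:
  assumes "subgroup B G" "f \<in> S \<rightarrow> B"
  shows "finprod G f S \<in> B"
proof -
  interpret GB: comm_group "G\<lparr>carrier := B\<rparr>"
    using subgroup_imp_comm_group[OF assms(1)] .
  show ?thesis using GB.finprod_closed[of f S] assms by (simp add: finprod_subgroup)
qed

text \<open>Guarantees that the \<open>SOME\<close> in \<open>transfer_map\<close> picks a genuine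
  transversal.\<close>

lemma left_transversal_exists:
  fixes G :: "'a monoid" (structure)
  assumes "group G" "subgroup B G"
  shows "\<exists>T. left_transversal G B T"
proof -
  interpret group G by fact
  interpret B: subgroup B G by fact
  define s where "s Q = (SOME a. a \<in> carrier G \<and> Q = a <#\<^bsub>G\<^esub> B)" for Q
  have s: "s (a <#\<^bsub>G\<^esub> B) \<in> carrier G \<and> a <#\<^bsub>G\<^esub> B = s (a <#\<^bsub>G\<^esub> B) <#\<^bsub>G\<^esub> B" if "a \<in> carrier G" for a
    unfolding s_def by (rule someI_ex) (use that in blast)
  have self: "a \<in> a <#\<^bsub>G\<^esub> B" if "a \<in> carrier G" for a
    using that B.one_closed by (auto simp: l_coset_def intro!: bexI[of _ \<one>])
  have "left_transversal G B (s ` (\<lambda>a. a <#\<^bsub>G\<^esub> B) ` carrier G)"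
    unfolding left_transversal_def
  proof (intro conjI ballI)
    show "s ` (\<lambda>a. a <#\<^bsub>G\<^esub> B) ` carrier G \<subseteq> carrier G" using s by auto
    fix a assume a: "a \<in> carrier G"
    show "\<exists>!t. t \<in> s ` (\<lambda>a. a <#\<^bsub>G\<^esub> B) ` carrier G \<and> a \<in> t <#\<^bsub>G\<^esub> B"
    proof (rule ex1I[of _ "s (a <#\<^bsub>G\<^esub> B)"])
      show "s (a <#\<^bsub>G\<^esub> B) \<in> s ` (\<lambda>a. a <#\<^bsub>G\<^esub> B) ` carrier G \<and> a \<in> s (a <#\<^bsub>G\<^esub> B) <#\<^bsub>G\<^esub> B"
        using a s[OF a] self[OF a] by auto
      fix t assume t: "t \<in> s ` (\<lambda>a. a <#\<^bsub>G\<^esub> B) ` carrier G \<and> a \<in> t <#\<^bsub>G\<^esub> B"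
      then obtain a' where a': "a' \<in> carrier G" "t = s (a' <#\<^bsub>G\<^esub> B)" by auto
      then have "a \<in> a' <#\<^bsub>G\<^esub> B" using s[OF a'(1)] t by simp
      then have "a' <#\<^bsub>G\<^esub> B = a <#\<^bsub>G\<^esub> B" using a' B.subgroup_axioms l_repr_independence by blast
      then show "t = s (a <#\<^bsub>G\<^esub> B)" using a' by simp
    qed
  qed
  then show ?thesis by blast
qed

text \<open>In the product defining the transfer, the representatives cancel against their permuted copies.\<close>

lemma transfer_map_eq_pow:
  fixes G :: "'a monoid" (structure)
  assumes "comm_group G" "finite (carrier G)" "subgroup B G" "a \<in> carrier G"
  shows "transfer_map G B a = a [^] card (rcosets B)"
proof -
  interpret comm_group G by fact
  interpret B: subgroup B G by fact
  define T where "T = (SOME T. left_transversal G B T)"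
  define rep where "rep = (\<lambda>x. THE t. t \<in> T \<and> x \<in> t <#\<^bsub>G\<^esub> B)"
  have "left_transversal G B T"
    unfolding T_def using left_transversal_exists[OF group_axioms assms(3)] by (rule someI_ex)
  then have Tsub: "T \<subseteq> carrier G" and Tex: "\<And>x. x \<in> carrier G \<Longrightarrow> \<exists>!t. t \<in> T \<and> x \<in> t <#\<^bsub>G\<^esub> B"
    by (auto simp: left_transversal_def)
  have finT: "finite T" using Tsub assms(2) finite_subset by blast
  have rep: "rep x \<in> T" "x \<in> rep x <#\<^bsub>G\<^esub> B" if "x \<in> carrier G" for x
    using theI'[OF Tex[OF that]] by (auto simp: rep_def)
  have repI: "rep x = t" if "x \<in> carrier G" "t \<in> T" "x \<in> t <#\<^bsub>G\<^esub> B" for x t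
    using Tex[OF that(1)] that(2,3) by (auto simp: rep_def)
  have cancel: "x \<otimes> (inv x \<otimes> y) = y" if "x \<in> carrier G" "y \<in> carrier G" for x y
    using that by (simp add: m_assoc[symmetric])
  have lc: "x \<in> t <#\<^bsub>G\<^esub> B \<longleftrightarrow> inv t \<otimes> x \<in> B" if "x \<in> carrier G" "t \<in> carrier G" for x t
  proof
    assume "x \<in> t <#\<^bsub>G\<^esub> B" then obtain b where "b \<in> B" "x = t \<otimes> b" by (auto simp: l_coset_def)
    then show "inv t \<otimes> x \<in> B" using that by (simp add: m_assoc[symmetric])
  next
    assume b: "inv t \<otimes> x \<in> B"
    have "x = t \<otimes> (inv t \<otimes> x)" using that by (simp add: m_assoc[symmetric])
    then show "x \<in> t <#\<^bsub>G\<^esub> B" using b by (auto simp: l_coset_def)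
  qed
  \<comment> \<open>The index counts right cosets, the transversal represents left ones; in an
    abelian group they coincide.\<close>
  have cardT: "card (rcosets B) = card T"
  proof (rule bij_betw_same_card[symmetric, of "\<lambda>t. B #> t"])
    have rl: "B #> t = t <#\<^bsub>G\<^esub> B" if "t \<in> carrier G" for t
      using that normal.coset_eq[OF subgroup_imp_normal[OF assms(3)]] by blast
    show "bij_betw (\<lambda>t. B #> t) T (rcosets B)"
      unfolding bij_betw_def
    proof
      show "inj_on (\<lambda>t. B #> t) T"
      proof (rule inj_onI)
        fix s t assume st: "s \<in> T" "t \<in> T" "B #> s = B #> t"
        then have c: "s \<in> carrier G" "t \<in> carrier G" using Tsub by auto
        then have "s \<in> B #> s" using rcos_self assms(3) by blast
        then have "s \<in> s <#\<^bsub>G\<^esub> B" "s \<in> t <#\<^bsub>G\<^esub> B" using st rl c by auto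
        then show "s = t" using repI c st by metis
      qed
      show "(\<lambda>t. B #> t) ` T = rcosets B"
      proof (intro equalityI subsetI)
        fix Q assume "Q \<in> rcosets B"
        then obtain x where x: "x \<in> carrier G" "Q = B #> x" by (auto simp: RCOSETS_def)
        then have "x \<in> B #> rep x" using rep[OF x(1)] rl Tsub by auto
        then have "Q = B #> rep x" using x rep[OF x(1)] Tsub assms(3) repr_independence by blast
        then show "Q \<in> (\<lambda>t. B #> t) ` T" using rep[OF x(1)] by auto
      qed (use Tsub in \<open>auto simp: RCOSETS_def\<close>)
    qed
  qed
  \<comment> \<open>Multiplication by \<open>a\<close> permutes the cosets of \<open>B\<close>,
    hence permutes \<open>T\<close> after passing to representatives. As \<open>T\<close> is finite,
    injectivity is enough.\<close>
  have bij: "bij_betw (\<lambda>t. rep (a \<otimes> t)) T T"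
  proof -
    have "inj_on (\<lambda>t. rep (a \<otimes> t)) T"
    proof (rule inj_onI)
      fix s t assume st: "s \<in> T" "t \<in> T" "rep (a \<otimes> s) = rep (a \<otimes> t)"
      then have c: "s \<in> carrier G" "t \<in> carrier G" using Tsub by auto
      define r where "r = rep (a \<otimes> s)"
      have r: "r \<in> carrier G" using rep[of "a \<otimes> s"] c assms(4) Tsub by (auto simp: r_def)
      have "inv r \<otimes> (a \<otimes> s) \<in> B" "inv r \<otimes> (a \<otimes> t) \<in> B"
        using rep[of "a \<otimes> s"] rep[of "a \<otimes> t"] lc r c assms(4) st(3) by (auto simp: r_def)
      then have "inv (inv r \<otimes> (a \<otimes> t)) \<otimes> (inv r \<otimes> (a \<otimes> s)) \<in> B" by simp
      moreover have "inv (inv r \<otimes> (a \<otimes> t)) \<otimes> (inv r \<otimes> (a \<otimes> s)) = inv t \<otimes> s"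
        using r c assms(4) cancel[of r "a \<otimes> s"] cancel[of "inv a" s]
        by (simp add: inv_mult_group m_assoc)
      ultimately have "s \<in> t <#\<^bsub>G\<^esub> B" using lc c by simp
      moreover have "s \<in> s <#\<^bsub>G\<^esub> B" using lc c by simp
      ultimately show "s = t" using repI c st by metis
    qed
    moreover have "(\<lambda>t. rep (a \<otimes> t)) ` T \<subseteq> T" using rep assms(4) Tsub by auto
    ultimately show ?thesis using finT by (simp add: bij_betw_def endo_inj_surj)
  qed
  have B1: "(\<lambda>t. inv (rep (a \<otimes> t)) \<otimes> (a \<otimes> t)) \<in> T \<rightarrow> B"
  proof
    fix t assume "t \<in> T"
    then have "a \<otimes> t \<in> carrier G" using Tsub assms(4) by auto
    then show "inv (rep (a \<otimes> t)) \<otimes> (a \<otimes> t) \<in> B" using rep lc Tsub by blast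
  qed
  have c1: "(\<lambda>t. rep (a \<otimes> t)) \<in> T \<rightarrow> carrier G"
    
  proof
    fix t assume "t \<in> T"
    then have "rep (a \<otimes> t) \<in> T" using Tsub assms(4) by (intro rep(1)) auto
    then show "rep (a \<otimes> t) \<in> carrier G" using Tsub by auto
  qed
  have c2: "(\<lambda>t. a \<otimes> t) \<in> T \<rightarrow> carrier G"
    using assms(4) Tsub by (simp add: Pi_def subset_iff)
  \<comment> \<open>The product of all \<open>a t\<close> is evaluated twice: it is \<open>P\<close>
    times the transfer of \<open>a\<close>, and also \<open>a ^ card T\<close> times
    \<open>P\<close>. Cancelling \<open>P\<close> gives the power.\<close>
  define P where "P = finprod G (\<lambda>t. t) T"
  have P: "P \<in> carrier G" unfolding P_def using Tsub by (intro finprod_closed) auto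
  have "finprod G (\<lambda>t. rep (a \<otimes> t)) T = P"
    using finprod_reindex[of "\<lambda>t. t" "\<lambda>t. rep (a \<otimes> t)" T] bij Tsub
    by (simp add: bij_betw_def P_def Pi_def subset_iff)
  moreover have "finprod G (\<lambda>t. rep (a \<otimes> t)) T \<otimes> finprod G (\<lambda>t. inv (rep (a \<otimes> t)) \<otimes> (a \<otimes> t)) T
      = finprod G (\<lambda>t. a \<otimes> t) T"
  proof -
    have "finprod G (\<lambda>t. rep (a \<otimes> t)) T \<otimes> finprod G (\<lambda>t. inv (rep (a \<otimes> t)) \<otimes> (a \<otimes> t)) T
      = finprod G (\<lambda>t. rep (a \<otimes> t) \<otimes> (inv (rep (a \<otimes> t)) \<otimes> (a \<otimes> t))) T"
      using c1 c2 B1 by (intro finprod_multf[symmetric]) auto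
    also have "\<dots> = finprod G (\<lambda>t. a \<otimes> t) T"
      using c1 c2 by (intro finprod_cong') (auto simp: Pi_def m_assoc[symmetric])
    finally show ?thesis .
  qed
  moreover have "finprod G (\<lambda>t. a \<otimes> t) T = a [^] card T \<otimes> P"
    using finprod_multf[of "\<lambda>t. a" T "\<lambda>t. t"] finprod_const[of a T] assms(4) Tsub
    by (simp add: P_def Pi_def subset_iff)
  ultimately have "P \<otimes> finprod G (\<lambda>t. inv (rep (a \<otimes> t)) \<otimes> (a \<otimes> t)) T = P \<otimes> a [^] card T"
    using assms(4) P by (simp add: m_comm)
  moreover have "finprod G (\<lambda>t. inv (rep (a \<otimes> t)) \<otimes> (a \<otimes> t)) T \<in> carrier G"
    by (rule finprod_closed) (use B1 B.subset in \<open>auto simp: Pi_iff\<close>)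
  ultimately have "finprod G (\<lambda>t. inv (rep (a \<otimes> t)) \<otimes> (a \<otimes> t)) T = a [^] card T"
    using P assms(4) by simp
  moreover have "transfer_map G B a =
      finprod (G\<lparr>carrier := B\<rparr>) (\<lambda>t. inv (rep (a \<otimes> t)) \<otimes> (a \<otimes> t)) T"
    unfolding transfer_map_def Let_def rep_def T_def by (rule refl)
  ultimately show ?thesis using finprod_subgroup[OF assms(3) B1] cardT by simp
qed

section \<open>RIC-functors\<close>

lemma ric_domainD:
  assumes "is_ric_domain G act D" "x \<in> pts D"
  shows "y \<in> res_dom D x \<Longrightarrow> y \<in> pts D" "y \<in> ind_dom D x \<Longrightarrow> y \<in> pts D"
    "x \<in> res_dom D x" "x \<in> ind_dom D x"
    "\<lbrakk>y \<in> res_dom D x; z \<in> res_dom D y\<rbrakk> \<Longrightarrow> z \<in> res_dom D x"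
    "\<lbrakk>y \<in> ind_dom D x; z \<in> ind_dom D y\<rbrakk> \<Longrightarrow> z \<in> ind_dom D x"
    "\<lbrakk>y \<in> res_dom D x; g \<in> carrier G\<rbrakk> \<Longrightarrow> act g y \<in> res_dom D (act g x)"
    "\<lbrakk>y \<in> ind_dom D x; g \<in> carrier G\<rbrakk> \<Longrightarrow> act g y \<in> ind_dom D (act g x)"
proof -
  have *: "S x \<subseteq> pts D \<and> x \<in> S x \<and> (\<forall>y\<in>S x. S y \<subseteq> S x) \<and>
      (\<forall>g\<in>carrier G. act g ` S x = S (act g x))" if "S \<in> {res_dom D, ind_dom D}" for S
    using assms that unfolding is_ric_domain_def
    by - (elim conjE, drule bspec, assumption, drule bspec, assumption, assumption)
  note r = *[of "res_dom D", OF insertI1] and i = *[of "ind_dom D", OF insertI2[OF singletonI]]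
  show "y \<in> res_dom D x \<Longrightarrow> y \<in> pts D" "x \<in> res_dom D x"
    "\<lbrakk>y \<in> res_dom D x; z \<in> res_dom D y\<rbrakk> \<Longrightarrow> z \<in> res_dom D x"
    "\<lbrakk>y \<in> res_dom D x; g \<in> carrier G\<rbrakk> \<Longrightarrow> act g y \<in> res_dom D (act g x)"
    using r by blast+
  show "y \<in> ind_dom D x \<Longrightarrow> y \<in> pts D" "x \<in> ind_dom D x"
    "\<lbrakk>y \<in> ind_dom D x; z \<in> ind_dom D y\<rbrakk> \<Longrightarrow> z \<in> ind_dom D x"
    "\<lbrakk>y \<in> ind_dom D x; g \<in> carrier G\<rbrakk> \<Longrightarrow> act g y \<in> ind_dom D (act g x)"
    using i by blast+
qed

lemma ric_domain_act:
  assumes "is_ric_domain G act D" "x \<in> pts D" "g \<in> carrier G"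
  shows "act g x \<in> pts D"
proof -
  interpret group_action G "pts D" "\<lambda>g. restrict (act g) (pts D)"
    using assms(1) by (simp add: is_ric_domain_def)
  show ?thesis using element_image[OF assms(3,2) refl] assms(2) by simp
qed

lemma ric_domain_act_one:
  assumes "is_ric_domain G act D" "x \<in> pts D"
  shows "act \<one>\<^bsub>G\<^esub> x = x"
proof -
  interpret group_action G "pts D" "\<lambda>g. restrict (act g) (pts D)"
    using assms(1) by (simp add: is_ric_domain_def)
  show ?thesis using id_eq_one assms(2) by (metis restrict_apply')
qed

lemma ric_domain_act_mult:
  assumes "is_ric_domain G act D" "x \<in> pts D" "g \<in> carrier G" "g' \<in> carrier G"
  shows "act g' (act g x) = act (g' \<otimes>\<^bsub>G\<^esub> g) x"
proof -
  interpret group_action G "pts D" "\<lambda>g. restrict (act g) (pts D)"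
    using assms(1) by (simp add: is_ric_domain_def)
  show ?thesis
    using composition_rule[OF assms(2,4,3)] ric_domain_act[OF assms(1-3)] assms(2) by simp
qed

lemma ric_functorD:
  assumes "is_ric_functor G act D \<Phi>" "x \<in> pts D"
  shows "comm_group (obj_grp \<Phi> x)"
    and "y \<in> res_dom D x \<Longrightarrow> res_map \<Phi> y x \<in> hom (obj_grp \<Phi> x) (obj_grp \<Phi> y)"
    and "y \<in> ind_dom D x \<Longrightarrow> ind_map \<Phi> x y \<in> hom (obj_grp \<Phi> y) (obj_grp \<Phi> x)"
    and "g \<in> carrier G \<Longrightarrow> con_map \<Phi> g x \<in> hom (obj_grp \<Phi> x) (obj_grp \<Phi> (act g x))"
    and "a \<in> carrier (obj_grp \<Phi> x) \<Longrightarrow> res_map \<Phi> x x a = a"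
    and "a \<in> carrier (obj_grp \<Phi> x) \<Longrightarrow> ind_map \<Phi> x x a = a"
    and "a \<in> carrier (obj_grp \<Phi> x) \<Longrightarrow> con_map \<Phi> \<one>\<^bsub>G\<^esub> x a = a"
    and "\<lbrakk>y \<in> res_dom D x; z \<in> res_dom D y; a \<in> carrier (obj_grp \<Phi> x)\<rbrakk> \<Longrightarrow>
      res_map \<Phi> z y (res_map \<Phi> y x a) = res_map \<Phi> z x a"
    and "\<lbrakk>y \<in> ind_dom D x; z \<in> ind_dom D y; a \<in> carrier (obj_grp \<Phi> z)\<rbrakk> \<Longrightarrow>
      ind_map \<Phi> x y (ind_map \<Phi> y z a) = ind_map \<Phi> x z a"
    and "\<lbrakk>g \<in> carrier G; g' \<in> carrier G; a \<in> carrier (obj_grp \<Phi> x)\<rbrakk> \<Longrightarrow>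
      con_map \<Phi> g' (act g x) (con_map \<Phi> g x a) = con_map \<Phi> (g' \<otimes>\<^bsub>G\<^esub> g) x a"
    and "\<lbrakk>y \<in> res_dom D x; g \<in> carrier G; a \<in> carrier (obj_grp \<Phi> x)\<rbrakk> \<Longrightarrow>
      con_map \<Phi> g y (res_map \<Phi> y x a) = res_map \<Phi> (act g y) (act g x) (con_map \<Phi> g x a)"
    and "\<lbrakk>y \<in> ind_dom D x; g \<in> carrier G; a \<in> carrier (obj_grp \<Phi> y)\<rbrakk> \<Longrightarrow>
      con_map \<Phi> g x (ind_map \<Phi> x y a) = ind_map \<Phi> (act g x) (act g y) (con_map \<Phi> g y a)"
  using assms unfolding is_ric_functor_def by simp_all

text \<open>Functoriality of \<open>\<Phi>\<close> is part of the conclusion: apply the injective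
  \<open>\<phi>\<close> to both sides of a law for \<open>\<Phi>\<close>, and commutation turns it
  into the same law for \<open>\<Psi>\<close>. This avoids proving transitivity of the transfer by
  hand.\<close>

lemma ric_isomorphism_transport:
  assumes D: "is_ric_domain G act D" and G: "group G"
    and \<Psi>: "is_ric_functor G act D \<Psi>"
    and grp: "\<And>x. x \<in> pts D \<Longrightarrow> comm_group (obj_grp \<Phi> x)"
    and iso: "\<And>x. x \<in> pts D \<Longrightarrow> \<phi> x \<in> iso (obj_grp \<Phi> x) (obj_grp \<Psi> x)"
    and res: "\<And>x y a. \<lbrakk>x \<in> pts D; y \<in> res_dom D x; a \<in> carrier (obj_grp \<Phi> x)\<rbrakk> \<Longrightarrow>
        res_map \<Phi> y x a \<in> carrier (obj_grp \<Phi> y) \<and> \<phi> y (res_map \<Phi> y x a) = res_map \<Psi> y x (\<phi> x a)"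
    and ind: "\<And>x y a. \<lbrakk>x \<in> pts D; y \<in> ind_dom D x; a \<in> carrier (obj_grp \<Phi> y)\<rbrakk> \<Longrightarrow>
        ind_map \<Phi> x y a \<in> carrier (obj_grp \<Phi> x) \<and> \<phi> x (ind_map \<Phi> x y a) = ind_map \<Psi> x y (\<phi> y a)"
    and con: "\<And>x g a. \<lbrakk>x \<in> pts D; g \<in> carrier G; a \<in> carrier (obj_grp \<Phi> x)\<rbrakk> \<Longrightarrow>
        con_map \<Phi> g x a \<in> carrier (obj_grp \<Phi> (act g x)) \<and>
        \<phi> (act g x) (con_map \<Phi> g x a) = con_map \<Psi> g x (\<phi> x a)"
  shows "ric_isomorphism G act D \<Phi> \<Psi> \<phi>"
proof -
  note act = ric_domain_act[OF D]
  note rdom = ric_domainD(1,5,7)[OF D] and idom = ric_domainD(2,6,8)[OF D]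
    and self = ric_domainD(3,4)[OF D]
  have g1: "\<one>\<^bsub>G\<^esub> \<in> carrier G" "\<And>g g'. g \<in> carrier G \<Longrightarrow> g' \<in> carrier G \<Longrightarrow> g' \<otimes>\<^bsub>G\<^esub> g \<in> carrier G"
    using G by (simp_all add: monoid.m_closed group.is_monoid)
  note act1 = ric_domain_act_one[OF D] and actm = ric_domain_act_mult[OF D]
  have h: "\<phi> x \<in> hom (obj_grp \<Phi> x) (obj_grp \<Psi> x)" "inj_on (\<phi> x) (carrier (obj_grp \<Phi> x))"
    "\<phi> x ` carrier (obj_grp \<Phi> x) = carrier (obj_grp \<Psi> x)" if "x \<in> pts D" for x
    using iso[OF that] by (auto simp: iso_def bij_betw_def)
  have hc: "\<phi> x a \<in> carrier (obj_grp \<Psi> x)" if "x \<in> pts D" "a \<in> carrier (obj_grp \<Phi> x)" for x a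
    using h(3)[OF that(1)] that(2) by auto
  have hm: "\<phi> x (a \<otimes>\<^bsub>obj_grp \<Phi> x\<^esub> b) = \<phi> x a \<otimes>\<^bsub>obj_grp \<Psi> x\<^esub> \<phi> x b"
    if "x \<in> pts D" "a \<in> carrier (obj_grp \<Phi> x)" "b \<in> carrier (obj_grp \<Phi> x)" for x a b
    using h(1)[OF that(1)] that(2,3) by (auto simp: hom_def)
  have inj: "a = b" if "x \<in> pts D" "a \<in> carrier (obj_grp \<Phi> x)" "b \<in> carrier (obj_grp \<Phi> x)"
     "\<phi> x a = \<phi> x b" for x a b
    using h(2)[OF that(1)] that(2-4) by (auto dest: inj_onD)
  have cm: "a \<otimes>\<^bsub>obj_grp \<Phi> x\<^esub> b \<in> carrier (obj_grp \<Phi> x)"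
    if "x \<in> pts D" "a \<in> carrier (obj_grp \<Phi> x)" "b \<in> carrier (obj_grp \<Phi> x)" for x a b
    using grp[OF that(1)] that(2,3) by (simp add: comm_group_def group.is_monoid monoid.m_closed)
  note r = res[THEN conjunct1] res[THEN conjunct2] and i = ind[THEN conjunct1] ind[THEN conjunct2]
    and c = con[THEN conjunct1] con[THEN conjunct2]
  \<comment> \<open>Multiplicativity is also tested after applying the injective
    \<open>\<phi> y\<close>, where it becomes multiplicativity of the map of
    \<open>\<Psi>\<close>.\<close>
  have hom_pull: "f \<in> hom (obj_grp \<Phi> x) (obj_grp \<Phi> y)"
    if "x \<in> pts D" "y \<in> pts D" "g \<in> hom (obj_grp \<Psi> x) (obj_grp \<Psi> y)"
      "\<And>a. a \<in> carrier (obj_grp \<Phi> x) \<Longrightarrow> f a \<in> carrier (obj_grp \<Phi> y)"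
      "\<And>a. a \<in> carrier (obj_grp \<Phi> x) \<Longrightarrow> \<phi> y (f a) = g (\<phi> x a)" for f g x y
  proof (rule homI)
    fix a b assume ab: "a \<in> carrier (obj_grp \<Phi> x)" "b \<in> carrier (obj_grp \<Phi> x)"
    have "\<phi> y (f (a \<otimes>\<^bsub>obj_grp \<Phi> x\<^esub> b)) = g (\<phi> x a) \<otimes>\<^bsub>obj_grp \<Psi> y\<^esub> g (\<phi> x b)"
      using that(3) ab by (simp add: that cm hm hc hom_mult)
    also have "\<dots> = \<phi> y (f a \<otimes>\<^bsub>obj_grp \<Phi> y\<^esub> f b)"
      using ab by (simp add: that hm)
    finally show "f (a \<otimes>\<^bsub>obj_grp \<Phi> x\<^esub> b) = f a \<otimes>\<^bsub>obj_grp \<Phi> y\<^esub> f b"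
      using ab by (intro inj[of y]) (auto simp: that cm)
  qed (use that in auto)
  note \<Psi>' = ric_functorD[OF \<Psi>]
  have \<Phi>: "is_ric_functor G act D \<Phi>"
    unfolding is_ric_functor_def
  proof (intro conjI ballI)
    fix x assume x: "x \<in> pts D"
    show "comm_group (obj_grp \<Phi> x)" by (rule grp[OF x])
    { fix y assume y: "y \<in> res_dom D x"
      show "res_map \<Phi> y x \<in> hom (obj_grp \<Phi> x) (obj_grp \<Phi> y)"
        by (rule hom_pull[of x y "res_map \<Psi> y x"]) (use x y rdom(1)[OF x y] r[OF x y] in \<open>simp_all add: \<Psi>'(1-4)\<close>) }
    { fix y assume y: "y \<in> ind_dom D x"
      show "ind_map \<Phi> x y \<in> hom (obj_grp \<Phi> y) (obj_grp \<Phi> x)"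
        by (rule hom_pull[of y x "ind_map \<Psi> x y"]) (use x y idom(1)[OF x y] i[OF x y] in \<open>simp_all add: \<Psi>'(1-4)\<close>) }
    { fix g assume g: "g \<in> carrier G"
      show "con_map \<Phi> g x \<in> hom (obj_grp \<Phi> x) (obj_grp \<Phi> (act g x))"
        by (rule hom_pull[of x "act g x" "con_map \<Psi> g x"]) (use x g act[OF x g] c[OF x g] in \<open>simp_all add: \<Psi>'(1-4)\<close>) }
    { fix a assume a: "a \<in> carrier (obj_grp \<Phi> x)"
      note ha = hc[OF x a]
      show "res_map \<Phi> x x a = a"
        using r[OF x self(1)[OF x] a] x a by (intro inj[of x]) (simp_all add: \<Psi>'(5)[OF x ha])
      show "ind_map \<Phi> x x a = a"
        using i[OF x self(2)[OF x] a] x a by (intro inj[of x]) (simp_all add: \<Psi>'(6)[OF x ha])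
      show "con_map \<Phi> \<one>\<^bsub>G\<^esub> x a = a"
        using c[OF x g1(1) a] x a by (intro inj[of x]) (simp_all add: act1 \<Psi>'(7)[OF x ha]) }
    { fix y z a assume *: "y \<in> res_dom D x" "z \<in> res_dom D y" "a \<in> carrier (obj_grp \<Phi> x)"
      then have "y \<in> pts D" "z \<in> pts D" "z \<in> res_dom D x" using rdom(1)[OF x] rdom(1) rdom(2)[OF x] by blast+
      then show "res_map \<Phi> z y (res_map \<Phi> y x a) = res_map \<Phi> z x a"
        using x * by (intro inj[of z]) (simp_all add: r hc \<Psi>'(8)) }
    { fix y z a assume *: "y \<in> ind_dom D x" "z \<in> ind_dom D y" "a \<in> carrier (obj_grp \<Phi> z)"
      then have "y \<in> pts D" "z \<in> pts D" "z \<in> ind_dom D x" using idom(1)[OF x] idom(1) idom(2)[OF x] by blast+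
      then show "ind_map \<Phi> x y (ind_map \<Phi> y z a) = ind_map \<Phi> x z a"
        using x * by (intro inj[of x]) (simp_all add: i hc \<Psi>'(9)) }
    { fix g g' a assume *: "g \<in> carrier G" "g' \<in> carrier G" "a \<in> carrier (obj_grp \<Phi> x)"
      \<comment> \<open>The two sides live a priori over \<open>act g' (act g x)\<close> and over
        \<open>act (g' g) x\<close>; these points must be identified before injectivity of one
        component of \<open>\<phi>\<close> can be used.\<close>
      show "con_map \<Phi> g' (act g x) (con_map \<Phi> g x a) = con_map \<Phi> (g' \<otimes>\<^bsub>G\<^esub> g) x a"
        using x * c[of x "g' \<otimes>\<^bsub>G\<^esub> g" a, unfolded actm[symmetric, OF x *(1,2)]]
        by (intro inj[of "act g' (act g x)"]) (simp_all add: c hc act actm[symmetric] g1 \<Psi>'(10)) }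
    { fix y g a assume *: "y \<in> res_dom D x" "g \<in> carrier G" "a \<in> carrier (obj_grp \<Phi> x)"
      have y: "y \<in> pts D" "act g y \<in> res_dom D (act g x)" "act g y \<in> pts D"
        using rdom(1,3)[OF x *(1)] * act by blast+
      show "con_map \<Phi> g y (res_map \<Phi> y x a) = res_map \<Phi> (act g y) (act g x) (con_map \<Phi> g x a)"
        using x y * by (intro inj[of "act g y"]) (simp_all add: r c act hc \<Psi>'(11)) }
    { fix y g a assume *: "y \<in> ind_dom D x" "g \<in> carrier G" "a \<in> carrier (obj_grp \<Phi> y)"
      have y: "y \<in> pts D" "act g y \<in> ind_dom D (act g x)" "act g y \<in> pts D"
        using idom(1,3)[OF x *(1)] * act by blast+
      show "con_map \<Phi> g x (ind_map \<Phi> x y a) = ind_map \<Phi> (act g x) (act g y) (con_map \<Phi> g y a)"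
        using x y * by (intro inj[of "act g x"]) (simp_all add: i c act hc \<Psi>'(12)) }
  qed
  define \<psi> where "\<psi> x = inv_into (carrier (obj_grp \<Phi> x)) (\<phi> x)" for x
  have \<psi>: "\<psi> x b \<in> carrier (obj_grp \<Phi> x)" "\<phi> x (\<psi> x b) = b"
    if "x \<in> pts D" "b \<in> carrier (obj_grp \<Psi> x)" for x b
    using that h(3)[OF that(1)] by (auto simp: \<psi>_def inv_into_into f_inv_into_f)
  have \<psi>\<phi>: "\<psi> x (\<phi> x a) = a" if "x \<in> pts D" "a \<in> carrier (obj_grp \<Phi> x)" for x a
    using that h(2)[OF that(1)] by (simp add: \<psi>_def)
  have "ric_morphism G act D \<Phi> \<Psi> \<phi>"
    unfolding ric_morphism_def using \<Phi> \<Psi> h(1) r(2) i(2) c(2) by simp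
  moreover have "ric_morphism G act D \<Psi> \<Phi> \<psi>"
    unfolding ric_morphism_def
  proof (intro conjI ballI)
    fix x assume x: "x \<in> pts D"
    show "\<psi> x \<in> hom (obj_grp \<Psi> x) (obj_grp \<Phi> x)"
      using group.iso_set_sym[of "obj_grp \<Phi> x", OF _ iso[OF x]] grp[OF x]
      by (simp add: \<psi>_def iso_def comm_group_def)
    { fix y b assume *: "y \<in> res_dom D x" "b \<in> carrier (obj_grp \<Psi> x)"
      then have y: "y \<in> pts D" using rdom(1)[OF x] by blast
      show "\<psi> y (res_map \<Psi> y x b) = res_map \<Phi> y x (\<psi> x b)"
        using \<psi>\<phi>[OF y] x * res[of x y "\<psi> x b"] \<psi>[of x b] by fastforce }
    { fix y b assume *: "y \<in> ind_dom D x" "b \<in> carrier (obj_grp \<Psi> y)"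
      then have y: "y \<in> pts D" using idom(1)[OF x] by blast
      show "\<psi> x (ind_map \<Psi> x y b) = ind_map \<Phi> x y (\<psi> y b)"
        using \<psi>\<phi>[OF x] x * ind[of x y "\<psi> y b"] \<psi>[of y b] y by fastforce }
    { fix g b assume *: "g \<in> carrier G" "b \<in> carrier (obj_grp \<Psi> x)"
      show "\<psi> (act g x) (con_map \<Psi> g x b) = con_map \<Phi> g x (\<psi> x b)"
        using \<psi>\<phi>[OF act[OF x *(1)]] x * con[of x g "\<psi> x b"] \<psi>[of x b] by fastforce }
  qed (fact \<Psi> \<Phi>)+
  ultimately show ?thesis unfolding ric_isomorphism_def using \<psi> \<psi>\<phi> by blast
qed

section \<open>Procyclic groups\<close>

lemma (in comm_group) pow_eq_imp_eq_torsion_free: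
  assumes tf: "\<forall>x\<in>carrier G. \<forall>n::nat. n > 0 \<longrightarrow> x [^] n = \<one> \<longrightarrow> x = \<one>"
    and "x \<in> carrier G" "y \<in> carrier G" "n > 0" "x [^] (n::nat) = y [^] n"
  shows "x = y"
proof -
  have "(x \<otimes> inv y) [^] n = \<one>"
    using assms by (simp add: nat_pow_distrib nat_pow_inv)
  then have "x \<otimes> inv y = \<one>" using tf assms by blast
  then show ?thesis using assms by (simp add: inv_solve_right')
qed

lemma continuous_map_grp_pow:
  assumes "topological_grp G T"
  shows "continuous_map T T (\<lambda>x. x [^]\<^bsub>G\<^esub> (n::nat))"
proof (induction n)
  case 0
  interpret group G using assms by (simp add: topological_grp_def)
  show ?case using assms by (simp add: topological_grp_def)
next
  case (Suc n)
  have "continuous_map T T ((\<lambda>(x, y). x \<otimes>\<^bsub>G\<^esub> y) \<circ> (\<lambda>x. (x [^]\<^bsub>G\<^esub> n, x)))"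
    using assms Suc
    by (intro continuous_map_compose[of _ "prod_topology T T"] continuous_map_pairedI)
      (auto simp: topological_grp_def)
  then show ?case by (simp add: comp_def)
qed

text \<open>The translates of \<open>n\<Omega>\<close> by \<open>i\<omega>\<close> with
  \<open>i < n\<close> are continuous images of a compact space, hence closed in the Hausdorff space
  \<Omega>, and so is their finite union. Division with remainder by \<open>n\<close> places every
  integer multiple of \<open>\<omega>\<close> in the union, and these multiples are dense.\<close>

lemma procyclic_decompose:
  assumes "torsion_free_procyclic \<Omega> T\<Omega> \<omega>" "n > 0" "x \<in> carrier \<Omega>"
  shows "\<exists>i<n. \<exists>y\<in>carrier \<Omega>. x = \<omega> [^]\<^bsub>\<Omega>\<^esub> i \<otimes>\<^bsub>\<Omega>\<^esub> y [^]\<^bsub>\<Omega>\<^esub> (n::nat)"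
proof -
  interpret \<Omega>: comm_group \<Omega> using assms(1) by (simp add: torsion_free_procyclic_def)
  have tg: "topological_grp \<Omega> T\<Omega>" and cpt: "compact_space T\<Omega>" and hd: "Hausdorff_space T\<Omega>"
    and \<omega>: "\<omega> \<in> carrier \<Omega>" and cl: "T\<Omega> closure_of (generate \<Omega> {\<omega>}) = carrier \<Omega>"
    using assms(1)
    by (auto simp: torsion_free_procyclic_def profinite_grp_def compact_grp_def top_generator_def)
  have top: "topspace T\<Omega> = carrier \<Omega>" using tg by (simp add: topological_grp_def)
  define S where "S i = (\<lambda>y. \<omega> [^]\<^bsub>\<Omega>\<^esub> i \<otimes>\<^bsub>\<Omega>\<^esub> y [^]\<^bsub>\<Omega>\<^esub> n) ` carrier \<Omega>" for i :: nat
  have "closedin T\<Omega> (S i)" for i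
  proof -
    have "continuous_map T\<Omega> T\<Omega> ((\<lambda>(x, y). x \<otimes>\<^bsub>\<Omega>\<^esub> y) \<circ> (\<lambda>y. (\<omega> [^]\<^bsub>\<Omega>\<^esub> i, y [^]\<^bsub>\<Omega>\<^esub> n)))"
      using tg continuous_map_grp_pow[OF tg, of n] \<omega> top
      by (intro continuous_map_compose[of _ "prod_topology T\<Omega> T\<Omega>"] continuous_map_pairedI)
        (auto simp: topological_grp_def)
    then have "compactin T\<Omega> (S i)"
      using image_compactin[of T\<Omega> "carrier \<Omega>"] cpt top
      by (auto simp: S_def comp_def compact_space_def)
    then show ?thesis using hd compactin_imp_closedin by blast
  qed
  then have "closedin T\<Omega> (\<Union>i<n. S i)" by (intro closedin_Union) auto
  moreover have "generate \<Omega> {\<omega>} \<subseteq> (\<Union>i<n. S i)"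
  proof
    fix z assume "z \<in> generate \<Omega> {\<omega>}"
    then obtain k :: int where k: "z = \<omega> [^]\<^bsub>\<Omega>\<^esub> k"
      using \<omega> \<Omega>.generate_pow by auto
    have "k = int (nat (k mod int n)) + (k div int n) * int n"
      using assms(2) by simp
    then have "z = \<omega> [^]\<^bsub>\<Omega>\<^esub> (int (nat (k mod int n)) + (k div int n) * int n)" using k by simp
    also have "\<dots> = \<omega> [^]\<^bsub>\<Omega>\<^esub> nat (k mod int n) \<otimes>\<^bsub>\<Omega>\<^esub> (\<omega> [^]\<^bsub>\<Omega>\<^esub> (k div int n)) [^]\<^bsub>\<Omega>\<^esub> n"
      using \<omega> by (simp only: \<Omega>.int_pow_mult int_pow_int \<Omega>.int_pow_pow[symmetric])
    finally have "z \<in> S (nat (k mod int n))" using \<omega> by (auto simp: S_def)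
    moreover have "nat (k mod int n) < n" using assms(2) by (simp add: nat_less_iff)
    ultimately show "z \<in> (\<Union>i<n. S i)" by blast
  qed
  ultimately have "carrier \<Omega> \<subseteq> (\<Union>i<n. S i)" using closure_of_minimal cl by metis
  then show ?thesis using assms(3) by (auto simp: S_def)
qed

text \<open>Let \<open>n\<close> be the index. The order of \<open>\<Omega> Mod D\<close> is
  \<open>n\<close>, so \<open>n\<Omega>\<close> lies in \<open>D\<close>. Conversely
  \<open>i\<omega>\<close> with \<open>i < n\<close> already meets all \<open>n\<close> cosets of
  \<open>D\<close>, so these multiples lie in distinct cosets; an element of \<open>D\<close> of the
  form \<open>i\<omega> + n y\<close> therefore has \<open>i = 0\<close>.\<close>

lemma procyclic_subgroup_eq_powers:
  assumes "torsion_free_procyclic \<Omega> T\<Omega> \<omega>" "subgroup D \<Omega>" "finite (rcosets\<^bsub>\<Omega>\<^esub> D)"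
  shows "D = (\<lambda>x. x [^]\<^bsub>\<Omega>\<^esub> card (rcosets\<^bsub>\<Omega>\<^esub> D)) ` carrier \<Omega>"
proof -
  interpret \<Omega>: comm_group \<Omega> using assms(1) by (simp add: torsion_free_procyclic_def)
  have \<omega>: "\<omega> \<in> carrier \<Omega>" using assms(1) by (simp add: torsion_free_procyclic_def top_generator_def)
  interpret D: subgroup D \<Omega> by fact
  interpret N: normal D \<Omega> using assms(2) by (rule \<Omega>.subgroup_imp_normal)
  define n where "n = card (rcosets\<^bsub>\<Omega>\<^esub> D)"
  interpret Q: group "\<Omega> Mod D" by (rule N.factorgroup_is_group)
  have rc: "rcosets\<^bsub>\<Omega>\<^esub> D = (\<lambda>x. D #>\<^bsub>\<Omega>\<^esub> x) ` carrier \<Omega>" by (auto simp: RCOSETS_def)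
  have n0: "n > 0" using assms(3) rc \<Omega>.one_closed by (auto simp: n_def card_gt_0_iff)
  have ord: "order (\<Omega> Mod D) = n" by (simp add: order_def n_def carrier_FactGroup rc)
  have pow: "x [^]\<^bsub>\<Omega>\<^esub> n \<in> D" if x: "x \<in> carrier \<Omega>" for x
  proof -
    have "(D #>\<^bsub>\<Omega>\<^esub> x) [^]\<^bsub>\<Omega> Mod D\<^esub> n = D"
      using Q.pow_order_eq_1[of "D #>\<^bsub>\<Omega>\<^esub> x"] x by (simp add: ord carrier_FactGroup)
    then have "D #>\<^bsub>\<Omega>\<^esub> (x [^]\<^bsub>\<Omega>\<^esub> n) = D" using N.FactGroup_pow[OF x] by simp
    then show ?thesis using \<Omega>.rcos_self[of "x [^]\<^bsub>\<Omega>\<^esub> n" D] x assms(2) by simp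
  qed
  have dec: "\<exists>i<n. \<exists>y\<in>carrier \<Omega>. x = \<omega> [^]\<^bsub>\<Omega>\<^esub> i \<otimes>\<^bsub>\<Omega>\<^esub> y [^]\<^bsub>\<Omega>\<^esub> n" if "x \<in> carrier \<Omega>" for x
    using procyclic_decompose[OF assms(1) n0 that] .
  have cos: "D #>\<^bsub>\<Omega>\<^esub> (z \<otimes>\<^bsub>\<Omega>\<^esub> y) = D #>\<^bsub>\<Omega>\<^esub> z" if "z \<in> carrier \<Omega>" "y \<in> D" for z y
    using that D.subset by (simp add: \<Omega>.m_comm[of z y] \<Omega>.coset_mult_assoc[symmetric] \<Omega>.coset_join2 assms(2))
  have "(\<lambda>i. D #>\<^bsub>\<Omega>\<^esub> (\<omega> [^]\<^bsub>\<Omega>\<^esub> i)) ` {..<n} = rcosets\<^bsub>\<Omega>\<^esub> D"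
  proof (intro equalityI subsetI)
    fix Z assume "Z \<in> rcosets\<^bsub>\<Omega>\<^esub> D"
    then obtain x where x: "x \<in> carrier \<Omega>" "Z = D #>\<^bsub>\<Omega>\<^esub> x" using rc by auto
    obtain i y where "i < n" "y \<in> carrier \<Omega>" "x = \<omega> [^]\<^bsub>\<Omega>\<^esub> i \<otimes>\<^bsub>\<Omega>\<^esub> y [^]\<^bsub>\<Omega>\<^esub> n"
      using dec[OF x(1)] by blast
    then show "Z \<in> (\<lambda>i. D #>\<^bsub>\<Omega>\<^esub> (\<omega> [^]\<^bsub>\<Omega>\<^esub> i)) ` {..<n}" using x pow \<omega> by (auto simp: cos)
  qed (use \<omega> rc in auto)
  then have inj: "inj_on (\<lambda>i. D #>\<^bsub>\<Omega>\<^esub> (\<omega> [^]\<^bsub>\<Omega>\<^esub> i)) {..<n}"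
    by (intro eq_card_imp_inj_on) (simp_all add: n_def)
  have "D \<subseteq> (\<lambda>x. x [^]\<^bsub>\<Omega>\<^esub> n) ` carrier \<Omega>"
  proof
    fix x assume x: "x \<in> D"
    then obtain i y where i: "i < n" "y \<in> carrier \<Omega>" "x = \<omega> [^]\<^bsub>\<Omega>\<^esub> i \<otimes>\<^bsub>\<Omega>\<^esub> y [^]\<^bsub>\<Omega>\<^esub> n"
      using dec D.mem_carrier by blast
    have "D #>\<^bsub>\<Omega>\<^esub> (\<omega> [^]\<^bsub>\<Omega>\<^esub> i) = D #>\<^bsub>\<Omega>\<^esub> x" using i pow \<omega> by (simp add: cos)
    also have "\<dots> = D #>\<^bsub>\<Omega>\<^esub> (\<omega> [^]\<^bsub>\<Omega>\<^esub> (0::nat))"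
      using x D.subset by (simp add: \<Omega>.coset_join2 assms(2))
    finally have "i = 0" using inj_onD[OF inj, of i 0] i(1) n0 by simp
    then show "x \<in> (\<lambda>x. x [^]\<^bsub>\<Omega>\<^esub> n) ` carrier \<Omega>" using i by auto
  qed
  then show ?thesis using pow by (auto simp: n_def)
qed

section \<open>Unramified extensions\<close>

locale procyclic_degree =
  fixes G :: "'g monoid" and T :: "'g topology"
    and \<Omega> :: "'w monoid" and T\<Omega> :: "'w topology" and \<omega> :: 'w
    and d :: "'g \<Rightarrow> 'w"
  assumes group_G: "group G"
    and torsion_free_procyclic: "torsion_free_procyclic \<Omega> T\<Omega> \<omega>"
    and d_epi: "d \<in> epi G \<Omega>"
begin

sublocale G: group G by (rule group_G)

sublocale \<Omega>: comm_group \<Omega>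
  using torsion_free_procyclic by (simp add: torsion_free_procyclic_def)

sublocale d: group_hom G \<Omega> d
  using d_epi by unfold_locales (simp add: epi_def)

lemma omega_closed [simp]: "\<omega> \<in> carrier \<Omega>"
  using torsion_free_procyclic by (simp add: torsion_free_procyclic_def top_generator_def)

lemma d_image: "d ` carrier G = carrier \<Omega>"
  using d_epi by (simp add: epi_def)

abbreviation "inert_fin \<equiv> inertially_finite G T \<Omega> d"
abbreviation "f \<equiv> abs_f G \<Omega> d"

lemma root_unique:
  "\<lbrakk>x \<in> carrier \<Omega>; y \<in> carrier \<Omega>; n > 0; x [^]\<^bsub>\<Omega>\<^esub> (n::nat) = y [^]\<^bsub>\<Omega>\<^esub> n\<rbrakk> \<Longrightarrow> x = y"
  using \<Omega>.pow_eq_imp_eq_torsion_free torsion_free_procyclic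
  unfolding torsion_free_procyclic_def by metis

lemma inert_fin_subgroup: "inert_fin H \<Longrightarrow> subgroup H G"
  by (simp add: inertially_finite_def closed_subgroup_def)

text \<open>Surjectivity of \<open>d\<close> makes \<open>f H\<close> the index of
  \<open>d(H)\<close> in all of \<Omega>, so the classification of subgroups of finite index
  applies. The last part is what makes division by \<open>f H\<close> in \<open>d_norm\<close>
  possible.\<close>

lemma inert_fin_image:
  assumes "inert_fin H"
  shows "subgroup (d ` H) \<Omega>" "f H > 0" "d ` H = (\<lambda>x. x [^]\<^bsub>\<Omega>\<^esub> f H) ` carrier \<Omega>"
proof -
  show sub: "subgroup (d ` H) \<Omega>"
    using inert_fin_subgroup[OF assms] by (rule d.subgroup_img_is_subgroup)
  have f: "f H = card (rcosets\<^bsub>\<Omega>\<^esub> (d ` H))"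
    by (simp add: abs_f_def ram_f_def sub_index_def d_image)
  have fin: "finite (rcosets\<^bsub>\<Omega>\<^esub> (d ` H))"
    using assms by (simp add: inertially_finite_def finite_index_def d_image)
  have "d ` H #>\<^bsub>\<Omega>\<^esub> \<one>\<^bsub>\<Omega>\<^esub> \<in> rcosets\<^bsub>\<Omega>\<^esub> (d ` H)" by (auto simp: RCOSETS_def)
  then show "f H > 0" using fin f by (auto simp: card_gt_0_iff)
  show "d ` H = (\<lambda>x. x [^]\<^bsub>\<Omega>\<^esub> f H) ` carrier \<Omega>"
    unfolding f by (rule procyclic_subgroup_eq_powers[OF torsion_free_procyclic sub fin])
qed

lemma abs_f_mult:
  assumes "inert_fin H" "inert_fin K" "K \<subseteq> H"
  shows "f K = f H * ram_f \<Omega> d H K"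
proof -
  have "sub_index \<Omega> (carrier \<Omega>) (d ` K) = sub_index \<Omega> (carrier \<Omega>) (d ` H) * sub_index \<Omega> (d ` H) (d ` K)"
    using assms inert_fin_image(1)[OF assms(1)] inert_fin_image(1)[OF assms(2)]
    by (intro sub_index_mult \<Omega>.is_group \<Omega>.subgroup_self) (auto dest: subgroup.subset)
  then show ?thesis by (simp add: abs_f_def ram_f_def d_image)
qed

text \<open>Torsion-freeness makes \<open>f H\<close>-th roots unique, so the \<open>THE\<close> in
  \<open>d_norm\<close> is determined. Afterwards degrees are handled through \<open>d\<close>
  itself.\<close>

lemma d_norm_eq_iff:
  assumes "inert_fin H" "h \<in> H" "w \<in> carrier \<Omega>"
  shows "d_norm G \<Omega> d H h = w \<longleftrightarrow> d h = w [^]\<^bsub>\<Omega>\<^esub> f H"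
proof -
  obtain w' where w': "w' \<in> carrier \<Omega>" "d h = w' [^]\<^bsub>\<Omega>\<^esub> f H"
    using inert_fin_image(3)[OF assms(1)] assms(2) by blast
  have "d_norm G \<Omega> d H h = w'"
    unfolding d_norm_def
  proof (rule the_equality)
    fix w assume "w \<in> carrier \<Omega> \<and> w [^]\<^bsub>\<Omega>\<^esub> f H = d h"
    then show "w = w'" using w' root_unique[OF _ _ inert_fin_image(2)[OF assms(1)]] by simp
  qed (use w' in simp)
  then show ?thesis using w' assms(3) root_unique[OF _ _ inert_fin_image(2)[OF assms(1)]] by metis
qed

text \<open>Inertial finiteness of \<open>U\<close> is included because positivity of
  \<open>f U\<close> will yield finiteness of \<open>[H:U]\<close>. For a datum it holds since
  \<open>U\<close> is a point of the inertially finite system \<open>M\<close>.\<close>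

definition unramified_ext :: "'g set \<Rightarrow> 'g set \<Rightarrow> bool" where
  "unramified_ext H U \<longleftrightarrow>
     inert_fin H \<and> inert_fin U \<and> U \<lhd> G\<lparr>carrier := H\<rparr> \<and> inertia G \<Omega> d H \<subseteq> U"

lemma unramified_extD:
  assumes "unramified_ext H U"
  shows "inert_fin H" "inert_fin U" "U \<lhd> G\<lparr>carrier := H\<rparr>" "inertia G \<Omega> d H \<subseteq> U"
    "subgroup H G" "subgroup U G" "U \<subseteq> H"
  using assms inert_fin_subgroup normal_imp_subgroup[of U "G\<lparr>carrier := H\<rparr>"]
    subgroup.subset[of U "G\<lparr>carrier := H\<rparr>"]
  by (auto simp: unramified_ext_def)

text \<open>The quotient of the two elements has degree zero, so it lies in the inertia group of
  \<open>H\<close>, which \<open>U\<close> contains. Hence a coset of \<open>U\<close> in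
  \<open>H\<close> is determined by the degree of any of its elements.\<close>

lemma mem_of_eq_d:
  assumes "unramified_ext H U" "h \<in> H" "h' \<in> H" "d h = d h'"
  shows "h' \<otimes>\<^bsub>G\<^esub> inv\<^bsub>G\<^esub> h \<in> U"
proof -
  interpret H: subgroup H G using assms unramified_extD by blast
  have "d (h' \<otimes>\<^bsub>G\<^esub> inv\<^bsub>G\<^esub> h) = \<one>\<^bsub>\<Omega>\<^esub>" using assms by simp
  then have "h' \<otimes>\<^bsub>G\<^esub> inv\<^bsub>G\<^esub> h \<in> inertia G \<Omega> d H"
    using assms by (simp add: inertia_def kernel_def)
  then show ?thesis using unramified_extD(4)[OF assms(1)] by blast
qed

lemma rcos_eq_of_eq_d:
  assumes "unramified_ext H U" "h \<in> H" "h' \<in> H" "d h = d h'"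
  shows "U #>\<^bsub>G\<^esub> h = U #>\<^bsub>G\<^esub> h'"
proof -
  interpret H: subgroup H G using assms unramified_extD by blast
  interpret U: subgroup U G using assms unramified_extD by blast
  have "h' = (h' \<otimes>\<^bsub>G\<^esub> inv\<^bsub>G\<^esub> h) \<otimes>\<^bsub>G\<^esub> h" using assms by (simp add: G.m_assoc)
  then have "h' \<in> U #>\<^bsub>G\<^esub> h" using mem_of_eq_d[OF assms] by (force simp: r_coset_def)
  then show ?thesis using assms U.subgroup_axioms by (intro G.repr_independence) auto
qed

lemma carrier_quot: "carrier (quot_group G H U) = (\<lambda>h. U #>\<^bsub>G\<^esub> h) ` H"
  by (simp add: carrier_FactGroup)

lemma group_quot: "unramified_ext H U \<Longrightarrow> group (quot_group G H U)"
  using unramified_extD(3) by (rule normal.factorgroup_is_group)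

lemma mult_quot:
  assumes "unramified_ext H U" "a \<in> H" "b \<in> H"
  shows "(U #>\<^bsub>G\<^esub> a) \<otimes>\<^bsub>quot_group G H U\<^esub> (U #>\<^bsub>G\<^esub> b) = U #>\<^bsub>G\<^esub> (a \<otimes>\<^bsub>G\<^esub> b)"
  using normal.rcos_sum[OF unramified_extD(3)[OF assms(1)], of a b] assms by simp

lemma int_pow_quot:
  assumes "unramified_ext H U" "a \<in> H"
  shows "(U #>\<^bsub>G\<^esub> a) [^]\<^bsub>quot_group G H U\<^esub> (k::int) = U #>\<^bsub>G\<^esub> (a [^]\<^bsub>G\<^esub> k)"
  using normal.FactGroup_int_pow[OF unramified_extD(3)[OF assms(1)], of a k] assms
    G.int_pow_consistent[OF unramified_extD(5)[OF assms(1)], of a k] by simp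

lemma frobenius_eq:
  assumes "unramified_ext H U" "h \<in> H" "d h = \<omega> [^]\<^bsub>\<Omega>\<^esub> f H"
  shows "frobenius G \<Omega> \<omega> d H U = U #>\<^bsub>G\<^esub> h"
  unfolding frobenius_def
proof (rule the_equality)
  show "\<exists>h'\<in>H. d_norm G \<Omega> d H h' = \<omega> \<and> U #>\<^bsub>G\<^esub> h = U #>\<^bsub>G\<^esub> h'"
    using assms unramified_extD by (auto simp: d_norm_eq_iff)
  fix x assume "\<exists>h'\<in>H. d_norm G \<Omega> d H h' = \<omega> \<and> x = U #>\<^bsub>G\<^esub> h'"
  then obtain h' where h': "h' \<in> H" "d_norm G \<Omega> d H h' = \<omega>" "x = U #>\<^bsub>G\<^esub> h'" by blast
  then have "d h' = \<omega> [^]\<^bsub>\<Omega>\<^esub> f H"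
    using d_norm_eq_iff[OF unramified_extD(1)[OF assms(1)]] by simp
  then show "x = U #>\<^bsub>G\<^esub> h" using rcos_eq_of_eq_d[OF assms(1) h'(1) assms(2)] h'(3) assms(3) by simp
qed

lemma frobenius_lift:
  assumes "inert_fin H"
  obtains h where "h \<in> H" "d h = \<omega> [^]\<^bsub>\<Omega>\<^esub> f H"
proof -
  have "\<omega> [^]\<^bsub>\<Omega>\<^esub> f H \<in> d ` H" unfolding inert_fin_image(3)[OF assms] by simp
  then show ?thesis using that by fastforce
qed

lemma int_pow_mem: "subgroup H G \<Longrightarrow> h \<in> H \<Longrightarrow> h [^]\<^bsub>G\<^esub> (k::int) \<in> H"
  using group.int_pow_closed[OF G.subgroup_imp_group[of H], of h k] G.int_pow_consistent[of H h k]
  by simp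

text \<open>Allowing any \<open>h\<close> of the right degree, not only a power of a Frobenius lift,
  lets a coset be recognised as a Frobenius power by computing \<open>d\<close> alone.\<close>

lemma frobenius_pow_eq:
  assumes "unramified_ext H U" "h \<in> H" "d h = \<omega> [^]\<^bsub>\<Omega>\<^esub> (int (f H) * k)"
  shows "frobenius G \<Omega> \<omega> d H U [^]\<^bsub>quot_group G H U\<^esub> k = U #>\<^bsub>G\<^esub> h"
proof -
  note H = unramified_extD[OF assms(1)]
  obtain h0 where h0: "h0 \<in> H" "d h0 = \<omega> [^]\<^bsub>\<Omega>\<^esub> f H" using frobenius_lift[OF H(1)] .
  have "h0 \<in> carrier G" using subgroup.mem_carrier[OF H(5) h0(1)] .
  then have "d (h0 [^]\<^bsub>G\<^esub> k) = (\<omega> [^]\<^bsub>\<Omega>\<^esub> int (f H)) [^]\<^bsub>\<Omega>\<^esub> k"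
    using h0 by (simp add: d.hom_int_pow int_pow_int)
  then have "d (h0 [^]\<^bsub>G\<^esub> k) = d h" using assms(3) by (simp add: \<Omega>.int_pow_pow)
  then have "U #>\<^bsub>G\<^esub> (h0 [^]\<^bsub>G\<^esub> k) = U #>\<^bsub>G\<^esub> h"
    using int_pow_mem[OF H(5) h0(1)] assms(2) by (intro rcos_eq_of_eq_d[OF assms(1)])
  then show ?thesis using int_pow_quot[OF assms(1) h0(1)] frobenius_eq[OF assms(1) h0] by simp
qed

lemma frobenius_pow_lift:
  assumes "inert_fin H"
  obtains h where "h \<in> H" "d h = \<omega> [^]\<^bsub>\<Omega>\<^esub> (int (f H) * k)"
proof -
  obtain h0 where h0: "h0 \<in> H" "d h0 = \<omega> [^]\<^bsub>\<Omega>\<^esub> f H" using frobenius_lift[OF assms] .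
  have "h0 \<in> carrier G" using subgroup.mem_carrier[OF inert_fin_subgroup[OF assms] h0(1)] .
  then have "d (h0 [^]\<^bsub>G\<^esub> k) = (\<omega> [^]\<^bsub>\<Omega>\<^esub> int (f H)) [^]\<^bsub>\<Omega>\<^esub> k"
    using h0 by (simp add: d.hom_int_pow int_pow_int)
  then show ?thesis
    using that[of "h0 [^]\<^bsub>G\<^esub> k"] int_pow_mem[OF inert_fin_subgroup[OF assms] h0(1)]
    by (simp add: \<Omega>.int_pow_pow)
qed

text \<open>The degree of an element of \<open>H\<close> is \<open>f H w\<close>, where
  \<open>w\<close> need not be an integer multiple of \<open>\<omega>\<close>. Writing
  \<open>w = i\<omega> + f_U y\<close>, the unwanted part \<open>f_H f_U y\<close> is the degree of
  some \<open>u\<close> in \<open>U\<close>, and replacing \<open>h\<close> by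
  \<open>inv u h\<close> removes it without changing the coset.\<close>

lemma coset_representative:
  assumes "unramified_ext H U" "x \<in> carrier (quot_group G H U)"
  obtains h k where "h \<in> H" "d h = \<omega> [^]\<^bsub>\<Omega>\<^esub> (int (f H) * k)" "x = U #>\<^bsub>G\<^esub> h"
proof -
  note H = unramified_extD[OF assms(1)]
  interpret H: subgroup H G by fact
  interpret U: subgroup U G by fact
  obtain h where h: "h \<in> H" "x = U #>\<^bsub>G\<^esub> h" using assms(2) by (auto simp: carrier_quot)
  then obtain w where w: "w \<in> carrier \<Omega>" "d h = w [^]\<^bsub>\<Omega>\<^esub> f H"
    using inert_fin_image(3)[OF H(1)] by blast
  \<comment> \<open>The modulus \<open>[H:U]\<close> would do, but its positivity is not yet known;
    \<open>f U\<close> is its multiple by \<open>f H\<close> and is already known to be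
    positive.\<close>
  obtain i y where y: "y \<in> carrier \<Omega>" "w = \<omega> [^]\<^bsub>\<Omega>\<^esub> (i::nat) \<otimes>\<^bsub>\<Omega>\<^esub> y [^]\<^bsub>\<Omega>\<^esub> f U"
    using procyclic_decompose[OF torsion_free_procyclic inert_fin_image(2)[OF H(2)] w(1)] by blast
  have "(y [^]\<^bsub>\<Omega>\<^esub> f H) [^]\<^bsub>\<Omega>\<^esub> f U \<in> d ` U"
    unfolding inert_fin_image(3)[OF H(2)] using y(1) by blast
  then obtain u where u: "u \<in> U" "d u = (y [^]\<^bsub>\<Omega>\<^esub> f H) [^]\<^bsub>\<Omega>\<^esub> f U" by auto
  have uH: "u \<in> H" using u H(7) by blast
  have du: "d u \<in> carrier \<Omega>" using uH by simp
  have "d h = d u \<otimes>\<^bsub>\<Omega>\<^esub> (\<omega> [^]\<^bsub>\<Omega>\<^esub> i) [^]\<^bsub>\<Omega>\<^esub> f H"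
    using y w u by (simp add: \<Omega>.nat_pow_distrib \<Omega>.nat_pow_pow mult.commute \<Omega>.m_comm)
  then have "d (inv\<^bsub>G\<^esub> u \<otimes>\<^bsub>G\<^esub> h) = (\<omega> [^]\<^bsub>\<Omega>\<^esub> i) [^]\<^bsub>\<Omega>\<^esub> f H"
    using h(1) uH du by (simp add: \<Omega>.m_assoc[symmetric])
  also have "\<dots> = \<omega> [^]\<^bsub>\<Omega>\<^esub> (int (f H) * int i)"
    by (simp add: \<Omega>.int_pow_pow mult.commute flip: int_pow_int)
  finally have "d (inv\<^bsub>G\<^esub> u \<otimes>\<^bsub>G\<^esub> h) = \<omega> [^]\<^bsub>\<Omega>\<^esub> (int (f H) * int i)" .
  moreover have "x = U #>\<^bsub>G\<^esub> (inv\<^bsub>G\<^esub> u \<otimes>\<^bsub>G\<^esub> h)"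
    using h u by (simp add: G.coset_mult_assoc[symmetric] G.coset_join2 U.subset H(6))
  ultimately show ?thesis using that h uH by blast
qed

lemma carrier_quot_eq_frobenius_powers:
  assumes "unramified_ext H U"
  shows "carrier (quot_group G H U) =
    range (\<lambda>k::int. frobenius G \<Omega> \<omega> d H U [^]\<^bsub>quot_group G H U\<^esub> k)"
proof (intro equalityI subsetI)
  fix x assume "x \<in> carrier (quot_group G H U)"
  then show "x \<in> range (\<lambda>k::int. frobenius G \<Omega> \<omega> d H U [^]\<^bsub>quot_group G H U\<^esub> k)"
    using coset_representative[OF assms, of x] frobenius_pow_eq[OF assms] by (metis rangeI)
next
  fix x assume "x \<in> range (\<lambda>k::int. frobenius G \<Omega> \<omega> d H U [^]\<^bsub>quot_group G H U\<^esub> k)"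
  then obtain k :: int where x: "x = frobenius G \<Omega> \<omega> d H U [^]\<^bsub>quot_group G H U\<^esub> k" by blast
  obtain h where "h \<in> H" "d h = \<omega> [^]\<^bsub>\<Omega>\<^esub> (int (f H) * k)"
    using frobenius_pow_lift[OF unramified_extD(1)[OF assms]] .
  then show "x \<in> carrier (quot_group G H U)"
    using frobenius_pow_eq[OF assms] by (simp add: x carrier_quot)
qed

lemma frobenius_closed:
  assumes "unramified_ext H U"
  shows "frobenius G \<Omega> \<omega> d H U \<in> carrier (quot_group G H U)"
proof -
  obtain h where "h \<in> H" "d h = \<omega> [^]\<^bsub>\<Omega>\<^esub> f H"
    using frobenius_lift[OF unramified_extD(1)[OF assms]] .
  then show ?thesis using frobenius_eq[OF assms] by (simp add: carrier_quot)
qed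

lemma comm_group_quot:
  assumes "unramified_ext H U"
  shows "comm_group (quot_group G H U)"
proof -
  interpret Q: group "quot_group G H U" using assms by (rule group_quot)
  show ?thesis
  proof (rule Q.group_comm_groupI)
    fix x y assume "x \<in> carrier (quot_group G H U)" "y \<in> carrier (quot_group G H U)"
    then obtain k l :: int where
      "x = frobenius G \<Omega> \<omega> d H U [^]\<^bsub>quot_group G H U\<^esub> k"
      "y = frobenius G \<Omega> \<omega> d H U [^]\<^bsub>quot_group G H U\<^esub> l"
      unfolding carrier_quot_eq_frobenius_powers[OF assms] by blast
    then show "x \<otimes>\<^bsub>quot_group G H U\<^esub> y = y \<otimes>\<^bsub>quot_group G H U\<^esub> x"
      using frobenius_closed[OF assms] by (simp only: Q.int_pow_mult[symmetric] add.commute)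
  qed
qed

text \<open>The degree induces a bijection from the cosets of \<open>U\<close> in \<open>H\<close>
  to those of \<open>d(U)\<close> in \<open>d(H)\<close>; it is injective because elements of equal
  degree share a coset. Equality of cardinalities holds before finiteness of the index is
  known.\<close>

lemma sub_index_eq_ram_f:
  assumes "unramified_ext H U"
  shows "sub_index G H U = ram_f \<Omega> d H U"
proof -
  note H = unramified_extD[OF assms]
  interpret H: subgroup H G by fact
  interpret U: subgroup U G by fact
  interpret dU: subgroup "d ` U" \<Omega> using inert_fin_image(1)[OF H(2)] .
  have rG: "rcosets\<^bsub>G\<lparr>carrier := H\<rparr>\<^esub> U = (\<lambda>h. U #>\<^bsub>G\<^esub> h) ` H"
    by (auto simp: RCOSETS_def)
  have rO: "rcosets\<^bsub>\<Omega>\<lparr>carrier := d ` H\<rparr>\<^esub> (d ` U) = (\<lambda>h. d ` U #>\<^bsub>\<Omega>\<^esub> d h) ` H"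
    by (auto simp: RCOSETS_def)
  have img: "d ` (U #>\<^bsub>G\<^esub> h) = d ` U #>\<^bsub>\<Omega>\<^esub> d h" if "h \<in> H" for h
    using that by (force simp: r_coset_def image_iff)
  have "bij_betw ((`) d) ((\<lambda>h. U #>\<^bsub>G\<^esub> h) ` H) ((\<lambda>h. d ` U #>\<^bsub>\<Omega>\<^esub> d h) ` H)"
    unfolding bij_betw_def
  proof
    show "inj_on ((`) d) ((\<lambda>h. U #>\<^bsub>G\<^esub> h) ` H)"
    proof (rule inj_onI, clarify)
      fix h h' assume h: "h \<in> H" "h' \<in> H" "d ` (U #>\<^bsub>G\<^esub> h) = d ` (U #>\<^bsub>G\<^esub> h')"
      have "h \<in> U #>\<^bsub>G\<^esub> h" using h G.rcos_self H(6) by auto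
      then have "d h \<in> d ` (U #>\<^bsub>G\<^esub> h')" using h(3) by blast
      then obtain u where u: "u \<in> U" "d h = d (u \<otimes>\<^bsub>G\<^esub> h')" by (auto simp: r_coset_def)
      then have "U #>\<^bsub>G\<^esub> h = U #>\<^bsub>G\<^esub> (u \<otimes>\<^bsub>G\<^esub> h')"
        using h H(7) by (intro rcos_eq_of_eq_d[OF assms]) auto
      also have "\<dots> = U #>\<^bsub>G\<^esub> h'"
        using h u by (simp add: G.coset_mult_assoc[symmetric] G.coset_join2 U.subset H(6))
      finally show "U #>\<^bsub>G\<^esub> h = U #>\<^bsub>G\<^esub> h'" .
    qed
    show "(`) d ` (\<lambda>h. U #>\<^bsub>G\<^esub> h) ` H = (\<lambda>h. d ` U #>\<^bsub>\<Omega>\<^esub> d h) ` H"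
      using img by (simp add: image_image)
  qed
  from bij_betw_same_card[OF this] show ?thesis
    by (simp add: sub_index_def ram_f_def rG rO)
qed

lemma abs_f_unramified_ext:
  assumes "unramified_ext H U"
  shows "f U = f H * sub_index G H U"
  using abs_f_mult[OF unramified_extD(1,2,7)[OF assms]] sub_index_eq_ram_f[OF assms] by simp

text \<open>The positive number \<open>f U\<close> is a multiple of the index, so the index is not
  the default value \<open>0\<close> of an infinite one. Finiteness of \<open>H/U\<close> is drawn
  from here.\<close>

lemma sub_index_pos: "unramified_ext H U \<Longrightarrow> sub_index G H U > 0"
  using abs_f_unramified_ext[of H U] inert_fin_image(2)[of U] unramified_extD(2)[of H U]
  by (cases "sub_index G H U") auto

lemma order_quot: "order (quot_group G H U) = sub_index G H U"
  by (simp add: order_def sub_index_def FactGroup_def)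

lemma finite_quot: "unramified_ext H U \<Longrightarrow> finite (carrier (quot_group G H U))"
  using sub_index_pos[of H U] order_quot[of H U] 
  by (intro card_ge_0_finite) (simp add: order_def)

lemma frobenius_pow_eq_one_iff:
  assumes "unramified_ext H U"
  shows "frobenius G \<Omega> \<omega> d H U [^]\<^bsub>quot_group G H U\<^esub> (k::int) = \<one>\<^bsub>quot_group G H U\<^esub>
    \<longleftrightarrow> int (sub_index G H U) dvd k"
proof -
  interpret Q: group "quot_group G H U" using assms by (rule group_quot)
  note F = frobenius_closed[OF assms]
  have "generate (quot_group G H U) {frobenius G \<Omega> \<omega> d H U} = carrier (quot_group G H U)"
    using Q.generate_pow[OF F] carrier_quot_eq_frobenius_powers[OF assms] by auto
  then have "Q.ord (frobenius G \<Omega> \<omega> d H U) = sub_index G H U"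
    using Q.generate_pow_card[OF F] by (simp add: order_quot[symmetric] order_def)
  then show ?thesis using Q.int_pow_eq_id[OF F] by simp
qed

text \<open>The transfer is the power by \<open>m = [H/U : I/U]\<close>. Comparing
  \<open>f U = f_H [H:U]\<close> with \<open>f U = f_I [I:U]\<close> gives
  \<open>f_I = f_H m\<close>, so the \<open>m\<close>-th power takes degree
  \<open>f_H k \<omega>\<close> to \<open>f_I k \<omega>\<close> with the same \<open>k\<close>. In
  particular Frobenius goes to Frobenius.\<close>

lemma transfer_quot:
  assumes "unramified_ext H U" "unramified_ext I U" "I \<subseteq> H"
    and "h \<in> H" "d h = \<omega> [^]\<^bsub>\<Omega>\<^esub> (int (f H) * k)"
  obtains h' where "h' \<in> I" "d h' = \<omega> [^]\<^bsub>\<Omega>\<^esub> (int (f I) * k)"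
    "transfer_map (quot_group G H U) (carrier (quot_group G I U)) (U #>\<^bsub>G\<^esub> h) = U #>\<^bsub>G\<^esub> h'"
proof -
  note H = unramified_extD[OF assms(1)] and I = unramified_extD[OF assms(2)]
  interpret H: subgroup H G by fact
  interpret Q: comm_group "quot_group G H U" using assms(1) by (rule comm_group_quot)
  have sub: "subgroup (carrier (quot_group G I U)) (quot_group G H U)"
  proof (rule Q.subgroupI)
    show "carrier (quot_group G I U) \<subseteq> carrier (quot_group G H U)"
      using assms(3) by (auto simp: carrier_quot)
    show "carrier (quot_group G I U) \<noteq> {}"
      using subgroup.one_closed[OF I(5)] by (auto simp: carrier_quot)
    fix x assume "x \<in> carrier (quot_group G I U)"
    then obtain a where a: "a \<in> I" "x = U #>\<^bsub>G\<^esub> a" by (auto simp: carrier_quot)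
    then have "inv\<^bsub>quot_group G H U\<^esub> x = U #>\<^bsub>G\<^esub> (a [^]\<^bsub>G\<^esub> (- 1 :: int))"
      using int_pow_quot[OF assms(1), of a "-1"] assms(3) Q.int_pow_neg[of x 1]
      by (auto simp: carrier_quot)
    then show "inv\<^bsub>quot_group G H U\<^esub> x \<in> carrier (quot_group G I U)"
      using int_pow_mem[OF I(5) a(1)] by (auto simp: carrier_quot)
    fix y assume "y \<in> carrier (quot_group G I U)"
    then obtain b where b: "b \<in> I" "y = U #>\<^bsub>G\<^esub> b" by (auto simp: carrier_quot)
    then show "x \<otimes>\<^bsub>quot_group G H U\<^esub> y \<in> carrier (quot_group G I U)"
      using mult_quot[OF assms(1), of a b] a assms(3) subgroup.m_closed[OF I(5) a(1) b(1)]
      by (auto simp: carrier_quot)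
  qed
  define m where "m = card (rcosets\<^bsub>quot_group G H U\<^esub> carrier (quot_group G I U))"
  have "m * sub_index G I U = sub_index G H U"
    using Q.lagrange[OF sub] order_quot[of H U] order_quot[of I U] by (simp add: m_def order_def)
  moreover have "f I * sub_index G I U = f H * sub_index G H U"
    using abs_f_unramified_ext[OF assms(1)] abs_f_unramified_ext[OF assms(2)] by simp
  ultimately have "f I * sub_index G I U = (f H * m) * sub_index G I U"
    by (metis mult.assoc)
  then have fI: "f I = f H * m" using sub_index_pos[OF assms(2)] by simp
  define h' where "h' = h [^]\<^bsub>G\<^esub> int m"
  have h'H: "h' \<in> H" using int_pow_mem[OF H(5) assms(4)] by (simp add: h'_def)
  have dh': "d h' = \<omega> [^]\<^bsub>\<Omega>\<^esub> (int (f I) * k)"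
    using assms(4,5) by (simp add: h'_def d.hom_int_pow \<Omega>.int_pow_pow fI mult_ac)
  \<comment> \<open>\<open>I\<close> contains some element of the same degree; \<open>h'\<close>
    differs from it by an element of \<open>U\<close>, and \<open>U\<close> is contained in
    \<open>I\<close>.\<close>
  have "h' \<in> I"
  proof -
    obtain h1 where h1: "h1 \<in> I" "d h1 = \<omega> [^]\<^bsub>\<Omega>\<^esub> (int (f I) * k)"
      using frobenius_pow_lift[OF I(1)] .
    then have "h' \<otimes>\<^bsub>G\<^esub> inv\<^bsub>G\<^esub> h1 \<in> U"
      using mem_of_eq_d[OF assms(1)] h'H dh' assms(3) by (metis subsetD)
    then have "h' \<otimes>\<^bsub>G\<^esub> inv\<^bsub>G\<^esub> h1 \<otimes>\<^bsub>G\<^esub> h1 \<in> I"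
      using h1 I(7) subgroup.m_closed[OF I(5)] by blast
    moreover have "h1 \<in> carrier G" using h1 assms(3) by auto
    ultimately show ?thesis using h'H by (simp add: G.m_assoc)
  qed
  moreover have "transfer_map (quot_group G H U) (carrier (quot_group G I U)) (U #>\<^bsub>G\<^esub> h) = U #>\<^bsub>G\<^esub> h'"
    using transfer_map_eq_pow[OF Q.comm_group_axioms finite_quot[OF assms(1)] sub, of "U #>\<^bsub>G\<^esub> h"]
      int_pow_quot[OF assms(1,4), of "int m"] assms(4)
    by (simp add: m_def h'_def carrier_quot int_pow_int)
  ultimately show ?thesis using that dh' by blast
qed

end

section \<open>Unramified Fesenko--Neukirch data\<close>

lemma conj_pair_simp [simp]: "conj_pair G g (H, U) = (conj_set G g H, conj_set G g U)"
  by (simp add: conj_pair_def)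

lemma hom_mem: "h \<in> hom P Q \<Longrightarrow> a \<in> carrier P \<Longrightarrow> h a \<in> carrier Q"
  by (auto simp: hom_def)

lemma conj_set_eq_image: "conj_set G g S = (\<lambda>x. g \<otimes>\<^bsub>G\<^esub> x \<otimes>\<^bsub>G\<^esub> inv\<^bsub>G\<^esub> g) ` S"
  by (auto simp: conj_set_def l_coset_def r_coset_def)

lemma sub_index_self:
  assumes "group G" "subgroup J G"
  shows "sub_index G J J = 1"
proof -
  interpret group G by fact
  interpret J: subgroup J G by fact
  have "rcosets\<^bsub>G\<lparr>carrier := J\<rparr>\<^esub> J = (\<lambda>x. J #>\<^bsub>G\<^esub> x) ` J" by (auto simp: RCOSETS_def)
  also have "\<dots> = (\<lambda>x. J) ` J" by (rule image_cong) (simp_all add: coset_join2[OF _ assms(2)])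
  also have "\<dots> = {J}" using J.one_closed by (rule image_constant)
  finally show ?thesis by (simp add: sub_index_def)
qed

text \<open>The Mackey formula is stated for every set of representatives, so at least one is needed
  to apply it.\<close>

lemma dcoset_reps_exists: "\<exists>R. dcoset_reps G I H J R"
proof -
  obtain R where "R \<subseteq> H" "inj_on (\<lambda>h. dcoset G I h J) R"
    "(\<lambda>h. dcoset G I h J) ` H = (\<lambda>h. dcoset G I h J) ` R"
    using subset_image_inj[of "(\<lambda>h. dcoset G I h J) ` H" "\<lambda>h. dcoset G I h J" H] by auto
  then show ?thesis by (auto simp: dcoset_reps_def bij_betw_def)
qed

locale unramified_datum = procyclic_degree G T \<Omega> T\<Omega> \<omega> d
  for G :: "'g monoid" and T :: "'g topology"
    and \<Omega> :: "'w monoid" and T\<Omega> :: "'w topology" and \<omega> :: 'w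
    and d :: "'g \<Rightarrow> 'w" +
  fixes E :: "('g set \<times> 'g set) ric_domain"
    and M :: "'g set ric_domain"
    and C :: "('g, 'g set, 'c) ric_functor"
    and v :: "'g set \<Rightarrow> 'c \<Rightarrow> 'w"
  assumes unramified: "unramified_spectrum G T \<Omega> d E"
    and datum: "unramified_FN_datum G T \<Omega> \<omega> d E M C v"
begin

abbreviation "A \<equiv> obj_grp C"
abbreviation "N \<equiv> norm_group C"

section \<open>Consequences of the spectrum, the Mackey cover and the valuation\<close>

lemma ric_E: "is_ric_domain G (conj_pair G) E"
  using unramified by (simp add: unramified_spectrum_def spectrum_def two_dim_system_def)

lemma ric_C: "is_ric_functor G (conj_set G) M C"
  using datum by (simp add: unramified_FN_datum_def mackey_functor_def)

lemma ric_M: "is_ric_domain G (conj_set G) M"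
  using datum by (simp add: unramified_FN_datum_def mackey_cover_def mackey_system_def subgroup_system_def)

lemmas C_simps = ric_functorD[OF ric_C]

lemma act_E:
  assumes "(H, U) \<in> pts E" "g \<in> carrier G"
  shows "(conj_set G g H, conj_set G g U) \<in> pts E"
  using ric_domain_act[OF ric_E assms] by (simp add: conj_pair_def)

lemmas dom_M = ric_domainD[OF ric_M]
lemmas dom_E = ric_domainD[OF ric_E]

lemma pts_flat: "(H, U) \<in> pts E \<Longrightarrow> H \<in> pts (flat E)"
  by (force simp: flat_def)

lemma pts_M:
  assumes "(H, U) \<in> pts E"
  shows "H \<in> pts M" "U \<in> ind_dom M H" "U \<in> pts M"
proof -
  have cover: "mackey_cover G E M" using datum by (simp add: unramified_FN_datum_def)
  show H: "H \<in> pts M"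
    using cover pts_flat[OF assms] by (auto simp: mackey_cover_def subsystem_def)
  show U: "U \<in> ind_dom M H"
    using cover pts_flat[OF assms] assms by (auto simp: mackey_cover_def Ext_def)
  show "U \<in> pts M" using dom_M(2)[OF H U] .
qed

lemma unramified_ext_E:
  assumes "(H, U) \<in> pts E"
  shows "unramified_ext H U"
  using assms unramified datum pts_M(3)[OF assms]
  unfolding unramified_ext_def unramified_spectrum_def unramified_FN_datum_def inertially_finite_system_def
  by blast

lemma dom_E_subset:
  assumes "(H, U) \<in> pts E" "(I, V) \<in> res_dom E (H, U) \<union> ind_dom E (H, U)"
  shows "I \<subseteq> H" "V \<subseteq> U"
proof -
  have "two_dim_system G T E" using unramified by (simp add: unramified_spectrum_def spectrum_def)
  then have "\<forall>(I, V) \<in> res_dom E (H, U) \<union> ind_dom E (H, U). I \<subseteq> H \<and> V \<subseteq> U"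
    unfolding two_dim_system_def by - (drule conjunct2, drule bspec[OF _ assms(1)], simp)
  then show "I \<subseteq> H" "V \<subseteq> U" using assms(2) by blast+
qed

lemma res_E:
  assumes "(H, U) \<in> pts E" "(I, V) \<in> res_dom E (H, U)"
  shows "V = U" "I \<in> res_dom M H" "I \<subseteq> H"
proof -
  show "V = U" using assms unramified
    by (auto simp: unramified_spectrum_def spectrum_def)
  have "subsystem (flat E) M" using datum by (simp add: unramified_FN_datum_def mackey_cover_def)
  moreover have "I \<in> res_dom (flat E) H" using assms by (force simp: flat_def Ext_def)
  ultimately show "I \<in> res_dom M H" using pts_flat[OF assms(1)] by (auto simp: subsystem_def)
  show "I \<subseteq> H" using dom_E_subset(1) assms by blast
qed

lemma ind_E:
  assumes "(H, U) \<in> pts E" "(I, V) \<in> ind_dom E (H, U)"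
  shows "V \<subseteq> U" "I \<in> ind_dom M H" "I \<subseteq> H" "V \<in> ind_dom M U"
proof -
  have "subsystem (flat E) M" using datum by (simp add: unramified_FN_datum_def mackey_cover_def)
  moreover have "I \<in> ind_dom (flat E) H" using assms by (force simp: flat_def Ext_def)
  ultimately show "I \<in> ind_dom M H" using pts_flat[OF assms(1)] by (auto simp: subsystem_def)
  show "V \<subseteq> U" "I \<subseteq> H" using dom_E_subset assms by blast+
  have "mackey_cover G E M" using datum by (simp add: unramified_FN_datum_def)
  then show "V \<in> ind_dom M U" using assms by (auto simp: mackey_cover_def)
qed

lemma v_morphism: "ric_morphism G (conj_set G) M C (omega_functor G \<Omega> d) v"
  using datum by (simp add: unramified_FN_datum_def valuation_def)

lemma v_group_hom:
  assumes "H \<in> pts M"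
  shows "group_hom (A H) \<Omega> (v H)"
proof -
  interpret AH: comm_group "A H" using C_simps(1)[OF assms] .
  show ?thesis
    using v_morphism assms by unfold_locales (simp add: ric_morphism_def omega_functor_def)
qed

lemma v_structure_maps:
  assumes "H \<in> pts M"
  shows "\<lbrakk>I \<in> res_dom M H; a \<in> carrier (A H)\<rbrakk> \<Longrightarrow>
      v I (res_map C I H a) = v H a [^]\<^bsub>\<Omega>\<^esub> ram_e G \<Omega> d H I"
    "\<lbrakk>I \<in> ind_dom M H; a \<in> carrier (A I)\<rbrakk> \<Longrightarrow>
      v H (ind_map C H I a) = v I a [^]\<^bsub>\<Omega>\<^esub> ram_f \<Omega> d H I"
    "\<lbrakk>g \<in> carrier G; a \<in> carrier (A H)\<rbrakk> \<Longrightarrow> v (conj_set G g H) (con_map C g H a) = v H a"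
  using v_morphism assms by (simp_all add: ric_morphism_def omega_functor_def)

lemma C_closed:
  assumes "H \<in> pts M"
  shows "\<lbrakk>I \<in> res_dom M H; a \<in> carrier (A H)\<rbrakk> \<Longrightarrow> res_map C I H a \<in> carrier (A I)"
    "\<lbrakk>I \<in> ind_dom M H; a \<in> carrier (A I)\<rbrakk> \<Longrightarrow> ind_map C H I a \<in> carrier (A H)"
    "\<lbrakk>g \<in> carrier G; a \<in> carrier (A H)\<rbrakk> \<Longrightarrow> con_map C g H a \<in> carrier (A (conj_set G g H))"
  using hom_mem[OF C_simps(2)[OF assms]] hom_mem[OF C_simps(3)[OF assms]]
    hom_mem[OF C_simps(4)[OF assms]] by blast+

lemma comm_group_A: "(H, U) \<in> pts E \<Longrightarrow> comm_group (A H)"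
  using C_simps(1) pts_M(1) by blast

lemma norm_subgroup:
  assumes "(H, U) \<in> pts E"
  shows "subgroup (N H U) (A H)"
proof -
  interpret AH: comm_group "A H" using C_simps(1)[OF pts_M(1)[OF assms]] .
  interpret AU: comm_group "A U" using C_simps(1)[OF pts_M(3)[OF assms]] .
  interpret group_hom "A U" "A H" "ind_map C H U"
    using C_simps(3)[OF pts_M(1,2)[OF assms]] by unfold_locales
  show ?thesis unfolding norm_group_def by (rule img_is_subgroup)
qed

lemma norm_normal:
  assumes "(H, U) \<in> pts E"
  shows "N H U \<lhd> A H"
  by (rule comm_group.subgroup_imp_normal[OF comm_group_A[OF assms] norm_subgroup[OF assms]])

lemma carrier_H0: "carrier (A H Mod N H U) = (\<lambda>a. N H U #>\<^bsub>A H\<^esub> a) ` carrier (A H)"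
  by (simp add: carrier_FactGroup)

lemma datumD:
  assumes "(H, U) \<in> pts E"
  defines "Q \<equiv> \<lambda>N'. quot_group \<Omega> (v H ` carrier (A H)) N'"
    and "N' \<equiv> (\<lambda>x. x [^]\<^bsub>\<Omega>\<^esub> sub_index G H U) ` v U ` carrier (A U)"
  shows "order (Q N') = sub_index G H U"
    "generate (Q N') {N' #>\<^bsub>\<Omega>\<^esub> \<omega>} = carrier (Q N')"
    "ind_map C H U ` kernel (A U) \<Omega> (v U) = kernel (A H) \<Omega> (v H)"
    "finite (carrier (A H Mod N H U))"
    "order (A H Mod N H U) \<le> sub_index G H U"
  using datum unfolding unramified_FN_datum_def Let_def Q_def N'_def
  by - (elim conjE, drule bspec[OF _ assms(1)], simp)+

section \<open>Valuations modulo norms and the reciprocity map of a single pair\<close>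

lemma kernel_v_subset_norm:
  assumes "(H, U) \<in> pts E" "a \<in> carrier (A H)" "v H a = \<one>\<^bsub>\<Omega>\<^esub>"
  shows "a \<in> N H U"
proof -
  show ?thesis using assms(2,3) datumD(3)[OF assms(1)] by (auto simp: norm_group_def kernel_def)
qed

lemma norm_coset_eq:
  assumes "(H, U) \<in> pts E" "a \<in> carrier (A H)" "c \<in> carrier (A H)"
    "v H a = v H c \<otimes>\<^bsub>\<Omega>\<^esub> \<omega> [^]\<^bsub>\<Omega>\<^esub> (int (sub_index G H U) * j)"
  shows "N H U #>\<^bsub>A H\<^esub> a = N H U #>\<^bsub>A H\<^esub> c"
proof -
  interpret AH: comm_group "A H" using comm_group_A[OF assms(1)] .
  interpret AU: comm_group "A U" using C_simps(1)[OF pts_M(3)[OF assms(1)]] .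
  interpret vH: group_hom "A H" \<Omega> "v H" using v_group_hom[OF pts_M(1)[OF assms(1)]] .
  interpret vU: group_hom "A U" \<Omega> "v U" using v_group_hom[OF pts_M(3)[OF assms(1)]] .
  interpret NH: subgroup "N H U" "A H" using norm_subgroup[OF assms(1)] .
  \<comment> \<open>The given prime elements belong to first components of \<open>E\<close>, and
    \<open>U\<close> need not be one. As a point of \<open>M\<close> it still has a prime element,
    supplied by the valuation.\<close>
  have "\<omega> \<in> v U ` carrier (A U)"
    using datum pts_M(3)[OF assms(1)] by (simp add: unramified_FN_datum_def valuation_def)
  then obtain b where b: "b \<in> carrier (A U)" "v U b = \<omega>" by auto
  \<comment> \<open>A norm of valuation exactly \<open>j [H:U] \<omega>\<close>, because induction
    from \<open>U\<close> multiplies valuations by \<open>f_{H|U} = [H:U]\<close>. Dividing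
    \<open>a\<close> by \<open>c e\<close> leaves an element of valuation zero, which is a norm by
    condition (b).\<close>
  define e where "e = ind_map C H U (b [^]\<^bsub>A U\<^esub> j)"
  have e: "e \<in> N H U" using b by (simp add: e_def norm_group_def)
  have "v H e = (\<omega> [^]\<^bsub>\<Omega>\<^esub> j) [^]\<^bsub>\<Omega>\<^esub> sub_index G H U"
    using v_structure_maps(2)[OF pts_M(1,2)[OF assms(1)], of "b [^]\<^bsub>A U\<^esub> j"] b
      sub_index_eq_ram_f[OF unramified_ext_E[OF assms(1)]]
    by (simp add: e_def vU.hom_int_pow)
  also have "\<dots> = \<omega> [^]\<^bsub>\<Omega>\<^esub> (int (sub_index G H U) * j)"
    by (simp add: \<Omega>.int_pow_pow mult.commute flip: int_pow_int)
  finally have ve: "v H e = \<omega> [^]\<^bsub>\<Omega>\<^esub> (int (sub_index G H U) * j)" .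
  have eA: "e \<in> carrier (A H)" using e NH.subset by blast
  have "v H (a \<otimes>\<^bsub>A H\<^esub> inv\<^bsub>A H\<^esub> (c \<otimes>\<^bsub>A H\<^esub> e)) = \<one>\<^bsub>\<Omega>\<^esub>"
    using assms eA ve by simp
  then have "a \<otimes>\<^bsub>A H\<^esub> inv\<^bsub>A H\<^esub> (c \<otimes>\<^bsub>A H\<^esub> e) \<in> N H U"
    using kernel_v_subset_norm[OF assms(1)] assms eA by simp
  moreover have "a = (a \<otimes>\<^bsub>A H\<^esub> inv\<^bsub>A H\<^esub> (c \<otimes>\<^bsub>A H\<^esub> e)) \<otimes>\<^bsub>A H\<^esub> e \<otimes>\<^bsub>A H\<^esub> c"
    using assms eA by (simp add: AH.m_assoc AH.m_comm[of e c])
  ultimately have "a \<in> N H U #>\<^bsub>A H\<^esub> c" using e by (force simp: r_coset_def)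
  then have "N H U #>\<^bsub>A H\<^esub> c = N H U #>\<^bsub>A H\<^esub> a"
    using assms(3) NH.subgroup_axioms by (rule AH.repr_independence)
  then show ?thesis by simp
qed

text \<open>
  Evaluating \<open>\<Upsilon>\<close> on arbitrary lifts of matching degree and valuation, rather than on powers of
  Frobenius and prime elements, reduces naturality to comparing degrees and valuations.
\<close>

lemma upsilon_eq:
  assumes "(H, U) \<in> pts E" "prime_element \<omega> C v H q"
    and "h \<in> H" "d h = \<omega> [^]\<^bsub>\<Omega>\<^esub> (int (f H) * k)"
    and "c \<in> carrier (A H)" "v H c = \<omega> [^]\<^bsub>\<Omega>\<^esub> k"
  shows "upsilon G \<Omega> \<omega> d C q H U (U #>\<^bsub>G\<^esub> h) = N H U #>\<^bsub>A H\<^esub> c"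
proof -
  note ur = unramified_ext_E[OF assms(1)]
  interpret Q: group "quot_group G H U" using group_quot[OF ur] .
  interpret AH: comm_group "A H" using comm_group_A[OF assms(1)] .
  interpret vH: group_hom "A H" \<Omega> "v H" using v_group_hom[OF pts_M(1)[OF assms(1)]] .
  note F = frobenius_closed[OF ur]
  have q: "q \<in> carrier (A H)" "v H q = \<omega>" using assms(2) by (auto simp: prime_element_def)
  have k: "frobenius G \<Omega> \<omega> d H U [^]\<^bsub>quot_group G H U\<^esub> k = U #>\<^bsub>G\<^esub> h"
    using frobenius_pow_eq[OF ur assms(3,4)] .
  \<comment> \<open>Uniqueness for the \<open>THE\<close> in \<open>upsilon\<close>: two exponents
    giving the same coset differ by a multiple of \<open>[H:U]\<close>, which changes the valuation
    only by that of a norm.\<close>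
  have *: "N H U #>\<^bsub>A H\<^esub> (q [^]\<^bsub>A H\<^esub> l) = N H U #>\<^bsub>A H\<^esub> c"
    if "U #>\<^bsub>G\<^esub> h = frobenius G \<Omega> \<omega> d H U [^]\<^bsub>quot_group G H U\<^esub> l" for l :: int
  proof -
    have "frobenius G \<Omega> \<omega> d H U [^]\<^bsub>quot_group G H U\<^esub> (l - k) = \<one>\<^bsub>quot_group G H U\<^esub>"
      using that k F Q.int_pow_closed[OF F, of k] by (simp only: Q.int_pow_diff Q.r_inv)
    then have "int (sub_index G H U) dvd l - k" unfolding frobenius_pow_eq_one_iff[OF ur] .
    then obtain j where j: "l - k = int (sub_index G H U) * j" by (rule dvdE)
    have "v H (q [^]\<^bsub>A H\<^esub> l) = \<omega> [^]\<^bsub>\<Omega>\<^esub> (k + (l - k))" using q by (simp add: vH.hom_int_pow)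
    also have "\<dots> = v H c \<otimes>\<^bsub>\<Omega>\<^esub> \<omega> [^]\<^bsub>\<Omega>\<^esub> (int (sub_index G H U) * j)"
      unfolding j by (simp add: \<Omega>.int_pow_mult assms(6))
    finally show ?thesis using q assms(5) by (intro norm_coset_eq[OF assms(1)]) auto
  qed
  show ?thesis unfolding upsilon_def
    by (rule the_equality) (use k * in \<open>auto intro!: exI[of _ k]\<close>)
qed

lemma v_prime_pow:
  assumes "H \<in> pts M" "prime_element \<omega> C v H q"
  shows "q [^]\<^bsub>A H\<^esub> (k::int) \<in> carrier (A H)" "v H (q [^]\<^bsub>A H\<^esub> k) = \<omega> [^]\<^bsub>\<Omega>\<^esub> k"
proof -
  interpret AH: comm_group "A H" using C_simps(1)[OF assms(1)] .
  interpret vH: group_hom "A H" \<Omega> "v H" using v_group_hom[OF assms(1)] .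
  show "q [^]\<^bsub>A H\<^esub> (k::int) \<in> carrier (A H)" "v H (q [^]\<^bsub>A H\<^esub> k) = \<omega> [^]\<^bsub>\<Omega>\<^esub> k"
    using assms(2) by (auto simp: prime_element_def vH.hom_int_pow)
qed

lemma upsilon_frobenius_pow:
  assumes "(H, U) \<in> pts E" "prime_element \<omega> C v H q"
  shows "upsilon G \<Omega> \<omega> d C q H U (frobenius G \<Omega> \<omega> d H U [^]\<^bsub>quot_group G H U\<^esub> (k::int)) =
    N H U #>\<^bsub>A H\<^esub> (q [^]\<^bsub>A H\<^esub> k)"
proof -
  note ur = unramified_ext_E[OF assms(1)]
  obtain h where h: "h \<in> H" "d h = \<omega> [^]\<^bsub>\<Omega>\<^esub> (int (f H) * k)"
    using frobenius_pow_lift[OF unramified_extD(1)[OF ur]] .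
  show ?thesis
    using upsilon_eq[OF assms h v_prime_pow[OF pts_M(1)[OF assms(1)] assms(2)]]
      frobenius_pow_eq[OF ur h] by simp
qed

text \<open>\<open>upsilon_eq\<close> accepts any element of valuation \<open>k \<omega>\<close>,
  whichever prime element defines the map; the same power of \<open>q\<close> serves for
  both.\<close>

lemma upsilon_independent:
  assumes "(H, U) \<in> pts E" "prime_element \<omega> C v H q" "prime_element \<omega> C v H q'"
    "x \<in> carrier (quot_group G H U)"
  shows "upsilon G \<Omega> \<omega> d C q' H U x = upsilon G \<Omega> \<omega> d C q H U x"
proof -
  obtain h k where h: "h \<in> H" "d h = \<omega> [^]\<^bsub>\<Omega>\<^esub> (int (f H) * k)" "x = U #>\<^bsub>G\<^esub> h"
    using coset_representative[OF unramified_ext_E[OF assms(1)] assms(4)] .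
  note c = v_prime_pow[OF pts_M(1)[OF assms(1)] assms(2), of k]
  show ?thesis
    using upsilon_eq[OF assms(1,2) h(1,2) c] upsilon_eq[OF assms(1,3) h(1,2) c] h(3) by simp
qed

text \<open>The valuation maps the norm group onto \<open>n im(v_U)\<close> with
  \<open>n = [H:U]\<close>. By condition (a), \<open>\<omega>\<close> generates a quotient of order
  \<open>n\<close> of \<open>im(v_H)\<close> by this group, so \<open>k \<omega>\<close> lies in it
  only if \<open>n\<close> divides \<open>k\<close>.\<close>

lemma prime_pow_mem_norm_imp_dvd:
  assumes "(H, U) \<in> pts E" "prime_element \<omega> C v H q" "q [^]\<^bsub>A H\<^esub> (k::int) \<in> N H U"
  shows "int (sub_index G H U) dvd k"
proof -
  define n where "n = sub_index G H U"
  define N' where "N' = (\<lambda>x. x [^]\<^bsub>\<Omega>\<^esub> n) ` v U ` carrier (A U)"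
  define B where "B = v H ` carrier (A H)"
  interpret AH: comm_group "A H" using comm_group_A[OF assms(1)] .
  interpret vH: group_hom "A H" \<Omega> "v H" using v_group_hom[OF pts_M(1)[OF assms(1)]] .
  have ord: "order (quot_group \<Omega> B N') = n"
    and gen: "generate (quot_group \<Omega> B N') {N' #>\<^bsub>\<Omega>\<^esub> \<omega>} = carrier (quot_group \<Omega> B N')"
    using datumD(1,2)[OF assms(1)] by (simp_all add: n_def N'_def B_def)
  have N': "N' = v H ` N H U"
    using v_structure_maps(2)[OF pts_M(1,2)[OF assms(1)]]
      sub_index_eq_ram_f[OF unramified_ext_E[OF assms(1)]]
    by (force simp: N'_def norm_group_def n_def image_image)
  have B: "subgroup B \<Omega>" unfolding B_def by (rule vH.img_is_subgroup)
  have subN': "subgroup N' \<Omega>"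
    unfolding N' by (rule vH.subgroup_img_is_subgroup[OF norm_subgroup[OF assms(1)]])
  have "N' \<subseteq> B" unfolding N' B_def using subgroup.subset[OF norm_subgroup[OF assms(1)]] by blast
  then have "subgroup N' (\<Omega>\<lparr>carrier := B\<rparr>)" using \<Omega>.subgroup_incl[OF subN' B] by blast
  then interpret nN': normal N' "\<Omega>\<lparr>carrier := B\<rparr>"
    using comm_group.subgroup_imp_normal[OF \<Omega>.subgroup_imp_comm_group[OF B]] by blast
  interpret Q: group "quot_group \<Omega> B N'" by (rule nN'.factorgroup_is_group)
  have \<omega>B: "\<omega> \<in> B" using assms(2) by (auto simp: prime_element_def B_def)
  then have \<omega>Q: "N' #>\<^bsub>\<Omega>\<^esub> \<omega> \<in> carrier (quot_group \<Omega> B N')" by (auto simp: carrier_FactGroup)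
  have "Q.ord (N' #>\<^bsub>\<Omega>\<^esub> \<omega>) = n"
    using Q.generate_pow_card[OF \<omega>Q] gen ord by (simp add: order_def)
  moreover have "(N' #>\<^bsub>\<Omega>\<^esub> \<omega>) [^]\<^bsub>quot_group \<Omega> B N'\<^esub> k = \<one>\<^bsub>quot_group \<Omega> B N'\<^esub>"
  proof -
    have "\<omega> [^]\<^bsub>\<Omega>\<^esub> k \<in> N'"
      using assms(3) v_prime_pow(2)[OF pts_M(1)[OF assms(1)] assms(2), of k] unfolding N' by (metis imageI)
    moreover have "(N' #>\<^bsub>\<Omega>\<^esub> \<omega>) [^]\<^bsub>quot_group \<Omega> B N'\<^esub> k = N' #>\<^bsub>\<Omega>\<^esub> (\<omega> [^]\<^bsub>\<Omega>\<^esub> k)"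
      using nN'.FactGroup_int_pow[of \<omega> k] \<omega>B \<Omega>.int_pow_consistent[OF B \<omega>B] by simp
    ultimately show ?thesis using \<Omega>.coset_join2[OF _ subN'] by simp
  qed
  ultimately show ?thesis using Q.int_pow_eq_id[OF \<omega>Q] by (simp add: n_def)
qed

lemma upsilon_hom:
  assumes "(H, U) \<in> pts E" "prime_element \<omega> C v H q"
  shows "upsilon G \<Omega> \<omega> d C q H U \<in> hom (quot_group G H U) (A H Mod N H U)"
proof (rule homI)
  note ur = unramified_ext_E[OF assms(1)]
  interpret Q: group "quot_group G H U" using group_quot[OF ur] .
  interpret AH: comm_group "A H" using comm_group_A[OF assms(1)] .
  have q: "q \<in> carrier (A H)" using assms(2) by (simp add: prime_element_def)
  note F = frobenius_closed[OF ur]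
  fix x assume "x \<in> carrier (quot_group G H U)"
  then obtain k :: int where k: "x = frobenius G \<Omega> \<omega> d H U [^]\<^bsub>quot_group G H U\<^esub> k"
    unfolding carrier_quot_eq_frobenius_powers[OF ur] by blast
  show "upsilon G \<Omega> \<omega> d C q H U x \<in> carrier (A H Mod N H U)"
    unfolding k upsilon_frobenius_pow[OF assms] using q by (simp add: carrier_H0)
  fix y assume "y \<in> carrier (quot_group G H U)"
  then obtain l :: int where l: "y = frobenius G \<Omega> \<omega> d H U [^]\<^bsub>quot_group G H U\<^esub> l"
    unfolding carrier_quot_eq_frobenius_powers[OF ur] by blast
  have xy: "x \<otimes>\<^bsub>quot_group G H U\<^esub> y = frobenius G \<Omega> \<omega> d H U [^]\<^bsub>quot_group G H U\<^esub> (k + l)"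
    unfolding k l using Q.int_pow_mult[OF F] by simp
  show "upsilon G \<Omega> \<omega> d C q H U (x \<otimes>\<^bsub>quot_group G H U\<^esub> y) =
    upsilon G \<Omega> \<omega> d C q H U x \<otimes>\<^bsub>A H Mod N H U\<^esub> upsilon G \<Omega> \<omega> d C q H U y"
    unfolding xy unfolding k l upsilon_frobenius_pow[OF assms]
    using q by (simp add: normal.rcos_sum[OF norm_normal[OF assms(1)]] AH.int_pow_mult)
qed

lemma upsilon_iso:
  assumes "(H, U) \<in> pts E" "prime_element \<omega> C v H q"
  shows "upsilon G \<Omega> \<omega> d C q H U \<in> iso (quot_group G H U) (A H Mod N H U)"
proof -
  note ur = unramified_ext_E[OF assms(1)]
  interpret Q: group "quot_group G H U" using group_quot[OF ur] .
  interpret AH: comm_group "A H" using comm_group_A[OF assms(1)] .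
  interpret A0: group "A H Mod N H U" using normal.factorgroup_is_group[OF norm_normal[OF assms(1)]] .
  interpret Y: group_hom "quot_group G H U" "A H Mod N H U" "upsilon G \<Omega> \<omega> d C q H U"
    using upsilon_hom[OF assms] by unfold_locales
  have q: "q \<in> carrier (A H)" using assms(2) by (simp add: prime_element_def)
  have inj: "inj_on (upsilon G \<Omega> \<omega> d C q H U) (carrier (quot_group G H U))"
  proof (subst Y.inj_on_one_iff, intro allI impI)
    fix x assume x: "x \<in> carrier (quot_group G H U)"
      and y: "upsilon G \<Omega> \<omega> d C q H U x = \<one>\<^bsub>A H Mod N H U\<^esub>"
    obtain k :: int where k: "x = frobenius G \<Omega> \<omega> d H U [^]\<^bsub>quot_group G H U\<^esub> k"
      using x unfolding carrier_quot_eq_frobenius_powers[OF ur] by blast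
    have "N H U #>\<^bsub>A H\<^esub> (q [^]\<^bsub>A H\<^esub> k) = N H U"
      using y unfolding k upsilon_frobenius_pow[OF assms] by simp
    then have "q [^]\<^bsub>A H\<^esub> k \<in> N H U"
      using AH.rcos_self[OF _ norm_subgroup[OF assms(1)], of "q [^]\<^bsub>A H\<^esub> k"] q by simp
    then show "x = \<one>\<^bsub>quot_group G H U\<^esub>"
      unfolding k frobenius_pow_eq_one_iff[OF ur] by (rule prime_pow_mem_norm_imp_dvd[OF assms])
  qed
  \<comment> \<open>The injective image has \<open>[H:U]\<close> elements, and condition (c) bounds
    the finite target by the same number.\<close>
  have "upsilon G \<Omega> \<omega> d C q H U ` carrier (quot_group G H U) = carrier (A H Mod N H U)"
    using Y.hom_closed card_image[OF inj] order_quot[of H U] datumD(4,5)[OF assms(1)]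
    by (intro card_seteq) (auto simp: order_def)
  then show ?thesis using inj upsilon_hom[OF assms] by (simp add: iso_def bij_betw_def)
qed

section \<open>Norm groups under the structure maps and the functor of norm residues\<close>

lemma mackey_formula:
  assumes "H \<in> pts M" "I \<in> res_dom M H" "J \<in> ind_dom M H" "dcoset_reps G I H J R"
    "a \<in> carrier (A J)"
  shows "res_map C I H (ind_map C H J a) =
    finprod (A I) (\<lambda>h. let K = conj_set G (inv\<^bsub>G\<^esub> h) I \<inter> J
      in ind_map C I (I \<inter> conj_set G h J) (con_map C h K (res_map C K J a))) R"
  using datum assms by (simp add: unramified_FN_datum_def mackey_functor_def)

text \<open>In a spectrum \<open>V = U\<close>, so \<open>U\<close> lies in \<open>I\<close>, and
  \<open>U\<close> is normal in \<open>H\<close>. Hence for each \<open>h\<close> in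
  \<open>H\<close> both intersections in the Mackey formula collapse to \<open>U\<close>: every
  factor is \<open>ind_{I,U}\<close> of a conjugate of \<open>b\<close>, and their product is again
  a norm.\<close>

lemma res_norm:
  assumes "(H, U) \<in> pts E" "(I, V) \<in> res_dom E (H, U)"
  shows "res_map C I H ` N H U \<subseteq> N I V"
proof clarify
  note VU = res_E[OF assms]
  have I: "(I, U) \<in> pts E" using dom_E(1)[OF assms] VU by simp
  note UH = unramified_extD[OF unramified_ext_E[OF assms(1)]]
    and UI = unramified_extD[OF unramified_ext_E[OF I]]
  interpret AI: comm_group "A I" using comm_group_A[OF I] .
  interpret H: subgroup H G by fact
  fix x assume "x \<in> N H U"
  then obtain b where b: "b \<in> carrier (A U)" "x = ind_map C H U b" by (auto simp: norm_group_def)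
  obtain R where R: "dcoset_reps G I H U R" using dcoset_reps_exists by blast
  define t where "t h = (let K = conj_set G (inv\<^bsub>G\<^esub> h) I \<inter> U
    in ind_map C I (I \<inter> conj_set G h U) (con_map C h K (res_map C K U b)))" for h
  have "res_map C I H x = finprod (A I) t R"
    unfolding t_def b(2) by (rule mackey_formula[OF pts_M(1)[OF assms(1)] VU(2) pts_M(2)[OF assms(1)] R b(1)])
  moreover have "t h \<in> N I U" if "h \<in> R" for h
  proof -
    have h: "h \<in> H" "h \<in> carrier G" using that R H.subset by (auto simp: dcoset_reps_def)
    have conj: "h \<otimes>\<^bsub>G\<^esub> u \<otimes>\<^bsub>G\<^esub> inv\<^bsub>G\<^esub> h \<in> U" "inv\<^bsub>G\<^esub> h \<otimes>\<^bsub>G\<^esub> u \<otimes>\<^bsub>G\<^esub> h \<in> U" if "u \<in> U" for u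
      using normal.inv_op_closed1[OF UH(3), of h u] normal.inv_op_closed2[OF UH(3), of h u]
        h(1) that UH(5) by simp_all
    have inv_conj: "g \<otimes>\<^bsub>G\<^esub> (inv\<^bsub>G\<^esub> g \<otimes>\<^bsub>G\<^esub> u \<otimes>\<^bsub>G\<^esub> g) \<otimes>\<^bsub>G\<^esub> inv\<^bsub>G\<^esub> g = u"
      if "u \<in> carrier G" "g \<in> carrier G" for u g
    proof -
      have "g \<otimes>\<^bsub>G\<^esub> (inv\<^bsub>G\<^esub> g \<otimes>\<^bsub>G\<^esub> u \<otimes>\<^bsub>G\<^esub> g) \<otimes>\<^bsub>G\<^esub> inv\<^bsub>G\<^esub> g =
        (g \<otimes>\<^bsub>G\<^esub> inv\<^bsub>G\<^esub> g) \<otimes>\<^bsub>G\<^esub> u \<otimes>\<^bsub>G\<^esub> (g \<otimes>\<^bsub>G\<^esub> inv\<^bsub>G\<^esub> g)"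
        using that by (simp only: G.m_assoc G.m_closed G.inv_closed)
      then show ?thesis using that by simp
    qed
    have Usub: "U \<subseteq> carrier G" using UH(6) by (rule subgroup.subset)
    have cU: "conj_set G h U = U"
    proof (intro equalityI subsetI)
      fix u assume u: "u \<in> U"
      then have "u = h \<otimes>\<^bsub>G\<^esub> (inv\<^bsub>G\<^esub> h \<otimes>\<^bsub>G\<^esub> u \<otimes>\<^bsub>G\<^esub> h) \<otimes>\<^bsub>G\<^esub> inv\<^bsub>G\<^esub> h"
        using inv_conj[of u h] h Usub by auto
      then show "u \<in> conj_set G h U" unfolding conj_set_eq_image using conj(2)[OF u] by (rule image_eqI)
    qed (auto simp: conj_set_eq_image conj)
    have "U \<subseteq> conj_set G (inv\<^bsub>G\<^esub> h) I"
    proof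
      fix u assume u: "u \<in> U"
      then have "u = inv\<^bsub>G\<^esub> h \<otimes>\<^bsub>G\<^esub> (h \<otimes>\<^bsub>G\<^esub> u \<otimes>\<^bsub>G\<^esub> inv\<^bsub>G\<^esub> h) \<otimes>\<^bsub>G\<^esub> inv\<^bsub>G\<^esub> (inv\<^bsub>G\<^esub> h)"
        using inv_conj[of u "inv\<^bsub>G\<^esub> h"] h Usub by auto
      then show "u \<in> conj_set G (inv\<^bsub>G\<^esub> h) I"
        unfolding conj_set_eq_image using subsetD[OF UI(7) conj(1)[OF u]] by (rule image_eqI)
    qed
    then have K: "conj_set G (inv\<^bsub>G\<^esub> h) I \<inter> U = U" "I \<inter> conj_set G h U = U"
      using UI(7) cU by auto
    have "con_map C h U b \<in> carrier (A U)"
      using C_closed(3)[OF pts_M(3)[OF assms(1)] h(2) b(1)] cU by simp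
    then show ?thesis
      using C_simps(5)[OF pts_M(3)[OF assms(1)] b(1)] by (simp add: t_def K norm_group_def)
  qed
  ultimately have "res_map C I H x \<in> N I U"
    using AI.finprod_mem_subgroup[OF norm_subgroup[OF I], of t R] by (simp add: Pi_def)
  then show "res_map C I H x \<in> N I V" using VU by simp
qed

text \<open>Induction from \<open>V\<close> to \<open>H\<close> factors through \<open>I\<close> and
  through \<open>U\<close>. The second factorisation is where the Mackey cover's condition that
  \<open>V\<close> lies in \<open>ind_dom M U\<close> enters.\<close>

lemma ind_norm:
  assumes "(H, U) \<in> pts E" "(I, V) \<in> ind_dom E (H, U)"
  shows "ind_map C H I ` N I V \<subseteq> N H U"
proof clarify
  note IV = ind_E[OF assms]
  have I: "(I, V) \<in> pts E" using dom_E(2)[OF assms] .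
  note H = pts_M[OF assms(1)] and IM = pts_M[OF I]
  fix x assume "x \<in> N I V"
  then obtain b where b: "b \<in> carrier (A V)" "x = ind_map C I V b" by (auto simp: norm_group_def)
  have "ind_map C H I x = ind_map C H V b"
    unfolding b(2) by (rule C_simps(9)[OF H(1) IV(2) IM(2) b(1)])
  also have "\<dots> = ind_map C H U (ind_map C U V b)"
    by (rule C_simps(9)[OF H(1,2) IV(4) b(1), symmetric])
  finally show "ind_map C H I x \<in> N H U"
    using C_closed(2)[OF H(3) IV(4) b(1)] by (simp add: norm_group_def)
qed

lemma con_norm:
  assumes "(H, U) \<in> pts E" "g \<in> carrier G"
  shows "con_map C g H ` N H U \<subseteq> N (conj_set G g H) (conj_set G g U)"
proof clarify
  note H = pts_M[OF assms(1)]
  fix x assume "x \<in> N H U"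
  then obtain b where b: "b \<in> carrier (A U)" "x = ind_map C H U b" by (auto simp: norm_group_def)
  show "con_map C g H x \<in> N (conj_set G g H) (conj_set G g U)"
    using C_simps(12)[OF H(1,2) assms(2) b(1)] C_closed(3)[OF H(3) assms(2) b(1)]
    by (simp add: b(2) norm_group_def)
qed

lemma H0_res:
  assumes "(H, U) \<in> pts E" "(I, V) \<in> res_dom E (H, U)" "a \<in> carrier (A H)"
  shows "res_map (H0_functor G C) (I, V) (H, U) (N H U #>\<^bsub>A H\<^esub> a) = N I V #>\<^bsub>A I\<^esub> res_map C I H a"
proof -
  have I: "(I, V) \<in> pts E" using dom_E(1)[OF assms(1,2)] .
  show ?thesis
    using quot_map_rcos[OF _ _ norm_subgroup[OF assms(1)] norm_subgroup[OF I]
        C_simps(2)[OF pts_M(1)[OF assms(1)] res_E(2)[OF assms(1,2)]] res_norm[OF assms(1,2)] assms(3)]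
      comm_group_A[OF I] comm_group_A[OF assms(1)]
    by (simp add: H0_functor_def comm_group_def)
qed

lemma H0_ind:
  assumes "(H, U) \<in> pts E" "(I, V) \<in> ind_dom E (H, U)" "a \<in> carrier (A I)"
  shows "ind_map (H0_functor G C) (H, U) (I, V) (N I V #>\<^bsub>A I\<^esub> a) = N H U #>\<^bsub>A H\<^esub> ind_map C H I a"
proof -
  have I: "(I, V) \<in> pts E" using dom_E(2)[OF assms(1,2)] .
  show ?thesis
    using quot_map_rcos[OF _ _ norm_subgroup[OF I] norm_subgroup[OF assms(1)]
        C_simps(3)[OF pts_M(1)[OF assms(1)] ind_E(2)[OF assms(1,2)]] ind_norm[OF assms(1,2)] assms(3)]
      comm_group_A[OF I] comm_group_A[OF assms(1)]
    by (simp add: H0_functor_def comm_group_def)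
qed

lemma H0_con:
  assumes "(H, U) \<in> pts E" "g \<in> carrier G" "a \<in> carrier (A H)"
  shows "con_map (H0_functor G C) g (H, U) (N H U #>\<^bsub>A H\<^esub> a) =
    N (conj_set G g H) (conj_set G g U) #>\<^bsub>A (conj_set G g H)\<^esub> con_map C g H a"
  using quot_map_rcos[OF _ _ norm_subgroup[OF assms(1)] norm_subgroup[OF act_E[OF assms(1,2)]]
      C_simps(4)[OF pts_M(1)[OF assms(1)] assms(2)] con_norm[OF assms(1,2)] assms(3)]
    comm_group_A[OF act_E[OF assms(1,2)]] comm_group_A[OF assms(1)]
  by (simp add: H0_functor_def comm_group_def)

lemma H0_obj: "obj_grp (H0_functor G C) (H, U) = A H Mod N H U"
  by (simp add: H0_functor_def)

lemma H0_homI: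
  assumes "(H, U) \<in> pts E" "(I, V) \<in> pts E" "h \<in> hom (A H) (A I)"
    and "\<And>a. a \<in> carrier (A H) \<Longrightarrow> F (N H U #>\<^bsub>A H\<^esub> a) = N I V #>\<^bsub>A I\<^esub> h a"
  shows "F \<in> hom (A H Mod N H U) (A I Mod N I V)"
proof (rule homI)
  interpret AH: comm_group "A H" using comm_group_A[OF assms(1)] .
  have hc: "h a \<in> carrier (A I)" if "a \<in> carrier (A H)" for a using hom_mem[OF assms(3) that] .
  fix x assume "x \<in> carrier (A H Mod N H U)"
  then obtain a where a: "a \<in> carrier (A H)" "x = N H U #>\<^bsub>A H\<^esub> a" by (auto simp: carrier_H0)
  then show "F x \<in> carrier (A I Mod N I V)" using assms(4) hc by (auto simp: carrier_H0)
  fix y assume "y \<in> carrier (A H Mod N H U)"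
  then obtain b where b: "b \<in> carrier (A H)" "y = N H U #>\<^bsub>A H\<^esub> b" by (auto simp: carrier_H0)
  have "x \<otimes>\<^bsub>A H Mod N H U\<^esub> y = N H U #>\<^bsub>A H\<^esub> (a \<otimes>\<^bsub>A H\<^esub> b)"
    using a b normal.rcos_sum[OF norm_normal[OF assms(1)]] by simp
  then have "F (x \<otimes>\<^bsub>A H Mod N H U\<^esub> y) = N I V #>\<^bsub>A I\<^esub> (h a \<otimes>\<^bsub>A I\<^esub> h b)"
    using a b assms(4) hom_mult[OF assms(3)] by simp
  also have "\<dots> = F x \<otimes>\<^bsub>A I Mod N I V\<^esub> F y"
    using a b assms(4) hc normal.rcos_sum[OF norm_normal[OF assms(2)]] by simp
  finally show "F (x \<otimes>\<^bsub>A H Mod N H U\<^esub> y) = F x \<otimes>\<^bsub>A I Mod N I V\<^esub> F y" .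
qed

lemma comm_group_H0:
  assumes "(H, U) \<in> pts E"
  shows "comm_group (A H Mod N H U)"
  using comm_group.abelian_FactGroup[OF comm_group_A[OF assms] norm_subgroup[OF assms]] .

text \<open>On cosets the structure maps act through representatives by those of \<open>C\<close>
  (\<open>H0_res\<close>, \<open>H0_ind\<close>, \<open>H0_con\<close>), so each law reduces to the
  law of \<open>C\<close> on first components. It applies there because \<open>flat E\<close> is a
  subsystem of \<open>M\<close>.\<close>

lemma ric_H0: "is_ric_functor G (conj_pair G) E (H0_functor G C)"
  unfolding is_ric_functor_def
proof (intro conjI ballI)
  fix x assume x: "x \<in> pts E"
  obtain H U where xe: "x = (H, U)" by (cases x)
  have HU: "(H, U) \<in> pts E" using x xe by simp
  note HM = pts_M[OF HU]
  show "comm_group (obj_grp (H0_functor G C) x)"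
    using comm_group_H0[OF HU] by (simp add: xe H0_obj)
  { fix y assume y: "y \<in> res_dom E x"
    obtain I V where ye: "y = (I, V)" by (cases y)
    have IV: "(I, V) \<in> res_dom E (H, U)" using y xe ye by simp
    show "res_map (H0_functor G C) y x \<in> hom (obj_grp (H0_functor G C) x) (obj_grp (H0_functor G C) y)"
      unfolding xe ye H0_obj
      by (rule H0_homI[OF HU dom_E(1)[OF HU IV] C_simps(2)[OF HM(1) res_E(2)[OF HU IV]] H0_res[OF HU IV]])
    fix g b assume g: "g \<in> carrier G" and "b \<in> carrier (obj_grp (H0_functor G C) x)"
    then obtain a where a: "a \<in> carrier (A H)" "b = N H U #>\<^bsub>A H\<^esub> a"
      by (auto simp: xe H0_obj carrier_H0)
    have gIV: "(conj_set G g I, conj_set G g V) \<in> res_dom E (conj_set G g H, conj_set G g U)"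
      using dom_E(7)[OF HU IV g] by simp
    show "con_map (H0_functor G C) g y (res_map (H0_functor G C) y x b) =
      res_map (H0_functor G C) (conj_pair G g y) (conj_pair G g x) (con_map (H0_functor G C) g x b)"
      using H0_res[OF HU IV a(1)] H0_con[OF HU g a(1)]
        H0_con[OF dom_E(1)[OF HU IV] g C_closed(1)[OF HM(1) res_E(2)[OF HU IV] a(1)]]
        H0_res[OF act_E[OF HU g] gIV C_closed(3)[OF HM(1) g a(1)]]
        C_simps(11)[OF HM(1) res_E(2)[OF HU IV] g a(1)]
      by (simp add: xe ye a(2)) }
  { fix y assume y: "y \<in> ind_dom E x"
    obtain I V where ye: "y = (I, V)" by (cases y)
    have IV: "(I, V) \<in> ind_dom E (H, U)" using y xe ye by simp
    show "ind_map (H0_functor G C) x y \<in> hom (obj_grp (H0_functor G C) y) (obj_grp (H0_functor G C) x)"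
      unfolding xe ye H0_obj
      by (rule H0_homI[OF dom_E(2)[OF HU IV] HU C_simps(3)[OF HM(1) ind_E(2)[OF HU IV]] H0_ind[OF HU IV]])
    fix g b assume g: "g \<in> carrier G" and "b \<in> carrier (obj_grp (H0_functor G C) y)"
    then obtain a where a: "a \<in> carrier (A I)" "b = N I V #>\<^bsub>A I\<^esub> a"
      by (auto simp: ye H0_obj carrier_H0)
    have gIV: "(conj_set G g I, conj_set G g V) \<in> ind_dom E (conj_set G g H, conj_set G g U)"
      using dom_E(8)[OF HU IV g] by simp
    note IP = dom_E(2)[OF HU IV]
    show "con_map (H0_functor G C) g x (ind_map (H0_functor G C) x y b) =
      ind_map (H0_functor G C) (conj_pair G g x) (conj_pair G g y) (con_map (H0_functor G C) g y b)"
      using H0_ind[OF HU IV a(1)] H0_con[OF IP g a(1)]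
        H0_con[OF HU g C_closed(2)[OF HM(1) ind_E(2)[OF HU IV] a(1)]]
        H0_ind[OF act_E[OF HU g] gIV C_closed(3)[OF pts_M(1)[OF IP] g a(1)]]
        C_simps(12)[OF HM(1) ind_E(2)[OF HU IV] g a(1)]
      by (simp add: xe ye a(2)) }
  { fix g assume g: "g \<in> carrier G"
    show "con_map (H0_functor G C) g x \<in>
      hom (obj_grp (H0_functor G C) x) (obj_grp (H0_functor G C) (conj_pair G g x))"
      unfolding xe conj_pair_simp H0_obj
      by (rule H0_homI[OF HU act_E[OF HU g] C_simps(4)[OF HM(1) g] H0_con[OF HU g]])
    fix g' b assume g': "g' \<in> carrier G" and "b \<in> carrier (obj_grp (H0_functor G C) x)"
    then obtain a where a: "a \<in> carrier (A H)" "b = N H U #>\<^bsub>A H\<^esub> a"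
      by (auto simp: xe H0_obj carrier_H0)
    have gg: "g' \<otimes>\<^bsub>G\<^esub> g \<in> carrier G" using g g' by simp
    have "conj_pair G g' (conj_pair G g x) = conj_pair G (g' \<otimes>\<^bsub>G\<^esub> g) x"
      by (rule ric_domain_act_mult[OF ric_E x g g'])
    then show "con_map (H0_functor G C) g' (conj_pair G g x) (con_map (H0_functor G C) g x b) =
      con_map (H0_functor G C) (g' \<otimes>\<^bsub>G\<^esub> g) x b"
      using H0_con[OF HU g a(1)] H0_con[OF HU gg a(1)]
        H0_con[OF act_E[OF HU g] g' C_closed(3)[OF HM(1) g a(1)]]
        C_simps(10)[OF HM(1) g g' a(1)]
      by (simp add: xe a(2)) }
  { fix b assume "b \<in> carrier (obj_grp (H0_functor G C) x)"
    then obtain a where a: "a \<in> carrier (A H)" "b = N H U #>\<^bsub>A H\<^esub> a"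
      by (auto simp: xe H0_obj carrier_H0)
    show "res_map (H0_functor G C) x x b = b"
      using H0_res[OF HU dom_E(3)[OF HU] a(1)] C_simps(5)[OF HM(1) a(1)] by (simp add: xe a(2))
    show "ind_map (H0_functor G C) x x b = b"
      using H0_ind[OF HU dom_E(4)[OF HU] a(1)] C_simps(6)[OF HM(1) a(1)] by (simp add: xe a(2))
    have "conj_pair G \<one>\<^bsub>G\<^esub> x = x" by (rule ric_domain_act_one[OF ric_E x])
    then show "con_map (H0_functor G C) \<one>\<^bsub>G\<^esub> x b = b"
      using H0_con[OF HU G.one_closed a(1)] C_simps(7)[OF HM(1) a(1)] by (simp add: xe a(2)) }
  { fix y z b assume y: "y \<in> res_dom E x" and z: "z \<in> res_dom E y"
      and "b \<in> carrier (obj_grp (H0_functor G C) x)"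
    then obtain a where a: "a \<in> carrier (A H)" "b = N H U #>\<^bsub>A H\<^esub> a"
      by (auto simp: xe H0_obj carrier_H0)
    obtain I V J W where e: "y = (I, V)" "z = (J, W)" by (cases y, cases z)
    have IV: "(I, V) \<in> res_dom E (H, U)" and JW: "(J, W) \<in> res_dom E (I, V)"
      using y z xe e by simp_all
    note IP = dom_E(1)[OF HU IV]
    show "res_map (H0_functor G C) z y (res_map (H0_functor G C) y x b) = res_map (H0_functor G C) z x b"
      using H0_res[OF HU IV a(1)] H0_res[OF HU dom_E(5)[OF HU IV JW] a(1)]
        H0_res[OF IP JW C_closed(1)[OF HM(1) res_E(2)[OF HU IV] a(1)]]
        C_simps(8)[OF HM(1) res_E(2)[OF HU IV] res_E(2)[OF IP JW] a(1)]
      by (simp add: xe e a(2)) }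
  { fix y z b assume y: "y \<in> ind_dom E x" and z: "z \<in> ind_dom E y"
      and b: "b \<in> carrier (obj_grp (H0_functor G C) z)"
    obtain I V J W where e: "y = (I, V)" "z = (J, W)" by (cases y, cases z)
    have IV: "(I, V) \<in> ind_dom E (H, U)" and JW: "(J, W) \<in> ind_dom E (I, V)"
      using y z xe e by simp_all
    obtain a where a: "a \<in> carrier (A J)" "b = N J W #>\<^bsub>A J\<^esub> a"
      using b by (auto simp: e H0_obj carrier_H0)
    note IP = dom_E(2)[OF HU IV]
    show "ind_map (H0_functor G C) x y (ind_map (H0_functor G C) y z b) = ind_map (H0_functor G C) x z b"
      using H0_ind[OF IP JW a(1)] H0_ind[OF HU dom_E(6)[OF HU IV JW] a(1)]
        H0_ind[OF HU IV C_closed(2)[OF pts_M(1)[OF IP] ind_E(2)[OF IP JW] a(1)]]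
        C_simps(9)[OF HM(1) ind_E(2)[OF HU IV] ind_E(2)[OF IP JW] a(1)]
      by (simp add: xe e a(2)) }
qed

section \<open>Naturality of the reciprocity map\<close>

lemma ram_e_unramified:
  assumes "unramified_ext H U" "subgroup I G" "I \<subseteq> H" "U \<subseteq> I"
  shows "ram_e G \<Omega> d H I = 1"
proof -
  \<comment> \<open>As \<open>U\<close> contains the inertia group of \<open>H\<close>, every group
    between \<open>U\<close> and \<open>H\<close> has that same inertia group. Restriction therefore
    preserves valuations.\<close>
  have "inertia G \<Omega> d I = inertia G \<Omega> d H"
    using assms(3,4) unramified_extD(4)[OF assms(1)] by (auto simp: inertia_def)
  moreover have "subgroup (inertia G \<Omega> d H) G"
    unfolding inertia_def using unramified_extD(5)[OF assms(1)] d.subgroup_kernel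
    by (rule G.subgroups_Inter_pair)
  ultimately show ?thesis using sub_index_self[OF group_G] by (simp add: ram_e_def)
qed

lemma pi_obj: "obj_grp (pi_functor G) (H, U) = quot_group G H U"
  by (simp add: pi_functor_def)

text \<open>Both sides keep the exponent \<open>k\<close>: the transfer takes degree
  \<open>f_H k \<omega>\<close> to \<open>f_I k \<omega>\<close>, and restriction keeps the
  valuation \<open>k \<omega>\<close> because \<open>e_{H|I} = 1\<close>. The restriction of
  \<open>p ^ k\<close> need not be a power of \<open>q\<close>; only its valuation counts.\<close>

lemma upsilon_res:
  assumes HU: "(H, U) \<in> pts E" and IV: "(I, V) \<in> res_dom E (H, U)"
    and p: "prime_element \<omega> C v H p" and q: "prime_element \<omega> C v I q"
    and x: "x \<in> carrier (quot_group G H U)"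
  shows "res_map (pi_functor G) (I, V) (H, U) x \<in> carrier (quot_group G I V) \<and>
    upsilon G \<Omega> \<omega> d C q I V (res_map (pi_functor G) (I, V) (H, U) x) =
      res_map (H0_functor G C) (I, V) (H, U) (upsilon G \<Omega> \<omega> d C p H U x)"
proof -
  note r = res_E[OF HU IV]
  have I: "(I, U) \<in> pts E" using dom_E(1)[OF HU IV] r(1) by simp
  note urH = unramified_ext_E[OF HU] and urI = unramified_ext_E[OF I]
  obtain h k where h: "h \<in> H" "d h = \<omega> [^]\<^bsub>\<Omega>\<^esub> (int (f H) * k)" "x = U #>\<^bsub>G\<^esub> h"
    using coset_representative[OF urH x] .
  obtain h' where h': "h' \<in> I" "d h' = \<omega> [^]\<^bsub>\<Omega>\<^esub> (int (f I) * k)"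
    "transfer_map (quot_group G H U) (carrier (quot_group G I U)) (U #>\<^bsub>G\<^esub> h) = U #>\<^bsub>G\<^esub> h'"
    using transfer_quot[OF urH urI r(3) h(1,2)] .
  have rx: "res_map (pi_functor G) (I, V) (H, U) x = U #>\<^bsub>G\<^esub> h'"
    by (simp add: pi_functor_def h(3) h'(3) r(1))
  note c = v_prime_pow[OF pts_M(1)[OF HU] p, of k]
  have "v I (res_map C I H (p [^]\<^bsub>A H\<^esub> k)) = \<omega> [^]\<^bsub>\<Omega>\<^esub> k"
    using v_structure_maps(1)[OF pts_M(1)[OF HU] r(2) c(1)] c(2)
      ram_e_unramified[OF urH unramified_extD(5)[OF urI] r(3) unramified_extD(7)[OF urI]] by simp
  then have "upsilon G \<Omega> \<omega> d C q I U (U #>\<^bsub>G\<^esub> h') = N I U #>\<^bsub>A I\<^esub> res_map C I H (p [^]\<^bsub>A H\<^esub> k)"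
    by (rule upsilon_eq[OF I q h'(1,2) C_closed(1)[OF pts_M(1)[OF HU] r(2) c(1)]])
  then show ?thesis
    unfolding rx
    using H0_res[OF HU IV c(1)] upsilon_eq[OF HU p h(1,2) c] h'(1)
    by (simp add: r(1) h(3) carrier_quot)
qed

text \<open>The lift \<open>h\<close> stays the same and only its exponent is rewritten, since
  \<open>f_I k = f_H (f_{H|I} k)\<close>. Induction in \<open>C\<close> multiplies the valuation
  \<open>k \<omega>\<close> by the same factor \<open>f_{H|I}\<close>.\<close>

lemma upsilon_ind:
  assumes HU: "(H, U) \<in> pts E" and IV: "(I, V) \<in> ind_dom E (H, U)"
    and p: "prime_element \<omega> C v H p" and q: "prime_element \<omega> C v I q"
    and x: "x \<in> carrier (quot_group G I V)"
  shows "ind_map (pi_functor G) (H, U) (I, V) x \<in> carrier (quot_group G H U) \<and>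
    upsilon G \<Omega> \<omega> d C p H U (ind_map (pi_functor G) (H, U) (I, V) x) =
      ind_map (H0_functor G C) (H, U) (I, V) (upsilon G \<Omega> \<omega> d C q I V x)"
proof -
  note i = ind_E[OF HU IV] and I = dom_E(2)[OF HU IV]
  note urH = unramified_ext_E[OF HU] and urI = unramified_ext_E[OF I]
  note UH = unramified_extD[OF urH] and UI = unramified_extD[OF urI]
  obtain h k where h: "h \<in> I" "d h = \<omega> [^]\<^bsub>\<Omega>\<^esub> (int (f I) * k)" "x = V #>\<^bsub>G\<^esub> h"
    using coset_representative[OF urI x] .
  have hH: "h \<in> H" "h \<in> carrier G" using h(1) i(3) subgroup.mem_carrier[OF UI(5)] by auto
  have ix: "ind_map (pi_functor G) (H, U) (I, V) x = U #>\<^bsub>G\<^esub> h"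
    using quot_map_rcos[OF group_G group_G UI(6) UH(6), of "\<lambda>x. x" h] i(1) hH(2)
    by (simp add: pi_functor_def h(3) hom_def Pi_def)
  define m where "m = ram_f \<Omega> d H I"
  have dh: "d h = \<omega> [^]\<^bsub>\<Omega>\<^esub> (int (f H) * (int m * k))"
    using h(2) abs_f_mult[OF UH(1) UI(1) i(3)] by (simp add: m_def mult_ac)
  note c = v_prime_pow[OF pts_M(1)[OF I] q, of k]
  have "v H (ind_map C H I (q [^]\<^bsub>A I\<^esub> k)) = (\<omega> [^]\<^bsub>\<Omega>\<^esub> k) [^]\<^bsub>\<Omega>\<^esub> int m"
    using v_structure_maps(2)[OF pts_M(1)[OF HU] i(2) c(1)] c(2) by (simp add: m_def int_pow_int)
  then have "v H (ind_map C H I (q [^]\<^bsub>A I\<^esub> k)) = \<omega> [^]\<^bsub>\<Omega>\<^esub> (int m * k)"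
    by (simp add: \<Omega>.int_pow_pow mult.commute)
  then have "upsilon G \<Omega> \<omega> d C p H U (U #>\<^bsub>G\<^esub> h) = N H U #>\<^bsub>A H\<^esub> ind_map C H I (q [^]\<^bsub>A I\<^esub> k)"
    by (rule upsilon_eq[OF HU p hH(1) dh C_closed(2)[OF pts_M(1)[OF HU] i(2) c(1)]])
  then show ?thesis
    unfolding ix
    using H0_ind[OF HU IV c(1)] upsilon_eq[OF I q h(1,2) c] hH(1)
    by (simp add: h(3) carrier_quot)
qed

lemma d_conj_set:
  assumes "H \<subseteq> carrier G" "g \<in> carrier G"
  shows "d ` conj_set G g H = d ` H"
proof -
  have "d (g \<otimes>\<^bsub>G\<^esub> h \<otimes>\<^bsub>G\<^esub> inv\<^bsub>G\<^esub> g) = d h" if "h \<in> H" for h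
    using that assms by (simp add: subset_iff \<Omega>.m_comm[of "d g"] \<Omega>.m_assoc)
  then show ?thesis by (simp add: conj_set_eq_image image_image)
qed

lemma conj_set_rcos:
  assumes "U \<subseteq> carrier G" "h \<in> carrier G" "g \<in> carrier G"
  shows "conj_set G g (U #>\<^bsub>G\<^esub> h) = conj_set G g U #>\<^bsub>G\<^esub> (g \<otimes>\<^bsub>G\<^esub> h \<otimes>\<^bsub>G\<^esub> inv\<^bsub>G\<^esub> g)"
proof -
  have "g \<otimes>\<^bsub>G\<^esub> (u \<otimes>\<^bsub>G\<^esub> h) \<otimes>\<^bsub>G\<^esub> inv\<^bsub>G\<^esub> g =
      (g \<otimes>\<^bsub>G\<^esub> u \<otimes>\<^bsub>G\<^esub> inv\<^bsub>G\<^esub> g) \<otimes>\<^bsub>G\<^esub> (g \<otimes>\<^bsub>G\<^esub> h \<otimes>\<^bsub>G\<^esub> inv\<^bsub>G\<^esub> g)" if "u \<in> U" for u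
  proof -
    have u: "u \<in> carrier G" using that assms(1) by blast
    have "inv\<^bsub>G\<^esub> g \<otimes>\<^bsub>G\<^esub> (g \<otimes>\<^bsub>G\<^esub> (h \<otimes>\<^bsub>G\<^esub> inv\<^bsub>G\<^esub> g)) = h \<otimes>\<^bsub>G\<^esub> inv\<^bsub>G\<^esub> g"
      using assms by (simp add: G.m_assoc[symmetric])
    then show ?thesis using u assms by (simp add: G.m_assoc)
  qed
  then show ?thesis by (force simp: conj_set_eq_image r_coset_def image_iff)
qed

text \<open>Because \<Omega> is abelian, conjugation changes neither the degree of \<open>h\<close>
  nor \<open>d(H)\<close>, hence not \<open>f H\<close> either. The conjugation maps of
  \<open>C\<close> preserve valuations, so the exponent \<open>k\<close> is the same
  throughout.\<close>

lemma upsilon_con: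
  assumes HU: "(H, U) \<in> pts E" and g: "g \<in> carrier G"
    and p: "prime_element \<omega> C v H p" and q: "prime_element \<omega> C v (conj_set G g H) q"
    and x: "x \<in> carrier (quot_group G H U)"
  shows "con_map (pi_functor G) g (H, U) x
      \<in> carrier (quot_group G (conj_set G g H) (conj_set G g U)) \<and>
    upsilon G \<Omega> \<omega> d C q (conj_set G g H) (conj_set G g U) (con_map (pi_functor G) g (H, U) x) =
      con_map (H0_functor G C) g (H, U) (upsilon G \<Omega> \<omega> d C p H U x)"
proof -
  note urH = unramified_ext_E[OF HU]
  note UH = unramified_extD[OF urH]
  obtain h k where h: "h \<in> H" "d h = \<omega> [^]\<^bsub>\<Omega>\<^esub> (int (f H) * k)" "x = U #>\<^bsub>G\<^esub> h"
    using coset_representative[OF urH x] .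
  have hG: "h \<in> carrier G" using subgroup.mem_carrier[OF UH(5) h(1)] .
  define h' where "h' = g \<otimes>\<^bsub>G\<^esub> h \<otimes>\<^bsub>G\<^esub> inv\<^bsub>G\<^esub> g"
  have h': "h' \<in> conj_set G g H" using h(1) by (simp add: h'_def conj_set_eq_image)
  have "d h' = d h" using hG g by (simp add: h'_def \<Omega>.m_comm[of "d g"] \<Omega>.m_assoc)
  moreover have "f (conj_set G g H) = f H"
    using d_conj_set[OF subgroup.subset[OF UH(5)] g] by (simp add: abs_f_def ram_f_def)
  ultimately have dh': "d h' = \<omega> [^]\<^bsub>\<Omega>\<^esub> (int (f (conj_set G g H)) * k)" using h(2) by simp
  have cx: "con_map (pi_functor G) g (H, U) x = conj_set G g U #>\<^bsub>G\<^esub> h'"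
    using conj_set_rcos[OF subgroup.subset[OF UH(6)] hG g] by (simp add: pi_functor_def h(3) h'_def)
  note c = v_prime_pow[OF pts_M(1)[OF HU] p, of k]
  have "v (conj_set G g H) (con_map C g H (p [^]\<^bsub>A H\<^esub> k)) = \<omega> [^]\<^bsub>\<Omega>\<^esub> k"
    using v_structure_maps(3)[OF pts_M(1)[OF HU] g c(1)] c(2) by simp
  then have "upsilon G \<Omega> \<omega> d C q (conj_set G g H) (conj_set G g U) (conj_set G g U #>\<^bsub>G\<^esub> h') =
    N (conj_set G g H) (conj_set G g U) #>\<^bsub>A (conj_set G g H)\<^esub> con_map C g H (p [^]\<^bsub>A H\<^esub> k)"
    by (rule upsilon_eq[OF act_E[OF HU g] q h' dh' C_closed(3)[OF pts_M(1)[OF HU] g c(1)]])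
  then show ?thesis
    unfolding cx
    using H0_con[OF HU g c(1)] upsilon_eq[OF HU p h(1,2) c] h'
    by (simp add: h(3) carrier_quot)
qed

lemma upsilon_ric_isomorphism:
  assumes p: "\<And>H. H \<in> pts (flat E) \<Longrightarrow> prime_element \<omega> C v H (p H)"
  shows "ric_isomorphism G (conj_pair G) E (pi_functor G) (H0_functor G C)
    (\<lambda>(H, U). upsilon G \<Omega> \<omega> d C (p H) H U)"
proof (rule ric_isomorphism_transport[OF ric_E group_G ric_H0])
  have pr: "prime_element \<omega> C v H (p H)" if "(H, U) \<in> pts E" for H U
    using p[OF pts_flat[OF that]] .
  fix x assume x: "x \<in> pts E"
  obtain H U where xe: "x = (H, U)" by (cases x)
  have HU: "(H, U) \<in> pts E" using x xe by simp
  show "comm_group (obj_grp (pi_functor G) x)"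
    using comm_group_quot[OF unramified_ext_E[OF HU]] by (simp add: xe pi_obj)
  show "(\<lambda>(H, U). upsilon G \<Omega> \<omega> d C (p H) H U) x \<in> iso (obj_grp (pi_functor G) x) (obj_grp (H0_functor G C) x)"
    using upsilon_iso[OF HU pr[OF HU]] by (simp add: xe pi_obj H0_obj)
  { fix y a assume y: "y \<in> res_dom E x" and a: "a \<in> carrier (obj_grp (pi_functor G) x)"
    obtain I V where ye: "y = (I, V)" by (cases y)
    have IV: "(I, V) \<in> res_dom E (H, U)" using y xe ye by simp
    show "res_map (pi_functor G) y x a \<in> carrier (obj_grp (pi_functor G) y) \<and>
      (\<lambda>(H, U). upsilon G \<Omega> \<omega> d C (p H) H U) y (res_map (pi_functor G) y x a) =
      res_map (H0_functor G C) y x ((\<lambda>(H, U). upsilon G \<Omega> \<omega> d C (p H) H U) x a)"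
      using upsilon_res[OF HU IV pr[OF HU] pr[OF dom_E(1)[OF HU IV]], of a] a
      by (simp add: xe ye pi_obj) }
  { fix y a assume y: "y \<in> ind_dom E x" and a: "a \<in> carrier (obj_grp (pi_functor G) y)"
    obtain I V where ye: "y = (I, V)" by (cases y)
    have IV: "(I, V) \<in> ind_dom E (H, U)" using y xe ye by simp
    show "ind_map (pi_functor G) x y a \<in> carrier (obj_grp (pi_functor G) x) \<and>
      (\<lambda>(H, U). upsilon G \<Omega> \<omega> d C (p H) H U) x (ind_map (pi_functor G) x y a) =
      ind_map (H0_functor G C) x y ((\<lambda>(H, U). upsilon G \<Omega> \<omega> d C (p H) H U) y a)"
      using upsilon_ind[OF HU IV pr[OF HU] pr[OF dom_E(2)[OF HU IV]], of a] a
      by (simp add: xe ye pi_obj) }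
  { fix g a assume g: "g \<in> carrier G" and a: "a \<in> carrier (obj_grp (pi_functor G) x)"
    show "con_map (pi_functor G) g x a \<in> carrier (obj_grp (pi_functor G) (conj_pair G g x)) \<and>
      (\<lambda>(H, U). upsilon G \<Omega> \<omega> d C (p H) H U) (conj_pair G g x) (con_map (pi_functor G) g x a) =
      con_map (H0_functor G C) g x ((\<lambda>(H, U). upsilon G \<Omega> \<omega> d C (p H) H U) x a)"
      using upsilon_con[OF HU g pr[OF HU] pr[OF act_E[OF HU g]], of a] a
      by (simp add: xe pi_obj) }
qed

end

theorem theorem4p3p14:
  fixes G :: "'g monoid" and T :: "'g topology"
    and \<Omega> :: "'w monoid" and T\<Omega> :: "'w topology" and \<omega> :: 'w
    and d :: "'g \<Rightarrow> 'w"
    and E :: "('g set \<times> 'g set) ric_domain"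
    and M :: "'g set ric_domain"
    and C :: "('g, 'g set, 'c) ric_functor"
    and v :: "'g set \<Rightarrow> 'c \<Rightarrow> 'w"
    and p :: "'g set \<Rightarrow> 'c"
  assumes G: "compact_grp G T"
    and \<Omega>: "torsion_free_procyclic \<Omega> T\<Omega> \<omega>"
    and d_epi: "d \<in> epi G \<Omega>"
    and d_cont: "continuous_map T T\<Omega> d"
    and E: "unramified_spectrum G T \<Omega> d E"
    and Cv: "unramified_FN_datum G T \<Omega> \<omega> d E M C v"
    and p: "\<And>H. H \<in> pts (flat E) \<Longrightarrow> prime_element \<omega> C v H (p H)"
  shows
    "(\<forall>(H, U)\<in>pts E.
        \<comment> \<open>well defined on all of \<open>H/U\<close>\<close>
        carrier (quot_group G H U) =
          range (\<lambda>k::int. frobenius G \<Omega> \<omega> d H U [^]\<^bsub>quot_group G H U\<^esub> k) \<and>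
        (\<forall>k::int. upsilon G \<Omega> \<omega> d C (p H) H U
                     (frobenius G \<Omega> \<omega> d H U [^]\<^bsub>quot_group G H U\<^esub> k) =
                   norm_group C H U #>\<^bsub>obj_grp C H\<^esub> (p H [^]\<^bsub>obj_grp C H\<^esub> k)) \<and>
        \<comment> \<open>a homomorphism of abelian groups\<close>
        comm_group (quot_group G H U) \<and>
        comm_group (obj_grp C H Mod norm_group C H U) \<and>
        upsilon G \<Omega> \<omega> d C (p H) H U
          \<in> hom (quot_group G H U) (obj_grp C H Mod norm_group C H U) \<and>
        \<comment> \<open>independent of the choice of the prime element\<close>
        (\<forall>q. prime_element \<omega> C v H q \<longrightarrow>
           (\<forall>x\<in>carrier (quot_group G H U).
              upsilon G \<Omega> \<omega> d C q H U x = upsilon G \<Omega> \<omega> d C (p H) H U x))) \<and>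
     ric_isomorphism G (conj_pair G) E (pi_functor G) (H0_functor G C)
       (\<lambda>(H, U). upsilon G \<Omega> \<omega> d C (p H) H U)"
proof -
  have group_G: "group G" using G by (simp add: compact_grp_def topological_grp_def)
  interpret unramified_datum G T \<Omega> T\<Omega> \<omega> d E M C v
    by (intro unramified_datum.intro procyclic_degree.intro unramified_datum_axioms.intro)
      (fact group_G \<Omega> d_epi E Cv)+
  have pr: "prime_element \<omega> C v H (p H)" if "(H, U) \<in> pts E" for H U
    using p[OF pts_flat[OF that]] .
  show ?thesis
  proof (rule conjI, goal_cases)
    case 1
    show ?case
    proof (intro ballI, goal_cases)
      case (1 x)
      obtain H U where x: "x = (H, U)" by (cases x)
      have HU: "(H, U) \<in> pts E" using 1 x by simp
      note ur = unramified_ext_E[OF HU]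
      show ?case unfolding x prod.case
        using carrier_quot_eq_frobenius_powers[OF ur] upsilon_frobenius_pow[OF HU pr[OF HU]]
          comm_group_quot[OF ur] comm_group_H0[OF HU] upsilon_hom[OF HU pr[OF HU]]
          upsilon_independent[OF HU pr[OF HU]]
        by (intro conjI allI ballI impI)
    qed
  next
    case 2
    show ?case by (rule upsilon_ric_isomorphism[OF p])
  qed
qed

end
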